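(* Let $\omega$ be a measurable subset of $\Omega$. The limit $$\alpha^\infty(\omega)=\lim_{T\to+\infty}\alpha^T(\omega)$$ exists, and $$\lim_{T\to+\infty}\frac{C_T(\omega)}{T}=\min\left(\frac12 g_1(\omega),\ \alpha^\infty(\omega)\right).$$ Moreover, if $\frac12 g_1(\omega)<\alpha^\infty(\omega)$, then $g_1(\omega)$ is reached, i.e., the infimum in the definition of $g_1(\omega)$ is a minimum.
   Context: $(\Omega,g)$ is a compact connected Riemannian manifold of dimension $n$ without boundary, $v_g$ is its Riemannian volume measure (measurability is with respect to $v_g$), $\triangle_g$ is the Laplace-Beltrami operator. All functions are complex valued. Constants are removed: $(\phi_j)_{j\geq1}$ is a Hilbert basis of the space $L^2_0(\Omega)$ of zero-mean $L^2$ functions, consisting of eigenfunctions, $-\triangle_g\phi_j=\lambda_j^2\phi_j$, with $0<\lambda_1\leq\lambda_2\leq\cdots\to+\infty$ (counted with multiplicity). Set $\Lambda=\sqrt{-\triangle_g}$ and let $\mathcal{X}$ be the set of pairs $(y^0,y^1)$ with $y^0=\sum_j y^0_j\phi_j\in L^2_0(\Omega)$ and $y^1=\sum_j y^1_j\phi_j$ in the dual $H^{-1}$ of the space of zero-mean $H^1$ functions, normed by $$\Vert(y^0,y^1)\Vert_{L^2\times H^{-1}}^2=\Vert y^0\Vert_{L^2}^2+\Vert\Lambda^{-1}y^1\Vert_{L^2}^2=\sum_j\left(|y^0_j|^2+\lambda_j^{-2}|y^1_j|^2\right)<+\infty .$$ For $(y^0,y^1)\in\mathcal{X}$, $y$ denotes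 the solution of the wave equation $\partial_{tt}y-\triangle_g y=0$ with $y(0,\cdot)=y^0$, $\partial_ty(0,\cdot)=y^1$, i.e. $y(t)=\sum_j\left(y^0_j\cos(\lambda_jt)+y^1_j\frac{\sin(\lambda_jt)}{\lambda_j}\right)\phi_j$. For $T>0$ and measurable $\omega\subset\Omega$: $J_T^\omega(y^0,y^1)=\dfrac{\int_0^T\int_\omega|y(t,x)|^2\,dv_g\,dt}{\Vert(y^0,y^1)\Vert^2_{L^2\times H^{-1}}}$; the observability constant is $C_T(\omega)=\inf\{J_T^\omega(y^0,y^1): (y^0,y^1)\in\mathcal{X}\setminus\{(0,0)\}\}$; for $N\in\mathbb{N}$, $C_T^{>N}(\omega)$ is the infimum of $J_T^\omega(y^0,y^1)$ over those $(y^0,y^1)\in\mathcal{X}\setminus\{(0,0)\}$ with $y^0_j=y^1_j=0$ for $j=1,\dots,N$. The high-frequency observability constant is $\alpha^T(\omega)=\lim_{N\to+\infty}\frac1T C_T^{>N}(\omega)$ (the sequence is nondecreasing and bounded). The spectral quantity is $g_1(\omega)=\inf_{\phi}\frac{\int_\omega|\phi|^2dv_g}{\int_\Omega|\phi|^2dv_g}$, the infimum running over all nonconstant eigenfunctions $\phi$ of $-\triangle_g$. *)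

theory Defs
  imports "HOL-Analysis.Analysis"
begin

section \<open>Closed Riemannian manifolds\<close>

text \<open>The two predicates below are meant for open sets \<open>S\<close>.\<close>

primrec Ck_on ::
    "nat \<Rightarrow> 'a::real_normed_vector set \<Rightarrow> ('a \<Rightarrow> 'b::real_normed_vector) \<Rightarrow> bool" where
  "Ck_on 0 S f \<longleftrightarrow> continuous_on S f"
| "Ck_on (Suc k) S f \<longleftrightarrow>
     (\<forall>x\<in>S. f differentiable at x) \<and> (\<forall>v. Ck_on k S (\<lambda>x. frechet_derivative f (at x) v))"

definition smooth_on ::
    "'a::real_normed_vector set \<Rightarrow> ('a \<Rightarrow> 'b::real_normed_vector) \<Rightarrow> bool" where
  "smooth_on S f \<longleftrightarrow> (\<forall>k. Ck_on k S f)"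

definition chart_inv :: "('i \<Rightarrow> 'm set) \<Rightarrow> ('i \<Rightarrow> 'm \<Rightarrow> real^'n) \<Rightarrow> 'i \<Rightarrow> real^'n \<Rightarrow> 'm" where
  "chart_inv U \<kappa> i = inv_into (U i) (\<kappa> i)"

text \<open>
  The manifold is the whole type \<open>'m\<close>, of dimension \<open>CARD('n)\<close>, with an atlas of charts
  \<open>\<kappa> i\<close> on the open sets \<open>U i\<close>.  The metric is given by its coefficient matrices: \<open>g i x\<close> is
  the matrix \<open>(g\<^sub>a\<^sub>b)\<close> at the point of the \<open>i\<close>-th chart with coordinates \<open>x\<close>; the last
  assumption is the transformation law of a covariant 2-tensor.
\<close>

locale closed_riemannian_manifold =
  fixes U :: "'i \<Rightarrow> 'm::{t2_space, second_countable_topology} set"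
    and \<kappa> :: "'i \<Rightarrow> 'm \<Rightarrow> real^'n"
    and g :: "'i \<Rightarrow> real^'n \<Rightarrow> real^'n^'n"
  assumes compact_manifold: "compact (UNIV :: 'm set)"
    and connected_manifold: "connected (UNIV :: 'm set)"
    and cover: "(\<Union>i. U i) = UNIV"
    and open_dom: "open (U i)"
    and open_image: "open (\<kappa> i ` U i)"
    and chart: "homeomorphism (U i) (\<kappa> i ` U i) (\<kappa> i) (chart_inv U \<kappa> i)"
    and transition_smooth: "smooth_on (\<kappa> i ` (U i \<inter> U j)) (\<kappa> j \<circ> chart_inv U \<kappa> i)"
    and metric_smooth: "smooth_on (\<kappa> i ` U i) (g i)"
    and metric_sym: "x \<in> \<kappa> i ` U i \<Longrightarrow> transpose (g i x) = g i x"
    and metric_pos: "x \<in> \<kappa> i ` U i \<Longrightarrow> w \<noteq> 0 \<Longrightarrow> w \<bullet> (g i x *v w) > 0"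
    and metric_transform: "p \<in> U i \<inter> U j \<Longrightarrow>
      J = matrix (frechet_derivative (\<kappa> j \<circ> chart_inv U \<kappa> i) (at (\<kappa> i p))) \<Longrightarrow>
      g i (\<kappa> i p) = transpose J ** g j (\<kappa> j p) ** J"

text \<open>
  The Riemannian volume on Borel sets; the condition determines it, since the domains of
  countably many charts cover the manifold.  The measure space used below is its completion.
\<close>

definition riemannian_volume ::
    "('i \<Rightarrow> 'm::topological_space set) \<Rightarrow> ('i \<Rightarrow> 'm \<Rightarrow> real^'n) \<Rightarrow> ('i \<Rightarrow> real^'n \<Rightarrow> real^'n^'n)
     \<Rightarrow> 'm measure \<Rightarrow> bool" where
  "riemannian_volume U \<kappa> g vol \<longleftrightarrow> sets vol = sets borel \<and>
     (\<forall>i. \<forall>B\<in>sets borel. B \<subseteq> U i \<longrightarrow>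
        emeasure vol B = (\<integral>\<^sup>+x\<in>\<kappa> i ` B. ennreal (sqrt (det (g i x))) \<partial>lborel))"

definition smooth_fun ::
    "('i \<Rightarrow> 'm set) \<Rightarrow> ('i \<Rightarrow> 'm \<Rightarrow> real^'n) \<Rightarrow> ('m \<Rightarrow> complex) \<Rightarrow> bool" where
  "smooth_fun U \<kappa> u \<longleftrightarrow> (\<forall>i. smooth_on (\<kappa> i ` U i) (u \<circ> chart_inv U \<kappa> i))"

definition partial_deriv :: "'n \<Rightarrow> (real^'n \<Rightarrow> complex) \<Rightarrow> real^'n \<Rightarrow> complex" where
  "partial_deriv a f x = frechet_derivative f (at x) (axis a 1)"

text \<open>
  For a metric matrix \<open>G\<close> on an open set of coordinates:
  \<open>|G|\<^sup>-\<^sup>1\<^sup>/\<^sup>2 \<Sum>\<^sub>a \<partial>\<^sub>a (\<Sum>\<^sub>b |G|\<^sup>1\<^sup>/\<^sup>2 G\<^sup>a\<^sup>b \<partial>\<^sub>b f)\<close>.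
\<close>

definition laplace_coord ::
    "(real^'n \<Rightarrow> real^'n^'n) \<Rightarrow> (real^'n \<Rightarrow> complex) \<Rightarrow> real^'n \<Rightarrow> complex" where
  "laplace_coord G f x =
     (1 / sqrt (det (G x))) *\<^sub>R
       (\<Sum>a\<in>UNIV. partial_deriv a
          (\<lambda>z. \<Sum>b\<in>UNIV. (sqrt (det (G z)) * matrix_inv (G z) $ a $ b) *\<^sub>R partial_deriv b f z) x)"

text \<open>
  \<open>has_laplace_beltrami U \<kappa> g u f\<close> says \<open>\<triangle>\<^sub>g u = f\<close>.  The coordinate expression does not
  depend on the chart, so for smooth \<open>u\<close> there is exactly one such \<open>f\<close>.
\<close>

definition has_laplace_beltrami ::
    "('i \<Rightarrow> 'm set) \<Rightarrow> ('i \<Rightarrow> 'm \<Rightarrow> real^'n) \<Rightarrow> ('i \<Rightarrow> real^'n \<Rightarrow> real^'n^'n)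
     \<Rightarrow> ('m \<Rightarrow> complex) \<Rightarrow> ('m \<Rightarrow> complex) \<Rightarrow> bool" where
  "has_laplace_beltrami U \<kappa> g u f \<longleftrightarrow> smooth_fun U \<kappa> u \<and>
     (\<forall>i. \<forall>p\<in>U i. f p = laplace_coord (g i) (u \<circ> chart_inv U \<kappa> i) (\<kappa> i p))"

definition eigenfunction ::
    "('i \<Rightarrow> 'm set) \<Rightarrow> ('i \<Rightarrow> 'm \<Rightarrow> real^'n) \<Rightarrow> ('i \<Rightarrow> real^'n \<Rightarrow> real^'n^'n)
     \<Rightarrow> complex \<Rightarrow> ('m \<Rightarrow> complex) \<Rightarrow> bool" where
  "eigenfunction U \<kappa> g \<mu> u \<longleftrightarrow>
     (\<exists>p. u p \<noteq> 0) \<and> has_laplace_beltrami U \<kappa> g u (\<lambda>p. - \<mu> * u p)"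


section \<open>Zero-mean functions and spectral expansions\<close>

definition L2 :: "'m measure \<Rightarrow> ('m \<Rightarrow> complex) set" where
  "L2 M = {f \<in> borel_measurable M. integrable M (\<lambda>x. (cmod (f x))\<^sup>2)}"

definition L2_zero_mean :: "'m measure \<Rightarrow> ('m \<Rightarrow> complex) set" where
  "L2_zero_mean M = {f \<in> L2 M. (LINT x|M. f x) = 0}"

definition L2_inner :: "'m measure \<Rightarrow> ('m \<Rightarrow> complex) \<Rightarrow> ('m \<Rightarrow> complex) \<Rightarrow> complex" where
  "L2_inner M f h = (LINT x|M. f x * cnj (h x))"

definition L2_sums :: "'m measure \<Rightarrow> (nat \<Rightarrow> 'm \<Rightarrow> complex) \<Rightarrow> ('m \<Rightarrow> complex) \<Rightarrow> bool" where
  "L2_sums M h f \<longleftrightarrow> f \<in> L2 M \<and>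
     (\<lambda>N. LINT x|M. (cmod (f x - (\<Sum>j<N. h j x)))\<^sup>2) \<longlonglongrightarrow> 0"

definition hilbert_basis :: "'m measure \<Rightarrow> (nat \<Rightarrow> 'm \<Rightarrow> complex) \<Rightarrow> bool" where
  "hilbert_basis M \<phi> \<longleftrightarrow>
     (\<forall>j. \<phi> j \<in> L2_zero_mean M) \<and>
     (\<forall>j k. L2_inner M (\<phi> j) (\<phi> k) = (if j = k then 1 else 0)) \<and>
     (\<forall>f\<in>L2_zero_mean M. L2_sums M (\<lambda>j x. L2_inner M f (\<phi> j) * \<phi> j x) f)"

text \<open>
  Indices start at 0: \<open>\<phi> j\<close> and \<open>lam j\<close> stand for the eigenfunction and frequency usually
  numbered \<open>j + 1\<close>, so the first \<open>N\<close> modes are those with \<open>j < N\<close>.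

  Zero-mean \<open>H\<^sup>1\<close> functions form the domain of \<open>\<Lambda> = (-\<triangle>\<^sub>g)\<^sup>1\<^sup>/\<^sup>2\<close>, with norm
  \<open>\<parallel>\<Lambda> f\<parallel>\<close>.
\<close>

definition H1_zero_mean ::
    "'m measure \<Rightarrow> (nat \<Rightarrow> real) \<Rightarrow> (nat \<Rightarrow> 'm \<Rightarrow> complex) \<Rightarrow> ('m \<Rightarrow> complex) set" where
  "H1_zero_mean M lam \<phi> = {f \<in> L2_zero_mean M.
     summable (\<lambda>j. (lam j)\<^sup>2 * (cmod (L2_inner M f (\<phi> j)))\<^sup>2)}"

definition H1_norm ::
    "'m measure \<Rightarrow> (nat \<Rightarrow> real) \<Rightarrow> (nat \<Rightarrow> 'm \<Rightarrow> complex) \<Rightarrow> ('m \<Rightarrow> complex) \<Rightarrow> real" where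
  "H1_norm M lam \<phi> f = sqrt (\<Sum>j. (lam j)\<^sup>2 * (cmod (L2_inner M f (\<phi> j)))\<^sup>2)"

text \<open>
  The dual space consists of the bounded antilinear functionals, a zero-mean \<open>L\<^sup>2\<close> function \<open>h\<close>
  acting as \<open>\<lambda>f. L2_inner M h f\<close>.  Hence the \<open>j\<close>-th coefficient of \<open>F\<close> is \<open>F (\<phi> j)\<close>.
  Values of \<open>F\<close> outside \<open>H1_zero_mean\<close> are irrelevant.
\<close>

definition Hm1 ::
    "'m measure \<Rightarrow> (nat \<Rightarrow> real) \<Rightarrow> (nat \<Rightarrow> 'm \<Rightarrow> complex) \<Rightarrow> (('m \<Rightarrow> complex) \<Rightarrow> complex) set" where
  "Hm1 M lam \<phi> = {F.
     (\<forall>f\<in>H1_zero_mean M lam \<phi>. \<forall>h\<in>H1_zero_mean M lam \<phi>. \<forall>c.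
        F (\<lambda>x. f x + c * h x) = F f + cnj c * F h) \<and>
     (\<exists>C. \<forall>f\<in>H1_zero_mean M lam \<phi>. cmod (F f) \<le> C * H1_norm M lam \<phi> f)}"


section \<open>Waves and observability constants\<close>

text \<open>The admissible initial data: the nonzero elements of \<open>L\<^sup>2\<^sub>0 \<times> H\<^sup>-\<^sup>1\<close>.\<close>

definition nonzero_data ::
    "'m measure \<Rightarrow> (nat \<Rightarrow> real) \<Rightarrow> (nat \<Rightarrow> 'm \<Rightarrow> complex)
     \<Rightarrow> (('m \<Rightarrow> complex) \<times> (('m \<Rightarrow> complex) \<Rightarrow> complex)) set" where
  "nonzero_data M lam \<phi> = {(y0, y1). y0 \<in> L2_zero_mean M \<and> y1 \<in> Hm1 M lam \<phi> \<and>
     \<not> ((AE x in M. y0 x = 0) \<and> (\<forall>f\<in>H1_zero_mean M lam \<phi>. y1 f = 0))}"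

definition data_norm_sq ::
    "'m measure \<Rightarrow> (nat \<Rightarrow> real) \<Rightarrow> (nat \<Rightarrow> 'm \<Rightarrow> complex)
     \<Rightarrow> ('m \<Rightarrow> complex) \<Rightarrow> (('m \<Rightarrow> complex) \<Rightarrow> complex) \<Rightarrow> real" where
  "data_norm_sq M lam \<phi> y0 y1 =
     (LINT x|M. (cmod (y0 x))\<^sup>2) + (\<Sum>j. (cmod (y1 (\<phi> j)))\<^sup>2 / (lam j)\<^sup>2)"

definition wave_solution ::
    "'m measure \<Rightarrow> (nat \<Rightarrow> real) \<Rightarrow> (nat \<Rightarrow> 'm \<Rightarrow> complex)
     \<Rightarrow> ('m \<Rightarrow> complex) \<Rightarrow> (('m \<Rightarrow> complex) \<Rightarrow> complex) \<Rightarrow> (real \<Rightarrow> 'm \<Rightarrow> complex) \<Rightarrow> bool" where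
  "wave_solution M lam \<phi> y0 y1 y \<longleftrightarrow>
     (\<forall>t. L2_sums M
        (\<lambda>j x. (L2_inner M y0 (\<phi> j) * of_real (cos (lam j * t))
                + y1 (\<phi> j) * of_real (sin (lam j * t) / lam j)) * \<phi> j x) (y t))"

text \<open>
  For given data, a solution \<open>y\<close> is unique up to the choice, for each \<open>t\<close>, of a representative
  of \<open>y t\<close> modulo null sets, and the inner integral below does not depend on that choice.
\<close>

definition obs_ratio ::
    "'m measure \<Rightarrow> (nat \<Rightarrow> real) \<Rightarrow> (nat \<Rightarrow> 'm \<Rightarrow> complex) \<Rightarrow> 'm set \<Rightarrow> real
     \<Rightarrow> ('m \<Rightarrow> complex) \<Rightarrow> (('m \<Rightarrow> complex) \<Rightarrow> complex) \<Rightarrow> (real \<Rightarrow> 'm \<Rightarrow> complex) \<Rightarrow> real" where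
  "obs_ratio M lam \<phi> \<omega> T y0 y1 y =
     (LINT t:{0..T}|lborel. (LINT x:\<omega>|M. (cmod (y t x))\<^sup>2)) / data_norm_sq M lam \<phi> y0 y1"

definition obs_const ::
    "'m measure \<Rightarrow> (nat \<Rightarrow> real) \<Rightarrow> (nat \<Rightarrow> 'm \<Rightarrow> complex) \<Rightarrow> 'm set \<Rightarrow> real \<Rightarrow> real" where
  "obs_const M lam \<phi> \<omega> T = Inf {obs_ratio M lam \<phi> \<omega> T y0 y1 y | y0 y1 y.
     (y0, y1) \<in> nonzero_data M lam \<phi> \<and> wave_solution M lam \<phi> y0 y1 y}"

definition obs_const_above ::
    "'m measure \<Rightarrow> (nat \<Rightarrow> real) \<Rightarrow> (nat \<Rightarrow> 'm \<Rightarrow> complex) \<Rightarrow> nat \<Rightarrow> 'm set \<Rightarrow> real \<Rightarrow> real" where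
  "obs_const_above M lam \<phi> N \<omega> T = Inf {obs_ratio M lam \<phi> \<omega> T y0 y1 y | y0 y1 y.
     (y0, y1) \<in> nonzero_data M lam \<phi> \<and> wave_solution M lam \<phi> y0 y1 y \<and>
     (\<forall>j<N. L2_inner M y0 (\<phi> j) = 0 \<and> y1 (\<phi> j) = 0)}"

definition high_freq_const ::
    "'m measure \<Rightarrow> (nat \<Rightarrow> real) \<Rightarrow> (nat \<Rightarrow> 'm \<Rightarrow> complex) \<Rightarrow> 'm set \<Rightarrow> real \<Rightarrow> real" where
  "high_freq_const M lam \<phi> \<omega> T = lim (\<lambda>N. 1 / T * obs_const_above M lam \<phi> N \<omega> T)"

definition nonconstant_eigenfunctions ::
    "('i \<Rightarrow> 'm set) \<Rightarrow> ('i \<Rightarrow> 'm \<Rightarrow> real^'n) \<Rightarrow> ('i \<Rightarrow> real^'n \<Rightarrow> real^'n^'n)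
     \<Rightarrow> ('m \<Rightarrow> complex) set" where
  "nonconstant_eigenfunctions U \<kappa> g =
     {u. (\<exists>\<mu>. eigenfunction U \<kappa> g \<mu> u) \<and> \<not> (\<exists>c. \<forall>p. u p = c)}"

definition mass_ratio :: "'m measure \<Rightarrow> 'm set \<Rightarrow> ('m \<Rightarrow> complex) \<Rightarrow> real" where
  "mass_ratio M \<omega> u = (LINT x:\<omega>|M. (cmod (u x))\<^sup>2) / (LINT x|M. (cmod (u x))\<^sup>2)"

definition g1 ::
    "('i \<Rightarrow> 'm set) \<Rightarrow> ('i \<Rightarrow> 'm \<Rightarrow> real^'n) \<Rightarrow> ('i \<Rightarrow> real^'n \<Rightarrow> real^'n^'n)
     \<Rightarrow> 'm measure \<Rightarrow> 'm set \<Rightarrow> real" where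
  "g1 U \<kappa> g M \<omega> = (INF u\<in>nonconstant_eigenfunctions U \<kappa> g. mass_ratio M \<omega> u)"

end

theory Submission
  imports Defs
begin

text \<open>
  Write a wave as \<open>\<Sum>\<^sub>k c\<^sub>k(t) \<phi>\<^sub>k\<close> with \<open>c\<^sub>k(t) = p\<^sub>k cos (\<lambda>\<^sub>k t) + q\<^sub>k sin (\<lambda>\<^sub>k t)\<close>.  The
  energy seen in \<open>\<omega>\<close> is the Hermitian form of the Gram matrix
  \<open>W\<^sub>j\<^sub>k = \<integral>\<^sub>\<omega> \<phi>\<^sub>j cnj \<phi>\<^sub>k\<close> at \<open>c(t)\<close>, and \<open>0 \<le> W \<le> 1\<close>.  Truncations of data are again
  data, and energy and norm are limits over truncations; hence the observability constant of
  the modes \<open>k \<ge> N\<close> at time \<open>T\<close> is the largest \<open>m\<close> for which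
  \<open>m \<Sum>\<^sub>k (|p\<^sub>k|\<^sup>2 + |q\<^sub>k|\<^sup>2)\<close> bounds the energy over \<open>[0,T]\<close> from below for all finite sequences
  supported in \<open>k \<ge> N\<close> (\<open>obs_const_above_iff_observes\<close>).

  Translation in time preserves the norm of the data, so these constants are superadditive in
  \<open>T\<close>, and they lie between \<open>0\<close> and \<open>T\<close>.  Fekete's lemma gives the limit \<open>c\<close> of
  \<open>C\<^sub>T / T\<close> and the limit \<open>\<alpha>\<close> of the high-frequency constants, with \<open>c \<le> \<alpha>\<close>.  The data
  \<open>(u, i \<lambda> u)\<close> built from an eigenfunction \<open>u\<close> have constant energy, so \<open>2 c\<close> is a
  lower bound of the mass ratios of eigenfunctions.

  Conversely let \<open>c < \<alpha>\<close> and choose \<open>S\<close> and \<open>N\<close> such that the constant of the modes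
  \<open>k \<ge> N\<close> at time \<open>S\<close>, divided by \<open>S\<close>, exceeds \<open>c\<close>; by superadditivity this persists at
  all multiples \<open>T\<close> of \<open>S\<close>.  Split the wave into exponentials \<open>exp (\<plusminus> i \<lambda>\<^sub>k t)\<close>.  Two
  different frequencies, one of them below the cutoff, interact over \<open>[0,T]\<close> by an amount
  bounded uniformly in \<open>T\<close>: the time integral is at most \<open>2\<close> over the spectral gap, and the rows
  of \<open>W\<close> satisfy a Bessel inequality (\<open>observes_low_high\<close>).  Therefore \<open>C\<^sub>T / T\<close> is, up to
  \<open>O(1/T)\<close>, at least the minimum of the high-frequency constant and of half the smallest mass
  ratio among single-frequency combinations of the first \<open>N\<close> modes.  That smallest ratio is
  attained by compactness (\<open>one_frequency_minimizer\<close>), so it is at most \<open>2 c\<close>, and hence equal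
  to \<open>2 c\<close> (\<open>observability_limits\<close>).

  It remains to identify nonconstant eigenfunctions of the differential operator with
  single-frequency combinations of the basis.  This rests on the symmetry of the Laplacian,
  proved from its weak form \<open>\<integral> \<triangle>u cnj \<psi> = - \<integral> \<langle>\<nabla>u, \<nabla>\<psi>\<rangle>\<close>: a partition by bump functions
  reduces it to one chart, where it is the divergence theorem (\<open>weak_laplacian\<close>).
\<close>

section \<open>Energies of finite trigonometric sums\<close>

text \<open>
  The real part of the sesquilinear expression of the infinite matrix \<open>W\<close>, cut off at size
  \<open>n\<close>; it is the value itself when \<open>W\<close> is Hermitian.
\<close>

definition qform :: "(nat \<Rightarrow> nat \<Rightarrow> complex) \<Rightarrow> nat \<Rightarrow> (nat \<Rightarrow> complex) \<Rightarrow> real" where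
  "qform W n c = Re (\<Sum>j<n. \<Sum>k<n. c j * cnj (c k) * W j k)"

text \<open>
  Squared Euclidean norm of the first \<open>n\<close> coefficients.
\<close>

definition sqnorm :: "nat \<Rightarrow> (nat \<Rightarrow> complex) \<Rightarrow> real" where
  "sqnorm n c = (\<Sum>k<n. (cmod (c k))\<^sup>2)"

text \<open>
  The \<open>k\<close>-th coefficient of a wave at time \<open>t\<close>.  Here \<open>q k\<close> is the coefficient of the initial
  velocity already divided by the frequency, so that the norm of the data is Euclidean in
  \<open>(p, q)\<close>.
\<close>

definition mode_coeff ::
    "(nat \<Rightarrow> real) \<Rightarrow> (nat \<Rightarrow> complex) \<Rightarrow> (nat \<Rightarrow> complex) \<Rightarrow> real \<Rightarrow> nat \<Rightarrow> complex" where
  "mode_coeff lam p q t k = p k * of_real (cos (lam k * t)) + q k * of_real (sin (lam k * t))"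

text \<open>
  The energy over \<open>[0,T]\<close> of the wave with coefficients \<open>p\<close> and \<open>q\<close>.
\<close>

abbreviation observed_energy ::
    "(nat \<Rightarrow> real) \<Rightarrow> (nat \<Rightarrow> nat \<Rightarrow> complex) \<Rightarrow> nat \<Rightarrow> (nat \<Rightarrow> complex) \<Rightarrow> (nat \<Rightarrow> complex) \<Rightarrow> real \<Rightarrow> real"
  where "observed_energy lam W n p q T \<equiv> integral {0..T} (\<lambda>t. qform W n (mode_coeff lam p q t))"

text \<open>
  \<open>m\<close> is an admissible observability constant at time \<open>T\<close> for all finitely supported data
  without the first \<open>N\<close> modes.
\<close>

definition observes ::
    "(nat \<Rightarrow> real) \<Rightarrow> (nat \<Rightarrow> nat \<Rightarrow> complex) \<Rightarrow> nat \<Rightarrow> real \<Rightarrow> real \<Rightarrow> bool" where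
  "observes lam W N T m \<longleftrightarrow> (\<forall>p q n. (\<forall>k<N. p k = 0 \<and> q k = 0) \<longrightarrow>
     m * (sqnorm n p + sqnorm n q) \<le> observed_energy lam W n p q T)"

text \<open>
  Coefficient sequences supported in \<open>{..<n}\<close> and involving one value of \<open>lam\<close> only.  The
  frequency condition is written with products, which makes it visibly closed; the zero sequence
  is included.
\<close>

definition one_frequency :: "(nat \<Rightarrow> real) \<Rightarrow> nat \<Rightarrow> (nat \<Rightarrow> complex) \<Rightarrow> bool" where
  "one_frequency lam n u \<longleftrightarrow> (\<forall>k\<ge>n. u k = 0) \<and> (\<forall>j k. lam j \<noteq> lam k \<longrightarrow> u j * u k = 0)"

lemma sqnorm_nonneg [simp]: "0 \<le> sqnorm n c"
  by (simp add: sqnorm_def sum_nonneg)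

lemma sqnorm_extend:
  assumes "\<forall>k\<ge>m. c k = 0" "m \<le> n" shows "sqnorm n c = sqnorm m c"
  unfolding sqnorm_def by (rule sum.mono_neutral_right) (use assms in auto)

lemma qform_extend:
  assumes "\<forall>k\<ge>m. c k = 0" "m \<le> n" shows "qform W n c = qform W m c"
proof -
  have "(\<Sum>j<n. \<Sum>k<n. c j * cnj (c k) * W j k) = (\<Sum>j<m. \<Sum>k<n. c j * cnj (c k) * W j k)"
    by (rule sum.mono_neutral_right) (use assms in auto)
  also have "\<dots> = (\<Sum>j<m. \<Sum>k<m. c j * cnj (c k) * W j k)"
    by (intro sum.cong refl sum.mono_neutral_right) (use assms in auto)
  finally show ?thesis by (simp add: qform_def)
qed

lemma continuous_on_mode_coeff [continuous_intros]:
  "continuous_on S (\<lambda>t. mode_coeff lam p q t k)"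
  unfolding mode_coeff_def by (intro continuous_intros)

lemma continuous_on_qform_mode_coeff [continuous_intros]:
  "continuous_on S (\<lambda>t. qform W n (mode_coeff lam p q t))"
  unfolding qform_def by (intro continuous_intros)

lemma integrable_qform_mode_coeff [simp]:
  "(\<lambda>t. qform W n (mode_coeff lam p q t)) integrable_on {a..b}"
  by (intro integrable_continuous_real continuous_intros)

text \<open>
  Evolution by any time rotates each pair \<open>(p k, q k)\<close> and preserves the norm of the data.
\<close>

lemma sqnorm_rotate:
  "sqnorm n (\<lambda>k. p k * of_real (cos (f k)) + q k * of_real (sin (f k))) +
   sqnorm n (\<lambda>k. q k * of_real (cos (f k)) - p k * of_real (sin (f k))) = sqnorm n p + sqnorm n q"
proof -
  have *: "(cmod (a * of_real (cos x) + b * of_real (sin x)))\<^sup>2 +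
        (cmod (b * of_real (cos x) - a * of_real (sin x)))\<^sup>2 = (cmod a)\<^sup>2 + (cmod b)\<^sup>2" for a b x
  proof -
    have "(a1 * cos x + b1 * sin x)\<^sup>2 + (b1 * cos x - a1 * sin x)\<^sup>2 = a1\<^sup>2 + b1\<^sup>2" for a1 b1 :: real
    proof -
      have "(a1 * cos x + b1 * sin x)\<^sup>2 + (b1 * cos x - a1 * sin x)\<^sup>2
        = (a1\<^sup>2 + b1\<^sup>2) * ((sin x)\<^sup>2 + (cos x)\<^sup>2)" by algebra
      then show ?thesis by simp
    qed
    from this[of "Re a" "Re b"] this[of "Im a" "Im b"] show ?thesis
      by (simp add: cmod_power2)
  qed
  show ?thesis by (simp add: sqnorm_def * flip: sum.distrib)
qed

lemma sqnorm_mode_coeff_le: "sqnorm n (mode_coeff lam p q t) \<le> sqnorm n p + sqnorm n q"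
  using sqnorm_rotate[of n p "\<lambda>k. lam k * t" q] sqnorm_nonneg[of n "\<lambda>k. q k * of_real (cos (lam k * t)) - p k * of_real (sin (lam k * t))"]
  unfolding mode_coeff_def[abs_def] by linarith

lemma mode_coeff_shift:
  "mode_coeff lam p q (t + s) =
   mode_coeff lam (\<lambda>k. p k * of_real (cos (lam k * s)) + q k * of_real (sin (lam k * s)))
     (\<lambda>k. q k * of_real (cos (lam k * s)) - p k * of_real (sin (lam k * s))) t"
  by (simp add: fun_eq_iff mode_coeff_def distrib_left cos_add sin_add algebra_simps)

lemma observesD:
  assumes "observes lam W N T m" "\<And>k. k < N \<Longrightarrow> p k = 0 \<and> q k = 0"
  shows "m * (sqnorm n p + sqnorm n q) \<le> observed_energy lam W n p q T"
  using assms by (simp add: observes_def)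

lemma observes_higher_cutoff:
  assumes "observes lam W N T m" "N \<le> N'" shows "observes lam W N' T m"
  using assms unfolding observes_def by (meson order_less_le_trans)

text \<open>
  Superadditivity in time: the energy over \<open>[S, S + T]\<close> is the energy over \<open>[0, T]\<close> of the
  rotated data.
\<close>

lemma observes_add:
  assumes "observes lam W N S a" "observes lam W N T b" "0 \<le> S" "0 \<le> T"
  shows "observes lam W N (S + T) (a + b)"
  unfolding observes_def
proof (intro allI impI)
  fix p q :: "nat \<Rightarrow> complex" and n assume z: "\<forall>k<N. p k = 0 \<and> q k = 0"
  let ?p = "\<lambda>k. p k * of_real (cos (lam k * S)) + q k * of_real (sin (lam k * S))"
  let ?q = "\<lambda>k. q k * of_real (cos (lam k * S)) - p k * of_real (sin (lam k * S))"
  let ?E = "\<lambda>t. qform W n (mode_coeff lam p q t)"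
  have split: "integral {0..S + T} ?E = integral {0..S} ?E + integral {S..S + T} ?E"
    by (rule Henstock_Kurzweil_Integration.integral_combine[symmetric]) (use assms in auto)
  have shift: "integral {S..S + T} ?E = observed_energy lam W n ?p ?q T"
    using integral_shift_Icc_real[of 0 T ?E S]
    by (simp only: o_def add.commute[of S] mode_coeff_shift add_0)
  have late: "b * (sqnorm n ?p + sqnorm n ?q) \<le> observed_energy lam W n ?p ?q T"
    by (rule observesD[OF assms(2)]) (simp add: z)
  have early: "a * (sqnorm n p + sqnorm n q) \<le> integral {0..S} ?E"
    by (rule observesD[OF assms(1)]) (simp add: z)
  show "(a + b) * (sqnorm n p + sqnorm n q) \<le> integral {0..S + T} ?E"
    using early late unfolding split shift sqnorm_rotate distrib_right by (rule add_mono)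
qed

section \<open>Superadditive functions, oscillatory integrals and the Bessel inequality\<close>

text \<open>
  Fekete's lemma for a real parameter.  The bounds \<open>0 \<le> f t \<le> t\<close> replace local boundedness, and
  the last conjunct says that \<open>f t / t\<close> exceeds every number below the limit.
\<close>

lemma superadditive_limit:
  fixes f :: "real \<Rightarrow> real"
  assumes super: "\<And>s t. 0 \<le> s \<Longrightarrow> 0 \<le> t \<Longrightarrow> f s + f t \<le> f (s + t)"
    and bounds: "\<And>t. 0 \<le> t \<Longrightarrow> 0 \<le> f t \<and> f t \<le> t"
  shows "\<exists>L. ((\<lambda>t. f t / t) \<longlongrightarrow> L) at_top \<and> (\<forall>m<L. \<exists>t>0. m < f t / t)"
proof -
  define L where "L = (SUP t\<in>{0<..}. f t / t)"
  have bdd: "bdd_above ((\<lambda>t. f t / t) ` {0<..})"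
    by (rule bdd_aboveI2[where M = 1]) (use bounds in auto)
  have upper: "f t / t \<le> L" if "0 < t" for t
    unfolding L_def by (rule cSUP_upper[OF _ bdd]) (use that in auto)
  have near: "\<exists>t>0. m < f t / t" if "m < L" for m
    using that less_cSUP_iff[OF _ bdd] unfolding L_def by fastforce
  have mult: "real k * f s \<le> f (real k * s)" if "0 \<le> s" for k s
  proof (induction k)
    case 0 then show ?case using bounds[of 0] by simp
  next
    case (Suc k)
    then show ?case using super[of "real k * s" s] that by (simp add: distrib_right algebra_simps)
  qed
  have "((\<lambda>t. f t / t) \<longlongrightarrow> L) at_top"
  proof (rule order_tendstoI)
    fix a assume "a < L"
    then obtain s where s: "s > 0" "a < f s / s" using near by blast
    have fs: "0 \<le> f s" "f s \<le> s" using bounds[of s] s by auto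
    have low: "f s / s - f s / t \<le> f t / t" if t: "t > 0" for t
    proof -
      define k where "k = nat \<lfloor>t / s\<rfloor>"
      have k: "real k \<le> t / s" "t / s < real k + 1"
        using t s unfolding k_def by (auto simp: of_nat_nat)
      have ks: "real k * s \<le> t" using k s by (simp add: field_simps)
      \<comment> \<open>superadditivity and \<open>0 \<le> f\<close> make \<open>f\<close> nondecreasing\<close>
      have "real k * f s \<le> f (real k * s)" using mult s by simp
      also have "\<dots> \<le> f t"
        using super[of "real k * s" "t - real k * s"] bounds[of "t - real k * s"] s ks by auto
      finally have "real k * f s \<le> f t" .
      moreover have "(t / s - 1) * f s \<le> real k * f s"
        by (rule mult_right_mono) (use k fs in auto)
      ultimately have "(t / s - 1) * f s / t \<le> f t / t"
        using t by (intro divide_right_mono) auto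
      then show ?thesis using t s by (simp add: field_simps)
    qed
    have "((\<lambda>t. f s / s - f s / t) \<longlongrightarrow> f s / s - 0) at_top"
      by (intro tendsto_intros tendsto_divide_0[OF tendsto_const] filterlim_at_top_imp_at_infinity filterlim_ident)
    then have "\<forall>\<^sub>F t in at_top. a < f s / s - f s / t"
      using s by (intro order_tendstoD) auto
    then show "\<forall>\<^sub>F t in at_top. a < f t / t"
      using eventually_gt_at_top[of 0] by eventually_elim (use low in force)
  next
    fix a assume a: "L < a"
    show "\<forall>\<^sub>F t in at_top. f t / t < a"
      using eventually_gt_at_top[of "0::real"] by eventually_elim (use upper a in force)
  qed
  then show ?thesis using near by blast
qed

text \<open>
  The oscillatory integral \<open>\<integral>\<^sub>0\<^sup>T exp (i \<theta> t) dt\<close>, with value \<open>0\<close> for negative \<open>T\<close>.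
\<close>

definition osc :: "real \<Rightarrow> real \<Rightarrow> complex" where
  "osc T \<theta> = integral {0..T} (\<lambda>t. cis (\<theta> * t))"

lemma osc_0 [simp]: "0 \<le> T \<Longrightarrow> osc T 0 = of_real T"
  by (simp add: osc_def scaleR_conv_of_real)

lemma cis_has_integral: "((\<lambda>t. cis (\<theta> * t)) has_integral osc T \<theta>) {0..T}"
  unfolding osc_def by (intro integrable_integral integrable_continuous_real continuous_intros)

lemma cmod_osc_le:
  assumes "\<theta> \<noteq> 0" shows "cmod (osc T \<theta>) \<le> 2 / \<bar>\<theta>\<bar>"
proof (cases "0 \<le> T")
  case True
  have "((\<lambda>t. cis (\<theta> * t) / (\<i> * of_real \<theta>)) has_vector_derivative cis (\<theta> * t)) (at t within S)" for t S
  proof -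
    have "((\<lambda>t. exp (\<i> * (of_real \<theta> * of_real t)) / (\<i> * of_real \<theta>)) has_vector_derivative
        exp (\<i> * (of_real \<theta> * of_real t)) * (\<i> * \<theta>) / (\<i> * of_real \<theta>)) (at t within S)"
      by (rule has_vector_derivative_real_field) (use assms in \<open>auto intro!: derivative_eq_intros simp: mult.left_commute[of \<i> _ \<i>]\<close>)
    then show ?thesis using assms by (simp add: cis_conv_exp mult.left_commute[of \<i> _ \<i>])
  qed
  then have "((\<lambda>t. cis (\<theta> * t)) has_integral (cis (\<theta> * T) / (\<i> * of_real \<theta>) - cis (\<theta> * 0) / (\<i> * of_real \<theta>))) {0..T}"
    by (intro fundamental_theorem_of_calculus[OF True])
  then have "osc T \<theta> = (cis (\<theta> * T) - 1) / (\<i> * of_real \<theta>)"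
    unfolding osc_def by (simp add: integral_unique diff_divide_distrib)
  then have "cmod (osc T \<theta>) = cmod (cis (\<theta> * T) - 1) / \<bar>\<theta>\<bar>"
    by (simp add: norm_divide norm_mult)
  also have "cmod (cis (\<theta> * T) - 1) \<le> 2"
    using norm_triangle_ineq4[of "cis (\<theta> * T)" 1] by simp
  finally show ?thesis by (simp add: divide_right_mono)
qed (simp add: osc_def)

lemma cnj_osc: "cnj (osc T \<theta>) = osc T (- \<theta>)"
  by (simp add: osc_def integral_cnj cis_cnj)


text \<open>
  A real mode \<open>k\<close> splits into two exponentials, indexed by \<open>(k, s)\<close>: frequency \<open>lam k\<close> for
  \<open>s = True\<close> and \<open>- lam k\<close> for \<open>s = False\<close>.
\<close>

definition frq :: "(nat \<Rightarrow> real) \<Rightarrow> nat \<times> bool \<Rightarrow> real" where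
  "frq lam x = (if snd x then lam (fst x) else - lam (fst x))"

text \<open>
  The amplitudes of these exponentials, from Euler's formulas.
\<close>

definition amp :: "(nat \<Rightarrow> complex) \<Rightarrow> (nat \<Rightarrow> complex) \<Rightarrow> nat \<times> bool \<Rightarrow> complex" where
  "amp p q x = (if snd x then p (fst x) - \<i> * q (fst x) else p (fst x) + \<i> * q (fst x)) / 2"

abbreviation modes :: "nat \<Rightarrow> (nat \<times> bool) set" where
  "modes n \<equiv> {..<n} \<times> UNIV"

lemma sum_modes: "(\<Sum>x\<in>A \<times> UNIV. f x) = (\<Sum>k\<in>A. f (k, True) + f (k, False))"
  by (simp add: sum.cartesian_product' UNIV_bool add.commute)

lemma mode_coeff_eq_exponentials:
  "mode_coeff lam p q t k = (\<Sum>s\<in>UNIV. amp p q (k, s) * cis (frq lam (k, s) * t))"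
  by (simp add: mode_coeff_def amp_def frq_def UNIV_bool complex_eq_iff field_simps)

lemma sqnorm_eq_amp:
  "sqnorm n p + sqnorm n q = 2 * (\<Sum>x\<in>modes n. (cmod (amp p q x))\<^sup>2)"
proof -
  have "(cmod (p k))\<^sup>2 + (cmod (q k))\<^sup>2
      = 2 * ((cmod (amp p q (k, True)))\<^sup>2 + (cmod (amp p q (k, False)))\<^sup>2)" for k
    by (simp add: amp_def cmod_power2 norm_divide power_divide) (simp add: power2_eq_square field_simps)
  then show ?thesis
    by (simp add: sqnorm_def sum_modes sum_distrib_left flip: sum.distrib)
qed

lemma integral_qform_eq:
  "observed_energy lam W n p q T =
   (\<Sum>x\<in>modes n. \<Sum>y\<in>modes n.
      Re (amp p q x * cnj (amp p q y) * W (fst x) (fst y) * osc T (frq lam x - frq lam y)))"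
proof -
  have "qform W n (mode_coeff lam p q t) =
      (\<Sum>x\<in>modes n. \<Sum>y\<in>modes n.
      Re (amp p q x * cnj (amp p q y) * W (fst x) (fst y) * cis ((frq lam x - frq lam y) * t)))" for t
  proof -
    have "mode_coeff lam p q t j * cnj (mode_coeff lam p q t k) * W j k =
      (\<Sum>s\<in>UNIV. \<Sum>s'\<in>UNIV. amp p q (j, s) * cnj (amp p q (k, s')) * W j k * cis ((frq lam (j, s) - frq lam (k, s')) * t))" for j k
    proof -
      have cis: "cis ((a - b) * t) = cis (a * t) * cnj (cis (b * t))" for a b
        by (simp add: cis_cnj cis_mult left_diff_distrib)
      show ?thesis
        unfolding mode_coeff_eq_exponentials cis cnj_sum complex_cnj_mult sum_product sum_distrib_right
        by (simp add: mult_ac sum_distrib_left)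
    qed
    then have "qform W n (mode_coeff lam p q t) = Re (\<Sum>j<n. \<Sum>k<n.
      (\<Sum>s\<in>UNIV. \<Sum>s'\<in>UNIV. amp p q (j, s) * cnj (amp p q (k, s')) * W j k * cis ((frq lam (j, s) - frq lam (k, s')) * t)))"
      unfolding qform_def by simp
    also have "\<dots> = (\<Sum>x\<in>modes n. \<Sum>y\<in>modes n.
      Re (amp p q x * cnj (amp p q y) * W (fst x) (fst y) * cis ((frq lam x - frq lam y) * t)))"
      by (simp add: sum.cartesian_product' sum.distrib UNIV_bool add_ac)
    finally show ?thesis .
  qed
  moreover have "((\<lambda>t. \<Sum>x\<in>modes n. \<Sum>y\<in>modes n.
      Re (amp p q x * cnj (amp p q y) * W (fst x) (fst y) * cis ((frq lam x - frq lam y) * t))) has_integral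
     (\<Sum>x\<in>modes n. \<Sum>y\<in>modes n.
      Re (amp p q x * cnj (amp p q y) * W (fst x) (fst y) * osc T (frq lam x - frq lam y)))) {0..T}"
    by (intro has_integral_sum has_integral_Re has_integral_mult_right cis_has_integral finite_cartesian_product) auto
  ultimately show ?thesis by (simp add: integral_unique)
qed

text \<open>
  Hermitian matrices between \<open>0\<close> and \<open>1\<close>; the Gram matrix of an orthonormal family restricted to
  a measurable set is the example in mind.
\<close>

locale gram_bounds =
  fixes W :: "nat \<Rightarrow> nat \<Rightarrow> complex"
  assumes qform_nonneg: "0 \<le> qform W n c"
    and qform_le: "qform W n c \<le> sqnorm n c"
    and hermitian: "W k j = cnj (W j k)"
begin

text \<open>
  Since \<open>0 \<le> W \<le> 1\<close>, every row of \<open>W\<close> lies in the unit ball of \<open>\<ell>\<^sup>2\<close>.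
\<close>

lemma gram_row_bessel: "(\<Sum>k<n. (cmod (W j k))\<^sup>2) \<le> 1"
proof -
  define m where "m = Suc (max j n)"
  define s where "s = (\<Sum>k<m. (cmod (W j k))\<^sup>2)"
  let ?e = "\<lambda>k. if k = j then 1 else (0::complex)"
  have jm: "j < m" by (simp add: m_def)
  have e: "qform W m ?e = Re (W j j)"
  proof -
    have "(\<Sum>b<m. ?e a * cnj (?e b) * W a b) = (if a = j then W j j else 0)" for a
      using jm by (cases "a = j")
        (simp_all add: if_distrib[where f = cnj] if_distrib[where f = "\<lambda>x. x * _"] cong: if_cong)
    then show ?thesis using jm by (simp add: qform_def del: Re_sum)
  qed
  have ej: "sqnorm m ?e = 1"
    using jm by (simp add: sqnorm_def if_distrib[where f = cmod] if_distrib[where f = "\<lambda>x. x\<^sup>2"] cong: if_cong)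
  \<comment> \<open>test positivity on the unit vector \<open>e\<^sub>j\<close> minus the \<open>j\<close>-th row of \<open>W\<close>\<close>
  have "(\<Sum>a<m. \<Sum>b<m. (?e a - W j a) * cnj (?e b - W j b) * W a b)
      = W j j - (\<Sum>b<m. cnj (W j b) * W j b) - (\<Sum>a<m. W j a * W a j)
        + (\<Sum>a<m. \<Sum>b<m. W j a * cnj (W j b) * W a b)"
  proof -
    have "(\<Sum>a<m. \<Sum>b<m. if a = j then h b else 0) = (\<Sum>b<m. h b)" for h :: "nat \<Rightarrow> complex"
      by (subst sum.swap) (use jm in simp)
    then show ?thesis
    using jm by (simp add: algebra_simps sum.distrib sum_subtractf if_distrib[where f = cnj] if_distrib[where f = "\<lambda>x. x * _"]
       if_distrib[where f = "\<lambda>x. _ * x"] cong: if_cong)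
  qed
  moreover have "(\<Sum>b<m. cnj (W j b) * W j b) = of_real s"
    by (simp add: s_def complex_norm_square mult.commute del: of_real_power)
  moreover have "(\<Sum>a<m. W j a * W a j) = of_real s"
    by (subst hermitian) (simp add: s_def complex_norm_square mult.commute del: of_real_power)
  ultimately have "qform W m (\<lambda>a. ?e a - W j a) = Re (W j j) - 2 * s + qform W m (W j)"
    by (simp add: qform_def)
  then have "2 * s \<le> Re (W j j) + qform W m (W j)"
    using qform_nonneg[of m "\<lambda>a. ?e a - W j a"] by simp
  also have "\<dots> \<le> 1 + s"
    using qform_le[of m ?e] qform_le[of m "W j"] unfolding e ej by (simp add: sqnorm_def s_def)
  finally have "s \<le> 1" by simp
  moreover have "(\<Sum>k<n. (cmod (W j k))\<^sup>2) \<le> s"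
    unfolding s_def by (rule sum_mono2) (auto simp: m_def)
  ultimately show ?thesis by simp
qed

text \<open>
  The bound does not depend on \<open>n\<close>: by the inequality \<open>2 a b \<le> a\<^sup>2 + b\<^sup>2\<close> each low mode costs one
  Bessel sum and half of the total norm.
\<close>

lemma low_mode_interaction_bound:
  assumes "N \<le> n"
  shows "(\<Sum>x\<in>modes N. \<Sum>y\<in>modes n. cmod (f x) * cmod (f y) * cmod (W (fst x) (fst y)))
      \<le> (1 + real N) * (\<Sum>x\<in>modes n. (cmod (f x))\<^sup>2)"
proof -
  let ?A = "\<Sum>x\<in>modes n. (cmod (f x))\<^sup>2"
  have "(\<Sum>y\<in>modes n. cmod (f x) * cmod (f y) * cmod (W (fst x) (fst y))) \<le> (cmod (f x))\<^sup>2 + ?A / 2" for x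
  proof -
    have "(\<Sum>y\<in>modes n. cmod (f x) * cmod (f y) * cmod (W (fst x) (fst y)))
        \<le> (\<Sum>y\<in>modes n. (cmod (f x))\<^sup>2 * (cmod (W (fst x) (fst y)))\<^sup>2 / 2 + (cmod (f y))\<^sup>2 / 2)"
    proof (rule sum_mono)
      fix y
      show "cmod (f x) * cmod (f y) * cmod (W (fst x) (fst y))
        \<le> (cmod (f x))\<^sup>2 * (cmod (W (fst x) (fst y)))\<^sup>2 / 2 + (cmod (f y))\<^sup>2 / 2"
        using sum_squares_bound[of "cmod (f x) * cmod (W (fst x) (fst y))" "cmod (f y)"]
        by (simp add: power_mult_distrib mult_ac)
    qed
    also have "\<dots> = (cmod (f x))\<^sup>2 * (\<Sum>k<n. (cmod (W (fst x) k))\<^sup>2) + ?A / 2"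
      by (simp add: sum.distrib sum_modes add_divide_distrib flip: sum_divide_distrib sum_distrib_left)
    also have "\<dots> \<le> (cmod (f x))\<^sup>2 * 1 + ?A / 2"
      by (intro add_right_mono mult_left_mono gram_row_bessel) auto
    finally show ?thesis by simp
  qed
  then have "(\<Sum>x\<in>modes N. \<Sum>y\<in>modes n. cmod (f x) * cmod (f y) * cmod (W (fst x) (fst y)))
      \<le> (\<Sum>x\<in>modes N. (cmod (f x))\<^sup>2 + ?A / 2)"
    by (intro sum_mono)
  also have "\<dots> = (\<Sum>x\<in>modes N. (cmod (f x))\<^sup>2) + N * ?A"
    by (simp add: sum.distrib card_cartesian_product)
  also have "(\<Sum>x\<in>modes N. (cmod (f x))\<^sup>2) \<le> ?A"
    by (rule sum_mono2) (use assms in auto)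
  finally show ?thesis by (simp add: distrib_right)
qed

end

section \<open>Separating low from high frequencies\<close>

lemma qform_cong: "(\<And>k. k < n \<Longrightarrow> c k = c' k) \<Longrightarrow> qform W n c = qform W n c'"
  by (simp add: qform_def)

lemma sqnorm_cong: "(\<And>k. k < n \<Longrightarrow> c k = c' k) \<Longrightarrow> sqnorm n c = sqnorm n c'"
  by (simp add: sqnorm_def)

lemma one_frequencyI:
  assumes "\<And>k. k \<ge> n \<Longrightarrow> u k = 0" "\<And>k. u k \<noteq> 0 \<Longrightarrow> lam k = \<mu>"
  shows "one_frequency lam n u"
  using assms unfolding one_frequency_def by (metis mult_eq_0_iff)

text \<open>
  Data may be padded by zeros, so it suffices to consider truncation levels \<open>n \<ge> M\<close>.
\<close>

lemma observesI:
  assumes "\<And>p q n. M \<le> n \<Longrightarrow> \<forall>k<N. p k = 0 \<and> q k = 0 \<Longrightarrow>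
     m * (sqnorm n p + sqnorm n q) \<le> observed_energy lam W n p q T"
  shows "observes lam W N T m"
  unfolding observes_def
proof (intro allI impI)
  fix p q :: "nat \<Rightarrow> complex" and n :: nat assume z: "\<forall>k<N. p k = 0 \<and> q k = 0"
  let ?c = "\<lambda>p k. if k < n then p k else 0 :: complex"
  have "qform W (max n M) (mode_coeff lam (?c p) (?c q) t) = qform W n (mode_coeff lam p q t)" for t
    by (subst qform_extend[of n]) (auto simp: mode_coeff_def intro!: qform_cong)
  moreover have "sqnorm (max n M) (?c p) = sqnorm n p" for p
    by (subst sqnorm_extend[of n]) (auto intro!: sqnorm_cong)
  ultimately show "m * (sqnorm n p + sqnorm n q) \<le> observed_energy lam W n p q T"
    using assms[of "max n M" "?c p" "?c q"] z by simp
qed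

context gram_bounds
begin

text \<open>
  Deleting the interaction of different frequencies makes the form block diagonal, and each block
  acts on sequences with one frequency.
\<close>

lemma frequency_blocks_lower_bound:
  assumes \<gamma>: "\<And>v. one_frequency lam N v \<Longrightarrow> \<gamma> * sqnorm N v \<le> qform W N v"
  shows "\<gamma> * sqnorm N a \<le> (\<Sum>j<N. \<Sum>k<N. if lam j = lam k then Re (a j * cnj (a k) * W j k) else 0)"
proof -
  let ?F = "lam ` {..<N}"
  define v where "v \<mu> k = (if k < N \<and> lam k = \<mu> then a k else 0)" for \<mu> k
  have "\<gamma> * sqnorm N a = (\<Sum>\<mu>\<in>?F. \<gamma> * sqnorm N (v \<mu>))"
  proof -
    have "(\<Sum>\<mu>\<in>?F. sqnorm N (v \<mu>)) = (\<Sum>k<N. \<Sum>\<mu>\<in>?F. (cmod (v \<mu> k))\<^sup>2)"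
      unfolding sqnorm_def by (rule sum.swap)
    also have "\<dots> = sqnorm N a"
      unfolding sqnorm_def
    proof (intro sum.cong refl)
      fix k assume k: "k \<in> {..<N}"
      have "(\<Sum>\<mu>\<in>?F. (cmod (v \<mu> k))\<^sup>2) = (\<Sum>\<mu>\<in>?F. if lam k = \<mu> then (cmod (a k))\<^sup>2 else 0)"
        using k by (intro sum.cong) (auto simp: v_def)
      then show "(\<Sum>\<mu>\<in>?F. (cmod (v \<mu> k))\<^sup>2) = (cmod (a k))\<^sup>2" using k by simp
    qed
    finally show ?thesis by (simp add: sum_distrib_left[symmetric])
  qed
  also have "\<dots> \<le> (\<Sum>\<mu>\<in>?F. qform W N (v \<mu>))"
    by (intro sum_mono \<gamma> one_frequencyI[where \<mu> = \<mu> for \<mu>]) (auto simp: v_def split: if_splits)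
  also have "\<dots> = (\<Sum>j<N. \<Sum>k<N. \<Sum>\<mu>\<in>?F. Re (v \<mu> j * cnj (v \<mu> k) * W j k))"
    unfolding qform_def Re_sum by (subst sum.swap, rule sum.cong[OF refl], rule sum.swap)
  also have "\<dots> = (\<Sum>j<N. \<Sum>k<N. if lam j = lam k then Re (a j * cnj (a k) * W j k) else 0)"
  proof (intro sum.cong refl)
    fix j k assume j: "j \<in> {..<N}" and k: "k \<in> {..<N}"
    have "(\<Sum>\<mu>\<in>?F. Re (v \<mu> j * cnj (v \<mu> k) * W j k)) =
        (\<Sum>\<mu>\<in>?F. if lam j = \<mu> then (if lam j = lam k then Re (a j * cnj (a k) * W j k) else 0) else 0)"
      using j k by (intro sum.cong) (auto simp: v_def)
    then show "(\<Sum>\<mu>\<in>?F. Re (v \<mu> j * cnj (v \<mu> k) * W j k)) =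
        (if lam j = lam k then Re (a j * cnj (a k) * W j k) else 0)" using j by simp
  qed
  finally show ?thesis .
qed

text \<open>
  An observability constant for the modes \<open>k \<ge> N\<close> and a lower bound \<open>\<gamma>\<close> for single-frequency
  combinations of the modes \<open>k < N\<close> combine to a constant for all data, up to an error that
  does not depend on \<open>T\<close>.  The factor \<open>1/2\<close> reflects that the squared norm of the data is
  twice that of the amplitudes.
\<close>

lemma observes_low_high:
  assumes N: "observes lam W N T m" and T: "0 \<le> T" and d: "0 < d"
    and gap: "\<And>k l. k < N \<Longrightarrow> lam k \<noteq> lam l \<Longrightarrow> d \<le> \<bar>lam k - lam l\<bar>"
    and pos: "\<And>k l. d \<le> lam k + lam l"
    and cut: "\<And>k l. k < N \<Longrightarrow> N \<le> l \<Longrightarrow> lam k \<noteq> lam l"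
    and \<gamma>: "\<And>v. one_frequency lam N v \<Longrightarrow> \<gamma> * sqnorm N v \<le> qform W N v"
  shows "observes lam W 0 T (min m (T * \<gamma> / 2) - 2 * (1 + real N) / d)"
proof (rule observesI[where M = N])
  fix p q :: "nat \<Rightarrow> complex" and n assume n: "N \<le> n"
  define f where "f = amp p q"
  define v where "v x y = Re (f x * cnj (f y) * W (fst x) (fst y) * osc T (frq lam x - frq lam y))" for x y
  let ?L = "modes N" and ?H = "{N..<n} \<times> (UNIV :: bool set)" and ?I = "modes n"
  define A where "A S = (\<Sum>x\<in>S. (cmod (f x))\<^sup>2)" for S
  have split: "sum h ?I = sum h ?L + sum h ?H" for h :: "nat \<times> bool \<Rightarrow> real"
  proof -
    have "?I = ?L \<union> ?H" using n by auto
    moreover have "?L \<inter> ?H = {}" by auto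
    ultimately show ?thesis by (simp add: sum.union_disjoint)
  qed
  have sym: "v y x = v x y" for x y
  proof -
    have "f y * cnj (f x) * W (fst y) (fst x) * osc T (frq lam y - frq lam x)
       = cnj (f x * cnj (f y) * W (fst x) (fst y) * osc T (frq lam x - frq lam y))"
      by (subst hermitian) (simp add: cnj_osc)
    then show ?thesis unfolding v_def by (metis complex_cnj cnj.simps(1))
  qed
  have gap': "frq lam x = frq lam y \<or> d \<le> \<bar>frq lam x - frq lam y\<bar>" if "x \<in> ?L" for x y
    using gap[of "fst x" "fst y"] pos[of "fst x" "fst y"] that
    by (cases "lam (fst x) = lam (fst y)") (auto simp: frq_def abs_minus_commute)
  have frq_eq: "frq lam x = frq lam y \<longleftrightarrow> snd x = snd y \<and> lam (fst x) = lam (fst y)" for x y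
    using pos[of "fst x" "fst y"] d by (auto simp: frq_def)
  have off: "\<bar>v x y\<bar> \<le> 2 / d * (cmod (f x) * cmod (f y) * cmod (W (fst x) (fst y)))"
    if "x \<in> ?L" "frq lam x \<noteq> frq lam y" for x y
  proof -
    have "cmod (osc T (frq lam x - frq lam y)) \<le> 2 / \<bar>frq lam x - frq lam y\<bar>"
      using that by (intro cmod_osc_le) auto
    also have "\<dots> \<le> 2 / d" using gap'[OF that(1), of y] that(2) d by (intro divide_left_mono) auto
    finally have "cmod (osc T (frq lam x - frq lam y)) \<le> 2 / d" .
    then have "cmod (f x) * cmod (f y) * cmod (W (fst x) (fst y)) * cmod (osc T (frq lam x - frq lam y))
       \<le> cmod (f x) * cmod (f y) * cmod (W (fst x) (fst y)) * (2 / d)"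
      by (intro mult_left_mono) auto
    moreover have "\<bar>v x y\<bar> \<le> cmod (f x) * cmod (f y) * cmod (W (fst x) (fst y)) * cmod (osc T (frq lam x - frq lam y))"
      unfolding v_def by (rule order_trans[OF abs_Re_le_cmod]) (simp add: norm_mult)
    ultimately show ?thesis by (simp add: mult_ac)
  qed
  \<comment> \<open>\<open>w\<close> collects the oscillating interactions, \<open>dg\<close> those of equal frequencies\<close>
  define w where "w x y = (if frq lam x = frq lam y then 0 else \<bar>v x y\<bar>)" for x y
  define dg where "dg x y = (if frq lam x = frq lam y then v x y else 0)" for x y
  have w0: "0 \<le> w x y" for x y by (simp add: w_def)

  have total: "observed_energy lam W n p q T = (\<Sum>x\<in>?I. \<Sum>y\<in>?I. v x y)"
    unfolding v_def f_def by (rule integral_qform_eq)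
  also have "\<dots> = (\<Sum>x\<in>?L. \<Sum>y\<in>?L. v x y) + 2 * (\<Sum>x\<in>?L. \<Sum>y\<in>?H. v x y) + (\<Sum>x\<in>?H. \<Sum>y\<in>?H. v x y)"
  proof -
    have "(\<Sum>x\<in>?H. \<Sum>y\<in>?L. v x y) = (\<Sum>x\<in>?L. \<Sum>y\<in>?H. v x y)"
      by (subst sum.swap) (simp add: sym)
    then show ?thesis by (simp add: split sum.distrib)
  qed
  finally have eq: "observed_energy lam W n p q T = \<dots>" .

  have high: "2 * m * A ?H \<le> (\<Sum>x\<in>?H. \<Sum>y\<in>?H. v x y)"
  proof -
    \<comment> \<open>the terms with both indices high form the energy of the data without low modes\<close>
    let ?c = "\<lambda>p k. if k < N then 0 else p k :: complex"
    have am: "amp (?c p) (?c q) x = (if x \<in> ?L then 0 else f x)" for x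
      by (auto simp: amp_def f_def mem_Times_iff)
    have "m * (sqnorm n (?c p) + sqnorm n (?c q)) \<le> observed_energy lam W n (?c p) (?c q) T"
      by (rule observesD[OF N]) simp
    moreover have "sqnorm n (?c p) + sqnorm n (?c q) = 2 * A ?H"
      unfolding sqnorm_eq_amp A_def am split by (auto intro!: sum.cong)
    moreover have "observed_energy lam W n (?c p) (?c q) T = (\<Sum>x\<in>?H. \<Sum>y\<in>?H. v x y)"
      unfolding integral_qform_eq am split v_def by (auto intro!: sum.cong)
    ultimately show ?thesis by simp
  qed

  have low: "T * \<gamma> * A ?L \<le> (\<Sum>x\<in>?L. \<Sum>y\<in>?L. dg x y)"
  proof -
    have "\<gamma> * sqnorm N (\<lambda>k. f (k, s)) * T \<le> (\<Sum>j<N. \<Sum>k<N. dg (j, s) (k, s))" for s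
    proof -
      have "\<gamma> * sqnorm N (\<lambda>k. f (k, s)) * T \<le>
        (\<Sum>j<N. \<Sum>k<N. if lam j = lam k then Re (f (j, s) * cnj (f (k, s)) * W j k) else 0) * T"
        by (intro mult_right_mono frequency_blocks_lower_bound \<gamma> T)
      also have "\<dots> = (\<Sum>j<N. \<Sum>k<N. dg (j, s) (k, s))"
      proof -
        have "dg (j, s) (k, s) = (if lam j = lam k then Re (f (j, s) * cnj (f (k, s)) * W j k) else 0) * T" for j k
        proof (cases "lam j = lam k")
          case True
          then have "frq lam (j, s) - frq lam (k, s) = 0" by (simp add: frq_def)
          then show ?thesis using True T by (simp add: dg_def v_def)
        qed (simp add: dg_def frq_eq)
        then show ?thesis by (simp add: sum_distrib_right)
      qed
      finally show ?thesis .
    qed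
    from add_mono[OF this[of True] this[of False]]
    have "\<gamma> * A ?L * T \<le> (\<Sum>j<N. \<Sum>k<N. dg (j, True) (k, True)) + (\<Sum>j<N. \<Sum>k<N. dg (j, False) (k, False))"
      by (simp add: A_def sum_modes sqnorm_def sum.distrib algebra_simps)
    also have "\<dots> = (\<Sum>x\<in>?L. \<Sum>y\<in>?L. dg x y)"
      by (simp add: sum_modes sum.distrib dg_def frq_eq)
    finally show ?thesis by (simp add: mult_ac)
  qed

  have "(\<Sum>x\<in>?L. \<Sum>y\<in>?I. w x y) \<le> (\<Sum>x\<in>?L. \<Sum>y\<in>?I. 2 / d * (cmod (f x) * cmod (f y) * cmod (W (fst x) (fst y))))"
    using d off by (intro sum_mono) (auto simp: w_def)
  also have "\<dots> \<le> 2 / d * ((1 + real N) * A ?I)"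
    unfolding sum_distrib_left[symmetric] A_def
    by (intro mult_left_mono low_mode_interaction_bound n) (use d in auto)
  finally have w: "(\<Sum>x\<in>?L. \<Sum>y\<in>?I. w x y) \<le> 2 * (1 + real N) / d * A ?I"
    by (simp only: times_divide_eq_left mult.assoc)

  have LL: "(\<Sum>x\<in>?L. \<Sum>y\<in>?L. dg x y) - (\<Sum>x\<in>?L. \<Sum>y\<in>?L. w x y) \<le> (\<Sum>x\<in>?L. \<Sum>y\<in>?L. v x y)"
    unfolding sum_subtractf[symmetric] by (intro sum_mono) (auto simp: dg_def w_def)
  \<comment> \<open>no frequency occurs on both sides of the cutoff, so all mixed terms oscillate\<close>
  have LH: "- (\<Sum>x\<in>?L. \<Sum>y\<in>?H. w x y) \<le> (\<Sum>x\<in>?L. \<Sum>y\<in>?H. v x y)"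
  proof -
    have "- w x y \<le> v x y" if "x \<in> ?L" "y \<in> ?H" for x y
      using cut[of "fst x" "fst y"] that by (auto simp: w_def frq_eq)
    then show ?thesis unfolding sum_negf[symmetric] by (intro sum_mono)
  qed
  have "(\<Sum>x\<in>?L. \<Sum>y\<in>?L. w x y) + 2 * (\<Sum>x\<in>?L. \<Sum>y\<in>?H. w x y) \<le> 2 * (\<Sum>x\<in>?L. \<Sum>y\<in>?I. w x y)"
    using w0 by (simp add: split sum.distrib sum_nonneg)
  with eq high low w LL LH
  have "T * \<gamma> * A ?L + 2 * m * A ?H - 2 * (2 * (1 + real N) / d * A ?I)
      \<le> observed_energy lam W n p q T" by linarith
  moreover have "min m (T * \<gamma> / 2) * (2 * A ?L) \<le> T * \<gamma> / 2 * (2 * A ?L)"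
    "min m (T * \<gamma> / 2) * (2 * A ?H) \<le> m * (2 * A ?H)"
    by (intro mult_right_mono; simp add: A_def sum_nonneg)+
  moreover have "A ?I = A ?L + A ?H" unfolding A_def by (rule split)
  moreover have "sqnorm n p + sqnorm n q = 2 * A ?I"
    unfolding A_def f_def by (rule sqnorm_eq_amp)
  ultimately show "(min m (T * \<gamma> / 2) - 2 * (1 + real N) / d) * (sqnorm n p + sqnorm n q)
      \<le> observed_energy lam W n p q T"
    by (simp add: algebra_simps)
qed

text \<open>
  The unit sequences with one frequency among the first \<open>N\<close> modes form a compact set in the
  product topology (Tychonoff), on which the form attains its minimum.
\<close>

lemma one_frequency_minimizer:
  assumes "0 < N"
  obtains u where "one_frequency lam N u" "sqnorm N u = 1"
    "\<And>v. one_frequency lam N v \<Longrightarrow> qform W N u * sqnorm N v \<le> qform W N v"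
proof -
  define K where "K = {u. one_frequency lam N u \<and> sqnorm N u = 1}"
  let ?B = "PiE UNIV (\<lambda>k. if k < N then cball 0 1 else {0}) :: (nat \<Rightarrow> complex) set"
  have cont: "continuous_on S (\<lambda>u. u k)" for S :: "(nat \<Rightarrow> complex) set" and k
    by (rule continuous_on_subset[OF continuous_on_product_coordinates subset_UNIV])
  have "compactin (product_topology (\<lambda>_. euclidean) UNIV) ?B"
    by (subst compactin_PiE) auto
  then have "compact ?B" by (simp add: euclidean_product_topology)
  moreover have "closed K"
  proof -
    have 1: "closed {u :: nat \<Rightarrow> complex. u k = 0}" for k
      using continuous_closed_vimage[of "{0}" "\<lambda>u :: nat \<Rightarrow> complex. u k"] continuous_on_eq_continuous_at[of UNIV "\<lambda>u :: nat \<Rightarrow> complex. u k"] cont[of UNIV k]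
      by (simp add: vimage_def)
    have 2: "closed {u :: nat \<Rightarrow> complex. u j * u k = 0}" for j k
    proof -
      have "{u :: nat \<Rightarrow> complex. u j * u k = 0} = {u. u j = 0} \<union> {u. u k = 0}" by auto
      then show ?thesis by (simp only: closed_Un 1)
    qed
    have "continuous_on UNIV (sqnorm N)"
      unfolding sqnorm_def[abs_def] by (intro continuous_on_sum continuous_on_power continuous_on_norm cont)
    then have 3: "closed {u. sqnorm N u = 1}"
      using continuous_closed_vimage[of "{1}" "sqnorm N"] continuous_on_eq_continuous_at[of UNIV "sqnorm N"]
      by (simp add: vimage_def)
    have K_eq: "K = (\<Inter>k\<in>{N..}. {u. u k = 0}) \<inter> (\<Inter>j. \<Inter>k\<in>{k. lam j \<noteq> lam k}. {u. u j * u k = 0}) \<inter> {u. sqnorm N u = 1}"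
      by (auto simp: K_def one_frequency_def)
    show ?thesis unfolding K_eq by (intro closed_Int closed_INT ballI 1 2 3)
  qed
  moreover have "K \<subseteq> ?B"
  proof
    fix u assume u: "u \<in> K"
    have "cmod (u k) \<le> 1" if "k < N" for k
    proof -
      have "(cmod (u k))\<^sup>2 \<le> sqnorm N u"
        unfolding sqnorm_def by (rule member_le_sum) (use that in auto)
      then show ?thesis using u by (simp add: K_def power_le_one_iff)
    qed
    then show "u \<in> ?B" using u by (auto simp: K_def one_frequency_def)
  qed
  ultimately have "compact K"
    by (metis compact_Int_closed inf.absorb_iff2 inf.commute)
  moreover have "(\<lambda>k. if k = 0 then 1 else 0) \<in> K"
    using assms by (auto simp: K_def one_frequency_def sqnorm_def if_distrib[where f = cmod] if_distrib[where f = "\<lambda>x. x\<^sup>2"] cong: if_cong)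
  moreover have "continuous_on K (qform W N)"
    unfolding qform_def[abs_def]
    by (intro continuous_on_Re continuous_on_sum continuous_on_mult continuous_on_cnj continuous_on_const cont)
  ultimately obtain u where u: "u \<in> K" "\<And>v. v \<in> K \<Longrightarrow> qform W N u \<le> qform W N v"
    using continuous_attains_inf[of K "qform W N"] by blast
  have "qform W N u * sqnorm N v \<le> qform W N v" if v: "one_frequency lam N v" for v
  proof (cases "sqnorm N v = 0")
    case True then show ?thesis using qform_nonneg by simp
  next
    case False
    then have s: "sqnorm N v > 0" using sqnorm_nonneg[of N v] by linarith
    define r where "r = 1 / sqrt (sqnorm N v)"
    have r: "r\<^sup>2 = 1 / sqnorm N v" using s by (simp add: r_def power_divide)
    have "sqnorm N (\<lambda>k. of_real r * v k) = r\<^sup>2 * sqnorm N v"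
      by (simp add: sqnorm_def norm_mult power_mult_distrib sum_distrib_left)
    moreover have "qform W N (\<lambda>k. of_real r * v k) = r\<^sup>2 * qform W N v"
      by (simp add: qform_def sum_distrib_left power2_eq_square mult_ac del: Re_sum flip: Re_complex_of_real)
         (simp add: sum_distrib_left mult_ac)
    moreover have "one_frequency lam N (\<lambda>k. of_real r * v k)"
      using v by (auto simp: one_frequency_def)
    ultimately have "qform W N u \<le> qform W N v / sqnorm N v"
      using u(2)[of "\<lambda>k. of_real r * v k"] s by (simp add: K_def r)
    then show ?thesis using s by (simp add: field_simps)
  qed
  then show thesis using that u(1) by (auto simp: K_def)
qed

end

section \<open>Large-time limits of the coefficient inequalities\<close>

context gram_bounds
begin

text \<open>
  The data \<open>p = u\<close>, \<open>q = i u\<close> evolve by a scalar phase, so their energy is constant in time,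
  while their squared norm is \<open>2 sqnorm n u\<close>.
\<close>

lemma observes_one_frequency:
  assumes "observes lam W 0 T m" and u: "one_frequency lam n u" and T: "0 \<le> T"
  shows "2 * m * sqnorm n u \<le> T * qform W n u"
proof -
  obtain \<mu> where \<mu>: "\<And>k. u k \<noteq> 0 \<Longrightarrow> lam k = \<mu>"
    using u unfolding one_frequency_def by (metis mult_eq_0_iff)
  have "qform W n (mode_coeff lam u (\<lambda>k. \<i> * u k) t) = qform W n u" for t
  proof -
    have m: "mode_coeff lam u (\<lambda>k. \<i> * u k) t k = cis (\<mu> * t) * u k" for k
      using \<mu>[of k] by (cases "u k = 0") (auto simp: mode_coeff_def complex_eq_iff algebra_simps)
    have "cis (\<mu> * t) * x * cnj (cis (\<mu> * t) * y) = x * cnj y" for x y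
      by (simp add: cis_cnj mult_ac) (simp add: cis_mult flip: mult.assoc)
    then show ?thesis unfolding qform_def m by (simp only:)
  qed
  moreover have "m * (sqnorm n u + sqnorm n (\<lambda>k. \<i> * u k))
      \<le> integral {0..T} (\<lambda>t. qform W n (mode_coeff lam u (\<lambda>k. \<i> * u k) t))"
    by (rule observesD[OF assms(1)]) simp
  moreover have "sqnorm n (\<lambda>k. \<i> * u k) = sqnorm n u" by (simp add: sqnorm_def norm_mult)
  ultimately show ?thesis using T by simp
qed

lemma observes_zero: "0 \<le> T \<Longrightarrow> observes lam W N T 0"
  by (auto simp: observes_def qform_nonneg intro!: integral_nonneg)

lemma observes_le:
  assumes "observes lam W N T m" "0 \<le> T" shows "m \<le> T"
proof -
  let ?p = "\<lambda>k. if k = N then 1 else (0::complex)" and ?q = "\<lambda>k. 0 :: complex"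
  have s: "sqnorm (Suc N) ?p = 1" "sqnorm (Suc N) ?q = 0"
    by (simp_all add: sqnorm_def)
  have "m * (sqnorm (Suc N) ?p + sqnorm (Suc N) ?q) \<le> integral {0..T} (\<lambda>t. qform W (Suc N) (mode_coeff lam ?p ?q t))"
    by (rule observesD[OF assms(1)]) simp
  also have "\<dots> \<le> integral {0..T} (\<lambda>t. 1)"
  proof (intro integral_le integrable_qform_mode_coeff)
    fix t
    show "qform W (Suc N) (mode_coeff lam ?p ?q t) \<le> 1"
      using qform_le[of "Suc N" "mode_coeff lam ?p ?q t"] sqnorm_mode_coeff_le[of "Suc N" lam ?p ?q t] s by linarith
  qed auto
  finally show ?thesis using assms(2) by (simp add: s)
qed

text \<open>
  The main result in terms of coefficients; \<open>C N T\<close> is the largest \<open>m\<close> with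
  \<open>observes lam W N T m\<close>.
\<close>

theorem observability_limits:
  assumes lam0: "0 < lam 0" and mono: "mono lam" and lim: "filterlim lam at_top sequentially"
    and C: "\<And>N T m. 0 \<le> T \<Longrightarrow> m \<le> C N T \<longleftrightarrow> observes lam W N T m"
  shows "\<exists>\<alpha> c. ((\<lambda>T. lim (\<lambda>N. 1 / T * C N T)) \<longlongrightarrow> \<alpha>) at_top \<and>
    ((\<lambda>T. C 0 T / T) \<longlongrightarrow> c) at_top \<and> c \<le> \<alpha> \<and>
    (\<forall>n u. one_frequency lam n u \<longrightarrow> 2 * c * sqnorm n u \<le> qform W n u) \<and>
    (c < \<alpha> \<longrightarrow> (\<exists>n u. one_frequency lam n u \<and> sqnorm n u = 1 \<and> qform W n u \<le> 2 * c))"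
proof -
  have obs: "observes lam W N T (C N T)" if "0 \<le> T" for N T using C[OF that] by blast
  have C_nonneg: "0 \<le> C N T" if "0 \<le> T" for N T
    using C[OF that, of 0] observes_zero[OF that] by simp
  have C_le: "C N T \<le> T" if "0 \<le> T" for N T
    using observes_le[OF obs[OF that] that] .
  have C_super: "C N S + C N T \<le> C N (S + T)" if "0 \<le> S" "0 \<le> T" for N S T
    using C[of "S + T"] observes_add[OF obs obs] that by simp
  have C_mono: "C N T \<le> C N' T" if "0 \<le> T" "N \<le> N'" for N N' T
    using C[OF that(1)] observes_higher_cutoff[OF obs that(2)] that by simp

  define A where "A T = lim (\<lambda>N. C N T)" for T
  have A: "(\<lambda>N. C N T) \<longlonglongrightarrow> A T" if T: "0 \<le> T" for T
  proof -
    have "incseq (\<lambda>N. C N T)" using C_mono T by (simp add: incseq_def)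
    moreover have "\<forall>N. C N T \<le> T" using C_le T by simp
    ultimately obtain L where "(\<lambda>N. C N T) \<longlonglongrightarrow> L" by (rule incseq_convergent)
    then show ?thesis by (simp add: A_def limI)
  qed
  have A_bounds: "0 \<le> A T \<and> A T \<le> T" if "0 \<le> T" for T
    using LIMSEQ_le_const[OF A[OF that], of 0] LIMSEQ_le_const2[OF A[OF that], of T]
      C_nonneg[OF that] C_le[OF that] by blast
  have A_super: "A S + A T \<le> A (S + T)" if "0 \<le> S" "0 \<le> T" for S T
    by (rule LIMSEQ_le[OF tendsto_add[OF A A] A]) (use that C_super in auto)

  obtain \<alpha> where \<alpha>: "((\<lambda>T. A T / T) \<longlongrightarrow> \<alpha>) at_top" "\<forall>m<\<alpha>. \<exists>T>0. m < A T / T"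
    using superadditive_limit[OF A_super A_bounds] by blast
  have C_bounds: "0 \<le> C N T \<and> C N T \<le> T" if "0 \<le> T" for N T
    using C_nonneg[OF that] C_le[OF that] by blast
  obtain c where c: "((\<lambda>T. C 0 T / T) \<longlongrightarrow> c) at_top"
    using superadditive_limit[OF C_super C_bounds] by blast

  show ?thesis
  proof (rule exI[of _ \<alpha>], rule exI[of _ c], intro conjI allI impI)
    have "\<forall>\<^sub>F T in at_top. A T / T = lim (\<lambda>N. 1 / T * C N T)"
      using eventually_gt_at_top[of 0]
    proof eventually_elim
      case (elim T)
      then have "(\<lambda>N. 1 / T * C N T) \<longlonglongrightarrow> 1 / T * A T" by (intro tendsto_mult tendsto_const A) auto
      then show ?case by (simp add: limI)
    qed
    then show "((\<lambda>T. lim (\<lambda>N. 1 / T * C N T)) \<longlongrightarrow> \<alpha>) at_top"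
      using \<alpha>(1) tendsto_cong by fastforce
    show "((\<lambda>T. C 0 T / T) \<longlongrightarrow> c) at_top" by (rule c)
    show "c \<le> \<alpha>"
    proof (rule tendsto_le[OF _ \<alpha>(1) c])
      have le: "C 0 T \<le> A T" if "0 \<le> T" for T
        using LIMSEQ_le_const[OF A[OF that], of "C 0 T"] C_mono[OF that, of 0] by auto
      show "\<forall>\<^sub>F T in at_top. C 0 T / T \<le> A T / T"
        using eventually_gt_at_top[of 0] by eventually_elim (simp add: divide_right_mono le)
    qed simp
    show "2 * c * sqnorm n u \<le> qform W n u" if u: "one_frequency lam n u" for n u
    proof (rule tendsto_upperbound)
      show "((\<lambda>T. 2 * (C 0 T / T) * sqnorm n u) \<longlongrightarrow> 2 * c * sqnorm n u) at_top"
        by (intro tendsto_intros c)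
      show "\<forall>\<^sub>F T in at_top. 2 * (C 0 T / T) * sqnorm n u \<le> qform W n u"
        using eventually_gt_at_top[of 0]
      proof eventually_elim
        case (elim T)
        then show ?case using observes_one_frequency[OF obs u, of T] by (simp add: field_simps)
      qed
    qed simp
    assume "c < \<alpha>"
    then obtain S where S: "S > 0" "c < A S / S" using \<alpha>(2) by blast
    then have "c * S < A S" by (simp add: field_simps)
    from order_tendstoD(1)[OF A this] S obtain N0 where N0: "c * S < C N0 S"
      by (auto simp: eventually_sequentially)
    have "\<exists>l. lam N0 < lam l"
      using lim[unfolded filterlim_at_top_dense, rule_format, of "lam N0"] by (auto simp: eventually_sequentially)
    \<comment> \<open>raise the cutoff to a place where \<open>lam\<close> jumps, so that no eigenvalue is split\<close>
    define N where "N = (LEAST l. lam N0 < lam l)"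
    have N: "lam N0 < lam N" unfolding N_def by (rule LeastI_ex) fact
    have low: "lam k \<le> lam N0" if "k < N" for k
      using not_less_Least that unfolding N_def by force
    have cut: "lam k < lam l" if "k < N" "N \<le> l" for k l
      using low[OF that(1)] N monoD[OF mono that(2)] by linarith
    have NN: "N0 < N" using N monoD[OF mono, of N N0] by (cases "N0 < N") auto
    \<comment> \<open>the gap between a low frequency and any different one: for equal signs the distances to
        \<open>lam l\<close> with \<open>l \<le> N\<close> suffice by monotonicity, for opposite signs \<open>2 * lam 0\<close> does\<close>
    define D where "D = insert (2 * lam 0) ((\<lambda>(k, l). \<bar>lam k - lam l\<bar>) ` {(k, l) \<in> {..<N} \<times> {..N}. lam k \<noteq> lam l})"
    define d where "d = Min D"
    have fin: "finite D" 
    proof -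
      have "finite {(k, l) \<in> {..<N} \<times> {..N}. lam k \<noteq> lam l}"
        by (rule finite_subset[of _ "{..<N} \<times> {..N}"]) auto
      then show ?thesis unfolding D_def by (simp only: finite_insert finite_imageI)
    qed
    have "d \<in> D" unfolding d_def by (rule Min_in[OF fin]) (simp add: D_def)
    then have d: "0 < d" using lam0 by (auto simp: D_def)
    have d_le: "d \<le> x" if "x \<in> D" for x unfolding d_def using fin that by simp
    have pos: "d \<le> lam k + lam l" for k l
      using d_le[of "2 * lam 0"] monoD[OF mono, of 0 k] monoD[OF mono, of 0 l] by (simp add: D_def)
    have gap: "d \<le> \<bar>lam k - lam l\<bar>" if "k < N" "lam k \<noteq> lam l" for k l
    proof (cases "l \<le> N")
      case True
      then show ?thesis using that by (intro d_le) (auto simp: D_def)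
    next
      case False
      have "d \<le> \<bar>lam k - lam N\<bar>" using that cut[of k N] by (intro d_le) (force simp: D_def)
      then show ?thesis using cut[of k N] monoD[OF mono, of N l] False that by auto
    qed
    obtain u where u: "one_frequency lam N u" "sqnorm N u = 1"
      "\<And>v. one_frequency lam N v \<Longrightarrow> qform W N u * sqnorm N v \<le> qform W N v"
      using one_frequency_minimizer[of N lam] NN by auto
    define a where "a = min (C N S / S) (qform W N u / 2)"
    define B where "B = 2 * (1 + real N) / d"
    have mult: "real j * C N S \<le> C N (real j * S)" for j
    proof (induction j)
      case 0 then show ?case using C_nonneg[of 0] by simp
    next
      case (Suc j)
      then show ?case using C_super[of "real j * S" S N] S by (simp add: distrib_right algebra_simps)
    qed
    have est: "a - B / (real j * S) \<le> C 0 (real j * S) / (real j * S)" if j: "0 < j" for j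
    proof -
      let ?T = "real j * S"
      have T: "0 < ?T" using j S by simp
      have "observes lam W N ?T (real j * C N S)"
        by (rule C[THEN iffD1, OF _ mult]) (use T in simp)
      then have "observes lam W 0 ?T (min (real j * C N S) (?T * qform W N u / 2) - B)"
        unfolding B_def
        by (rule observes_low_high) (use T d gap pos cut u in \<open>auto simp: less_imp_neq\<close>)
      then have "min (real j * C N S) (?T * qform W N u / 2) - B \<le> C 0 ?T"
        by (rule C[THEN iffD2, rotated]) (use T in simp)
      moreover have "?T * a \<le> min (real j * C N S) (?T * qform W N u / 2)"
        unfolding a_def using T S j by (auto simp: min_def field_simps mult_left_mono)
      ultimately have "?T * a - B \<le> C 0 ?T" by linarith
      then have "(?T * a - B) / ?T \<le> C 0 ?T / ?T" using T by (intro divide_right_mono) auto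
      then show ?thesis using T S j by (simp add: diff_divide_distrib)
    qed
    have lin: "filterlim (\<lambda>j. real j * S) at_top sequentially"
      using S by (intro filterlim_at_top_mult_tendsto_pos[OF tendsto_const] filterlim_real_sequentially)
    have "a \<le> c"
    proof (rule tendsto_le)
      show "(\<lambda>j. C 0 (real j * S) / (real j * S)) \<longlonglongrightarrow> c"
        by (rule filterlim_compose[OF c lin])
      have "(\<lambda>j. a - B / (real j * S)) \<longlonglongrightarrow> a - 0"
        by (intro tendsto_intros tendsto_divide_0[OF tendsto_const] filterlim_at_top_imp_at_infinity lin)
      then show "(\<lambda>j. a - B / (real j * S)) \<longlonglongrightarrow> a" by simp
      show "\<forall>\<^sub>F j in sequentially. a - B / (real j * S) \<le> C 0 (real j * S) / (real j * S)"
        using eventually_gt_at_top[of 0] by eventually_elim (rule est)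
    qed simp
    moreover have "c < C N S / S"
      using N0 C_mono[of S N0 N] NN S by (simp add: field_simps)
    ultimately have "qform W N u \<le> 2 * c" by (simp add: a_def)
    then show "\<exists>n u. one_frequency lam n u \<and> sqnorm n u = 1 \<and> qform W n u \<le> 2 * c"
      using u by blast
  qed
qed

end

section \<open>Square-integrable functions\<close>

lemma L2_D: "f \<in> L2 M \<Longrightarrow> f \<in> borel_measurable M" "f \<in> L2 M \<Longrightarrow> integrable M (\<lambda>x. (cmod (f x))\<^sup>2)"
  by (auto simp: L2_def)

lemma integrable_cmod_mult:
  assumes "f \<in> L2 M" "h \<in> L2 M"
  shows "integrable M (\<lambda>x. cmod (f x) * cmod (h x))"
proof (rule Bochner_Integration.integrable_bound)
  show "integrable M (\<lambda>x. (cmod (f x))\<^sup>2 + (cmod (h x))\<^sup>2)"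
    using assms by (auto dest: L2_D)
  show "(\<lambda>x. cmod (f x) * cmod (h x)) \<in> borel_measurable M"
    using assms[THEN L2_D(1)] by measurable
  have "cmod (f x) * cmod (h x) \<le> (cmod (f x))\<^sup>2 + (cmod (h x))\<^sup>2" for x
  proof -
    have "0 \<le> cmod (f x) * cmod (h x)" by simp
    then show ?thesis using sum_squares_bound[of "cmod (f x)" "cmod (h x)"] by linarith
  qed
  then show "AE x in M. norm (cmod (f x) * cmod (h x)) \<le> norm ((cmod (f x))\<^sup>2 + (cmod (h x))\<^sup>2)"
    by (auto simp: abs_mult)
qed

lemma integrable_L2_mult:
  assumes "f \<in> L2 M" "h \<in> L2 M"
  shows "integrable M (\<lambda>x. f x * cnj (h x))"
proof (rule Bochner_Integration.integrable_bound[OF integrable_cmod_mult[OF assms]])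
  have "(\<lambda>x. cnj (h x)) \<in> borel_measurable M"
    by (rule borel_measurable_continuous_on[OF _ L2_D(1)[OF assms(2)]]) (intro continuous_intros)
  then show "(\<lambda>x. f x * cnj (h x)) \<in> borel_measurable M"
    using L2_D(1)[OF assms(1)] by measurable
qed (simp add: norm_mult)

lemma L2_add:
  assumes "f \<in> L2 M" "h \<in> L2 M" shows "(\<lambda>x. f x + h x) \<in> L2 M"
  unfolding L2_def
proof (intro CollectI conjI)
  show m: "(\<lambda>x. f x + h x) \<in> borel_measurable M" using assms[THEN L2_D(1)] by measurable
  show "integrable M (\<lambda>x. (cmod (f x + h x))\<^sup>2)"
  proof (rule Bochner_Integration.integrable_bound)
    show "integrable M (\<lambda>x. 2 * (cmod (f x))\<^sup>2 + 2 * (cmod (h x))\<^sup>2)"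
      by (intro Bochner_Integration.integrable_add integrable_mult_right L2_D(2) assms)
    show "(\<lambda>x. (cmod (f x + h x))\<^sup>2) \<in> borel_measurable M" using m by measurable
    have "(cmod (a + b))\<^sup>2 \<le> 2 * (cmod a)\<^sup>2 + 2 * (cmod b)\<^sup>2" for a b
      using power_mono[OF norm_triangle_ineq[of a b], of 2] sum_squares_bound[of "cmod a" "cmod b"]
      by (simp add: power2_sum)
    then show "AE x in M. norm ((cmod (f x + h x))\<^sup>2) \<le> norm (2 * (cmod (f x))\<^sup>2 + 2 * (cmod (h x))\<^sup>2)"
      by auto
  qed
qed

lemma L2_scale: "f \<in> L2 M \<Longrightarrow> (\<lambda>x. c * f x) \<in> L2 M"
  by (auto simp: L2_def norm_mult power_mult_distrib)

lemma L2_zero: "(\<lambda>x. 0) \<in> L2 M"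
  by (simp add: L2_def)

lemma L2_diff: "f \<in> L2 M \<Longrightarrow> h \<in> L2 M \<Longrightarrow> (\<lambda>x. f x - h x) \<in> L2 M"
  using L2_add[OF _ L2_scale, of f M h "-1"] by simp

lemma L2_sum: "(\<And>k. k \<in> S \<Longrightarrow> f k \<in> L2 M) \<Longrightarrow> (\<lambda>x. \<Sum>k\<in>S. c k * f k x) \<in> L2 M"
proof (induction S rule: infinite_finite_induct)
  case (insert k S)
  then show ?case using L2_add[OF L2_scale[of "f k" M "c k"]] by simp
qed (auto intro: L2_zero)

lemma L2_indicator:
  assumes "\<omega> \<in> sets M" "f \<in> L2 M" shows "(\<lambda>x. indicator \<omega> x *\<^sub>R f x) \<in> L2 M"
proof -
  have "integrable M (\<lambda>x. indicator \<omega> x *\<^sub>R (cmod (f x))\<^sup>2)"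
    by (rule integrable_mult_indicator) (use assms L2_D in auto)
  moreover have "indicator \<omega> x *\<^sub>R (cmod (f x))\<^sup>2 = (cmod (indicator \<omega> x *\<^sub>R f x))\<^sup>2" for x
    by (simp add: indicator_def)
  ultimately show ?thesis using assms L2_D(1)[OF assms(2)] by (auto simp: L2_def)
qed

lemma L2_integrable:
  assumes "finite_measure M" "f \<in> L2 M" shows "integrable M f"
proof -
  interpret finite_measure M by fact
  have "(\<lambda>x. 1) \<in> L2 M" by (simp add: L2_def)
  from integrable_L2_mult[OF assms(2) this] show ?thesis by simp
qed

lemma L2_inner_self: "L2_inner M f f = of_real (LINT x|M. (cmod (f x))\<^sup>2)"
  unfolding L2_inner_def by (simp add: complex_norm_square[symmetric] del: of_real_power)

lemma L2_inner_cnj: "L2_inner M h f = cnj (L2_inner M f h)"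
proof -
  have "h x * cnj (f x) = cnj (f x * cnj (h x))" for x by (simp add: mult.commute)
  then show ?thesis unfolding L2_inner_def by (simp only: Bochner_Integration.integral_cnj)
qed

lemma L2_inner_add_left:
  "f \<in> L2 M \<Longrightarrow> f' \<in> L2 M \<Longrightarrow> h \<in> L2 M \<Longrightarrow>
   L2_inner M (\<lambda>x. f x + f' x) h = L2_inner M f h + L2_inner M f' h"
  unfolding L2_inner_def by (simp add: distrib_right integrable_L2_mult)

lemma L2_inner_scale_left: "L2_inner M (\<lambda>x. c * f x) h = c * L2_inner M f h"
  unfolding L2_inner_def by (simp add: mult.assoc)

lemma L2_inner_sum_left:
  assumes "\<And>k. k \<in> S \<Longrightarrow> f k \<in> L2 M" "h \<in> L2 M"
  shows "L2_inner M (\<lambda>x. \<Sum>k\<in>S. c k * f k x) h = (\<Sum>k\<in>S. c k * L2_inner M (f k) h)"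
  unfolding L2_inner_def
  by (simp add: sum_distrib_right mult.assoc)
     (subst Bochner_Integration.integral_sum, auto intro!: integrable_L2_mult assms)

lemma L2_inner_sum_right:
  assumes "\<And>k. k \<in> S \<Longrightarrow> f k \<in> L2 M" "h \<in> L2 M"
  shows "L2_inner M h (\<lambda>x. \<Sum>k\<in>S. c k * f k x) = (\<Sum>k\<in>S. cnj (c k) * L2_inner M h (f k))"
  by (subst L2_inner_cnj, subst L2_inner_sum_left[OF assms], assumption)
     (simp add: L2_inner_cnj[of M _ h])

lemma L2_inner_diff_left:
  "f \<in> L2 M \<Longrightarrow> f' \<in> L2 M \<Longrightarrow> h \<in> L2 M \<Longrightarrow>
   L2_inner M (\<lambda>x. f x - f' x) h = L2_inner M f h - L2_inner M f' h"
  unfolding L2_inner_def by (simp add: left_diff_distrib integrable_L2_mult)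

text \<open>
  Cauchy-Schwarz, from the discriminant of \<open>\<integral> (t |f| - |h|)\<^sup>2\<close>.
\<close>

lemma cmod_L2_inner_le:
  assumes "f \<in> L2 M" "h \<in> L2 M"
  shows "(cmod (L2_inner M f h))\<^sup>2 \<le> (LINT x|M. (cmod (f x))\<^sup>2) * (LINT x|M. (cmod (h x))\<^sup>2)"
proof -
  define A B C where "A = (LINT x|M. (cmod (f x))\<^sup>2)" and "B = (LINT x|M. (cmod (h x))\<^sup>2)"
    and "C = (LINT x|M. cmod (f x) * cmod (h x))"
  note [simp] = assms[THEN L2_D(2)] integrable_cmod_mult[OF assms]
  have q: "0 \<le> t\<^sup>2 * A - 2 * t * C + B" for t
  proof -
    have "0 \<le> (LINT x|M. (t * cmod (f x) - cmod (h x))\<^sup>2)" by simp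
    also have "\<dots> = (LINT x|M. t\<^sup>2 * (cmod (f x))\<^sup>2 - 2 * t * (cmod (f x) * cmod (h x)) + (cmod (h x))\<^sup>2)"
      by (simp add: power2_diff power_mult_distrib algebra_simps)
    also have "\<dots> = t\<^sup>2 * A - 2 * t * C + B" unfolding A_def B_def C_def by simp
    finally show ?thesis .
  qed
  have A: "0 \<le> A" and C: "0 \<le> C" by (simp_all add: A_def C_def)
  have "C\<^sup>2 \<le> A * B"
  proof (cases "A = 0")
    case True
    have "C = 0"
    proof (rule ccontr)
      assume "C \<noteq> 0"
      then show False using q[of "(B + 1) / (2 * C)"] True by (simp add: field_simps)
    qed
    then show ?thesis using True by simp
  next
    case False
    then have "0 < A" using A by simp
    have "0 \<le> (C / A)\<^sup>2 * A - 2 * (C / A) * C + B" by (rule q)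
    also have "\<dots> = B - C\<^sup>2 / A" using \<open>0 < A\<close> by (simp add: power2_eq_square field_simps)
    finally show ?thesis using \<open>0 < A\<close> by (simp add: field_simps)
  qed
  moreover have "cmod (L2_inner M f h) \<le> C"
    unfolding L2_inner_def C_def
    by (rule order_trans[OF integral_norm_bound]) (simp add: norm_mult)
  ultimately show ?thesis
    using power_mono[of "cmod (L2_inner M f h)" C 2] unfolding A_def B_def by simp
qed

lemma set_integral_cmod2:
  "(LINT x:\<omega>|M. (cmod (f x))\<^sup>2) = (LINT x|M. (cmod (indicator \<omega> x *\<^sub>R f x))\<^sup>2)"
  unfolding set_lebesgue_integral_def by (intro Bochner_Integration.integral_cong) (auto simp: indicator_def)

text \<open>
  The energy in \<open>\<omega>\<close> is continuous under convergence in \<open>L\<^sup>2\<close>.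
\<close>

lemma tendsto_set_integral_cmod2:
  assumes "\<omega> \<in> sets M" "f \<in> L2 M" "\<And>n. h n \<in> L2 M"
    and "(\<lambda>n. LINT x|M. (cmod (f x - h n x))\<^sup>2) \<longlonglongrightarrow> 0"
  shows "(\<lambda>n. LINT x:\<omega>|M. (cmod (h n x))\<^sup>2) \<longlonglongrightarrow> (LINT x:\<omega>|M. (cmod (f x))\<^sup>2)"
proof -
  define F H where "F x = indicator \<omega> x *\<^sub>R f x" and "H n x = indicator \<omega> x *\<^sub>R h n x" for n x
  have F: "F \<in> L2 M" and H: "H n \<in> L2 M" for n
    unfolding F_def[abs_def] H_def[abs_def] by (intro L2_indicator assms)+
  define R where "R n x = F x - H n x" for n x
  have R: "R n \<in> L2 M" for n unfolding R_def[abs_def] by (intro L2_diff F H)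
  have R0: "(\<lambda>n. LINT x|M. (cmod (R n x))\<^sup>2) \<longlonglongrightarrow> 0"
  proof (rule tendsto_sandwich[OF _ _ tendsto_const assms(4)])
    have "(LINT x|M. (cmod (R n x))\<^sup>2) \<le> (LINT x|M. (cmod (f x - h n x))\<^sup>2)" for n
      using L2_D(2)[OF R] L2_D(2)[OF L2_diff[OF assms(2,3)]]
      by (intro integral_mono) (auto simp: R_def F_def H_def indicator_def)
    then show "\<forall>\<^sub>F n in sequentially. (LINT x|M. (cmod (R n x))\<^sup>2) \<le> (LINT x|M. (cmod (f x - h n x))\<^sup>2)" by simp
  qed simp
  have "(\<lambda>n. cmod (L2_inner M F (R n))) \<longlonglongrightarrow> 0"
  proof -
    have "(\<lambda>n. sqrt ((LINT x|M. (cmod (F x))\<^sup>2) * (LINT x|M. (cmod (R n x))\<^sup>2))) \<longlonglongrightarrow> sqrt ((LINT x|M. (cmod (F x))\<^sup>2) * 0)"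
      by (intro tendsto_intros R0)
    then have lim: "(\<lambda>n. sqrt ((LINT x|M. (cmod (F x))\<^sup>2) * (LINT x|M. (cmod (R n x))\<^sup>2))) \<longlonglongrightarrow> 0" by simp
    show ?thesis
      by (rule tendsto_sandwich[OF _ _ tendsto_const lim])
        (auto intro!: always_eventually real_le_rsqrt cmod_L2_inner_le[OF F R])
  qed
  then have I0: "(\<lambda>n. Re (L2_inner M F (R n))) \<longlonglongrightarrow> 0"
    using tendsto_norm_zero_iff tendsto_Re by fastforce
  have "(LINT x|M. (cmod (H n x))\<^sup>2) = (LINT x|M. (cmod (F x))\<^sup>2) - 2 * Re (L2_inner M F (R n)) + (LINT x|M. (cmod (R n x))\<^sup>2)" for n
  proof -
    have "(cmod (a - b))\<^sup>2 = (cmod a)\<^sup>2 - 2 * Re (a * cnj b) + (cmod b)\<^sup>2" for a b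
      by (simp add: cmod_power2 power2_diff)
    then have "(cmod (H n x))\<^sup>2 = (cmod (F x))\<^sup>2 - 2 * Re (F x * cnj (R n x)) + (cmod (R n x))\<^sup>2" for x
      by (metis R_def diff_diff_eq2 add_diff_cancel_left' )
    moreover have "Re (L2_inner M F (R n)) = (LINT x|M. Re (F x * cnj (R n x)))"
      unfolding L2_inner_def by (rule integral_Re[symmetric]) (rule integrable_L2_mult[OF F R])
    moreover have "integrable M (\<lambda>x. Re (F x * cnj (R n x)))"
      by (intro integrable_Re integrable_L2_mult F R)
    ultimately show ?thesis using L2_D(2)[OF F] L2_D(2)[OF R] by (simp del: times_complex.sel)
  qed
  moreover have "(\<lambda>n. (LINT x|M. (cmod (F x))\<^sup>2) - 2 * Re (L2_inner M F (R n)) + (LINT x|M. (cmod (R n x))\<^sup>2))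
     \<longlonglongrightarrow> (LINT x|M. (cmod (F x))\<^sup>2) - 2 * 0 + 0"
    by (intro tendsto_intros I0 R0)
  ultimately show ?thesis unfolding set_integral_cmod2 F_def H_def by simp
qed

text \<open>
  The Gram matrix of the restrictions to \<open>\<omega>\<close>.
\<close>

definition gram :: "'m measure \<Rightarrow> (nat \<Rightarrow> 'm \<Rightarrow> complex) \<Rightarrow> 'm set \<Rightarrow> nat \<Rightarrow> nat \<Rightarrow> complex" where
  "gram M \<phi> \<omega> j k = (LINT x:\<omega>|M. \<phi> j x * cnj (\<phi> k x))"

lemma set_integral_combination:
  assumes "\<omega> \<in> sets M" "\<And>k. \<phi> k \<in> L2 M"
  shows "(LINT x:\<omega>|M. (cmod (\<Sum>k<n. c k * \<phi> k x))\<^sup>2) = qform (gram M \<phi> \<omega>) n c"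
proof -
  define F where "F k x = indicator \<omega> x *\<^sub>R \<phi> k x" for k x
  have F: "F k \<in> L2 M" for k unfolding F_def[abs_def] by (intro L2_indicator assms)
  have G: "gram M \<phi> \<omega> j k = L2_inner M (F j) (F k)" for j k
    unfolding gram_def set_lebesgue_integral_def L2_inner_def F_def
    by (intro Bochner_Integration.integral_cong) (auto simp: indicator_def)
  have "(LINT x:\<omega>|M. (cmod (\<Sum>k<n. c k * \<phi> k x))\<^sup>2) = (LINT x|M. (cmod (\<Sum>k<n. c k * F k x))\<^sup>2)"
    unfolding set_integral_cmod2 F_def by (simp add: scaleR_sum_right)
  also have "\<dots> = Re (L2_inner M (\<lambda>x. \<Sum>k<n. c k * F k x) (\<lambda>x. \<Sum>k<n. c k * F k x))"
    by (simp add: L2_inner_self)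
  also have "\<dots> = qform (gram M \<phi> \<omega>) n c"
    by (simp add: L2_inner_sum_left[OF F L2_sum[OF F]] L2_inner_sum_right[OF F F] qform_def G
        sum_distrib_left mult.assoc del: Re_sum)
  finally show ?thesis .
qed

section \<open>Zero-mean expansions and the dual of the first Sobolev space\<close>

text \<open>
  A Hilbert basis of the zero-mean functions together with positive frequencies; nothing is
  required of the \<open>\<phi> j\<close> as eigenfunctions.
\<close>

locale spectral_basis = finite_measure M for M :: "'m measure" +
  fixes \<phi> :: "nat \<Rightarrow> 'm \<Rightarrow> complex" and lam :: "nat \<Rightarrow> real"
  assumes basis: "hilbert_basis M \<phi>" and lam_pos: "0 < lam j"
begin

lemma phi_zero_mean: "\<phi> j \<in> L2_zero_mean M" and
  orthonormal: "L2_inner M (\<phi> j) (\<phi> k) = (if j = k then 1 else 0)"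
  using basis by (auto simp: hilbert_basis_def)

lemma phi_L2 [simp]: "\<phi> j \<in> L2 M"
  using phi_zero_mean by (simp add: L2_zero_mean_def)

lemma L2_zero_mean_L2: "f \<in> L2_zero_mean M \<Longrightarrow> f \<in> L2 M"
  by (simp add: L2_zero_mean_def)

lemma combination_L2 [simp]: "(\<lambda>x. \<Sum>k<n. c k * \<phi> k x) \<in> L2 M"
  by (intro L2_sum) simp

lemma combination_zero_mean: "(\<lambda>x. \<Sum>k<n. c k * \<phi> k x) \<in> L2_zero_mean M"
proof -
  have "(LINT x|M. \<phi> k x) = 0" for k using phi_zero_mean by (simp add: L2_zero_mean_def)
  moreover have "integrable M (\<phi> k)" for k by (intro L2_integrable finite_measure_axioms phi_L2)
  ultimately show ?thesis by (simp add: L2_zero_mean_def)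
qed

lemma inner_combination: "L2_inner M (\<lambda>x. \<Sum>k<n. c k * \<phi> k x) (\<phi> j) = (if j < n then c j else 0)"
  by (simp add: L2_inner_sum_left orthonormal if_distrib[where f = "\<lambda>x. _ * x"] cong: if_cong)

lemma gram_space: "gram M \<phi> (space M) j k = (if j = k then 1 else 0)"
  using orthonormal[of j k] unfolding gram_def L2_inner_def
  by (simp add: set_integral_space[OF integrable_L2_mult])

lemma qform_gram_space: "qform (gram M \<phi> (space M)) n c = sqnorm n c"
  by (simp add: qform_def gram_space sqnorm_def if_distrib[where f = "\<lambda>x. _ * x"] cong: if_cong del: Re_sum)
     (simp add: cmod_power2 flip: power2_eq_square)

lemma set_integral_space_cmod2: "f \<in> L2 M \<Longrightarrow> (LINT x:space M|M. (cmod (f x))\<^sup>2) = (LINT x|M. (cmod (f x))\<^sup>2)"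
  by (rule set_integral_space) (rule L2_D(2))

lemma integral_combination: "(LINT x|M. (cmod (\<Sum>k<n. c k * \<phi> k x))\<^sup>2) = sqnorm n c"
  using set_integral_combination[of "space M" M \<phi> c n] 
  by (simp add: qform_gram_space set_integral_space_cmod2)

lemma set_integral_cmod2_le:
  assumes "\<omega> \<in> sets M" "f \<in> L2 M"
  shows "(LINT x:\<omega>|M. (cmod (f x))\<^sup>2) \<le> (LINT x|M. (cmod (f x))\<^sup>2)"
  unfolding set_integral_cmod2
  using L2_D(2)[OF L2_indicator[OF assms]] L2_D(2)[OF assms(2)]
  by (intro integral_mono) (auto simp: indicator_def)

lemma gram_bounds_gram:
  assumes "\<omega> \<in> sets M" shows "gram_bounds (gram M \<phi> \<omega>)"
proof
  fix n c
  note eq = set_integral_combination[OF assms, of \<phi> c n, symmetric]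
  show "0 \<le> qform (gram M \<phi> \<omega>) n c" by (simp add: eq set_integral_cmod2)
  show "qform (gram M \<phi> \<omega>) n c \<le> sqnorm n c"
    unfolding integral_combination[symmetric] by (simp add: eq set_integral_cmod2_le assms)
next
  fix j k
  have "gram M \<phi> \<omega> k j = (LINT x|M. cnj (indicator \<omega> x *\<^sub>R (\<phi> j x * cnj (\<phi> k x))))"
    unfolding gram_def set_lebesgue_integral_def by (simp add: mult.commute)
  then show "gram M \<phi> \<omega> k j = cnj (gram M \<phi> \<omega> j k)"
    unfolding gram_def set_lebesgue_integral_def by (simp only: Bochner_Integration.integral_cnj)
qed

lemma L2_sums_energy:
  assumes "L2_sums M (\<lambda>j x. c j * \<phi> j x) f" "\<omega> \<in> sets M"
  shows "(\<lambda>n. qform (gram M \<phi> \<omega>) n c) \<longlonglongrightarrow> (LINT x:\<omega>|M. (cmod (f x))\<^sup>2)"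
  using tendsto_set_integral_cmod2[of \<omega> M f "\<lambda>n x. \<Sum>k<n. c k * \<phi> k x"] assms
  by (simp add: L2_sums_def set_integral_combination)

lemma L2_sums_norm:
  assumes "L2_sums M (\<lambda>j x. c j * \<phi> j x) f"
  shows "(\<lambda>n. sqnorm n c) \<longlonglongrightarrow> (LINT x|M. (cmod (f x))\<^sup>2)"
  using L2_sums_energy[OF assms, of "space M"] assms
  by (simp add: qform_gram_space set_integral_space_cmod2 L2_sums_def)

lemma expansion: "f \<in> L2_zero_mean M \<Longrightarrow> L2_sums M (\<lambda>j x. L2_inner M f (\<phi> j) * \<phi> j x) f"
  using basis by (simp add: hilbert_basis_def)

lemma parseval:
  "f \<in> L2_zero_mean M \<Longrightarrow> (\<lambda>n. sqnorm n (\<lambda>j. L2_inner M f (\<phi> j))) \<longlonglongrightarrow> (LINT x|M. (cmod (f x))\<^sup>2)"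
  by (rule L2_sums_norm) (rule expansion)

lemma L2_sums_finite: "L2_sums M (\<lambda>j x. (if j < n then c j else 0) * \<phi> j x) (\<lambda>x. \<Sum>k<n. c k * \<phi> k x)"
proof -
  have "(\<Sum>k<N. (if k < n then c k else 0) * \<phi> k x) = (\<Sum>k<n. c k * \<phi> k x)" if "n \<le> N" for N x
    by (rule sum.mono_neutral_cong_right) (use that in auto)
  then have "\<forall>\<^sub>F N in sequentially. (LINT x|M. (cmod ((\<Sum>k<n. c k * \<phi> k x) - (\<Sum>k<N. (if k < n then c k else 0) * \<phi> k x)))\<^sup>2) = 0"
    unfolding eventually_sequentially by (intro exI[of _ n]) auto
  then show ?thesis unfolding L2_sums_def by (auto intro: tendsto_eventually)
qed

lemma combination_H1: "(\<lambda>x. \<Sum>k<n. c k * \<phi> k x) \<in> H1_zero_mean M lam \<phi>"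
  unfolding H1_zero_mean_def
  by (auto simp: combination_zero_mean inner_combination split: if_splits intro!: summable_finite[of "{..<n}"])

lemma phi_H1: "\<phi> j \<in> H1_zero_mean M lam \<phi>"
  using combination_H1[where n = "Suc j" and c = "\<lambda>k. if k = j then 1 else 0"]
  by (simp add: if_distrib[where f = "\<lambda>x. x * _"] cong: if_cong)

lemma H1_L2: "f \<in> H1_zero_mean M lam \<phi> \<Longrightarrow> f \<in> L2 M"
  by (simp add: H1_zero_mean_def L2_zero_mean_def)

lemma H1_norm_combination:
  "(H1_norm M lam \<phi> (\<lambda>x. \<Sum>k<n. c k * \<phi> k x))\<^sup>2 = (\<Sum>k<n. (lam k)\<^sup>2 * (cmod (c k))\<^sup>2)"
proof -
  have "(\<Sum>j. (lam j)\<^sup>2 * (cmod (L2_inner M (\<lambda>x. \<Sum>k<n. c k * \<phi> k x) (\<phi> j)))\<^sup>2) = (\<Sum>k<n. (lam k)\<^sup>2 * (cmod (c k))\<^sup>2)"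
    by (subst suminf_finite[of "{..<n}"]) (auto simp: inner_combination)
  then show ?thesis unfolding H1_norm_def by (simp add: sum_nonneg)
qed

lemma coefficient_le_H1_norm:
  assumes "f \<in> H1_zero_mean M lam \<phi>"
  shows "lam j * cmod (L2_inner M f (\<phi> j)) \<le> H1_norm M lam \<phi> f"
proof -
  have "(lam j)\<^sup>2 * (cmod (L2_inner M f (\<phi> j)))\<^sup>2 = (\<Sum>k\<in>{j}. (lam k)\<^sup>2 * (cmod (L2_inner M f (\<phi> k)))\<^sup>2)" by simp
  also have "\<dots> \<le> (\<Sum>k. (lam k)\<^sup>2 * (cmod (L2_inner M f (\<phi> k)))\<^sup>2)"
    by (rule sum_le_suminf) (use assms in \<open>auto simp: H1_zero_mean_def\<close>)
  finally show ?thesis unfolding H1_norm_def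
    by (intro real_le_rsqrt) (simp add: power_mult_distrib)
qed

lemma Hm1_linear:
  assumes "F \<in> Hm1 M lam \<phi>" "f \<in> H1_zero_mean M lam \<phi>" "h \<in> H1_zero_mean M lam \<phi>"
  shows "F (\<lambda>x. f x + c * h x) = F f + cnj c * F h"
  using assms by (simp add: Hm1_def)

lemma Hm1_combination:
  assumes "F \<in> Hm1 M lam \<phi>"
  shows "F (\<lambda>x. \<Sum>k<n. c k * \<phi> k x) = (\<Sum>k<n. cnj (c k) * F (\<phi> k))"
proof (induction n)
  case 0
  have "(\<lambda>x. 0) \<in> H1_zero_mean M lam \<phi>" using combination_H1[where n = 0] by simp
  from Hm1_linear[OF assms this this, of 1] show ?case by simp
next
  case (Suc n)
  have "F (\<lambda>x. (\<Sum>k<n. c k * \<phi> k x) + c n * \<phi> n x) = F (\<lambda>x. \<Sum>k<n. c k * \<phi> k x) + cnj (c n) * F (\<phi> n)"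
    by (intro Hm1_linear assms combination_H1 phi_H1)
  then show ?case using Suc by simp
qed

text \<open>
  Testing \<open>F\<close> on the combination with coefficients \<open>F (\<phi> k) / lam k ^ 2\<close> gives \<open>s \<le> C sqrt s\<close>
  for the partial sum \<open>s\<close>, hence \<open>s \<le> C\<^sup>2\<close>.
\<close>

lemma Hm1_summable:
  assumes "F \<in> Hm1 M lam \<phi>"
  shows "summable (\<lambda>j. (cmod (F (\<phi> j)))\<^sup>2 / (lam j)\<^sup>2)"
proof -
  obtain C where C: "\<And>f. f \<in> H1_zero_mean M lam \<phi> \<Longrightarrow> cmod (F f) \<le> C * H1_norm M lam \<phi> f"
    using assms unfolding Hm1_def by blast
  have "(\<Sum>j<n. (cmod (F (\<phi> j)))\<^sup>2 / (lam j)\<^sup>2) \<le> C\<^sup>2" for n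
  proof -
    define s where "s = (\<Sum>j<n. (cmod (F (\<phi> j)))\<^sup>2 / (lam j)\<^sup>2)"
    let ?c = "\<lambda>k. F (\<phi> k) / of_real ((lam k)\<^sup>2)"
    let ?f = "\<lambda>x. \<Sum>k<n. ?c k * \<phi> k x"
    have s: "0 \<le> s" unfolding s_def by (intro sum_nonneg) auto
    have "F ?f = (\<Sum>k<n. cnj (?c k) * F (\<phi> k))" by (rule Hm1_combination[OF assms])
    also have "\<dots> = of_real s"
      unfolding s_def of_real_sum
      by (intro sum.cong refl) (simp add: complex_norm_square mult.commute del: of_real_power)
    finally have "cmod (F ?f) = s" using s by simp
    moreover have "(H1_norm M lam \<phi> ?f)\<^sup>2 = s"
      unfolding H1_norm_combination s_def
      using lam_pos by (intro sum.cong refl) (simp add: norm_divide power_divide power2_eq_square norm_mult less_imp_neq[symmetric])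
    ultimately have "s \<le> C * H1_norm M lam \<phi> ?f" using C[OF combination_H1[of ?c n]] by simp
    then have "s\<^sup>2 \<le> (C * H1_norm M lam \<phi> ?f)\<^sup>2" using s by (intro power_mono)
    then have "s * s \<le> C\<^sup>2 * s"
      unfolding power_mult_distrib \<open>(H1_norm M lam \<phi> ?f)\<^sup>2 = s\<close> by (simp only: power2_eq_square[of s])
    then show ?thesis using s unfolding s_def[symmetric]
      by (cases "s = 0") auto
  qed
  then have "(\<Sum>j\<le>n. (cmod (F (\<phi> j)))\<^sup>2 / (lam j)\<^sup>2) \<le> C\<^sup>2" for n
    by (simp only: lessThan_Suc_atMost[symmetric])
  then show ?thesis by (intro bounded_imp_summable[where B = "C\<^sup>2"]) simp_all
qed

text \<open>
  Finite combinations of the basis are dense in the \<open>H\<^sup>1\<close> norm.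
\<close>

lemma Hm1_determined_by_coefficients:
  assumes F: "F \<in> Hm1 M lam \<phi>" and zero: "\<And>j. F (\<phi> j) = 0" and f: "f \<in> H1_zero_mean M lam \<phi>"
  shows "F f = 0"
proof -
  obtain C where C: "\<And>f. f \<in> H1_zero_mean M lam \<phi> \<Longrightarrow> cmod (F f) \<le> C * H1_norm M lam \<phi> f"
    using F unfolding Hm1_def by blast
  let ?a = "\<lambda>j. L2_inner M f (\<phi> j)"
  let ?s = "\<lambda>j. (lam j)\<^sup>2 * (cmod (?a j))\<^sup>2"
  have sm: "summable ?s" using f by (simp add: H1_zero_mean_def)
  define r where "r n x = f x + (-1) * (\<Sum>k<n. ?a k * \<phi> k x)" for n x
  have Fr: "F (r n) = F f" for n
  proof -
    have "F (r n) = F f + cnj (-1) * F (\<lambda>x. \<Sum>k<n. ?a k * \<phi> k x)"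
      unfolding r_def[abs_def] by (intro Hm1_linear F f combination_H1)
    then show ?thesis by (simp add: Hm1_combination[OF F] zero)
  qed
  have inner: "L2_inner M (r n) (\<phi> j) = (if j < n then 0 else ?a j)" for n j
  proof -
    have "r n = (\<lambda>x. f x - (\<Sum>k<n. ?a k * \<phi> k x))" by (simp add: r_def fun_eq_iff)
    then show ?thesis by (simp add: L2_inner_diff_left H1_L2[OF f] inner_combination)
  qed
  have rH: "r n \<in> H1_zero_mean M lam \<phi>" for n
  proof -
    have "r n \<in> L2_zero_mean M"
    proof -
      have L: "f \<in> L2_zero_mean M" "(\<lambda>x. \<Sum>k<n. ?a k * \<phi> k x) \<in> L2_zero_mean M"
        using f by (auto simp: H1_zero_mean_def combination_zero_mean)
      have "integrable M f" "integrable M (\<lambda>x. \<Sum>k<n. ?a k * \<phi> k x)"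
        by (intro L2_integrable finite_measure_axioms L2_zero_mean_L2 L)+
      moreover have "(\<lambda>x. f x - (\<Sum>k<n. ?a k * \<phi> k x)) \<in> L2 M" using L by (intro L2_diff L2_zero_mean_L2)
      ultimately show ?thesis using L by (simp add: L2_zero_mean_def r_def[abs_def])
    qed
    moreover have "summable (\<lambda>j. (lam j)\<^sup>2 * (cmod (L2_inner M (r n) (\<phi> j)))\<^sup>2)"
      by (rule summable_comparison_test'[OF sm, of 0]) (simp add: inner)
    ultimately show ?thesis by (simp add: H1_zero_mean_def)
  qed
  have norm_r: "H1_norm M lam \<phi> (r n) = sqrt (\<Sum>j. ?s (j + n))" for n
  proof -
    have "(\<Sum>j. (lam j)\<^sup>2 * (cmod (L2_inner M (r n) (\<phi> j)))\<^sup>2) = (\<Sum>j. if j < n then 0 else ?s j)"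
      by (intro suminf_cong) (simp add: inner)
    also have "\<dots> = (\<Sum>j. ?s (j + n))"
      by (subst suminf_split_initial_segment[where k = n])
        (auto intro: summable_comparison_test'[OF sm, of 0])
    finally show ?thesis by (simp add: H1_norm_def)
  qed
  have "(\<lambda>n. C * H1_norm M lam \<phi> (r n)) \<longlonglongrightarrow> C * sqrt 0"
    unfolding norm_r by (intro tendsto_intros suminf_exist_split2 sm)
  then have "cmod (F f) \<le> C * sqrt 0"
    by (rule LIMSEQ_le_const) (use C[OF rH] Fr in auto)
  then show ?thesis by simp
qed

end

section \<open>Observability constants as inequalities for finite sums\<close>

context spectral_basis
begin

text \<open>
  The coefficients \<open>p\<close> and \<open>q\<close> of initial data.
\<close>

abbreviation y0_coeff :: "('m \<Rightarrow> complex) \<Rightarrow> nat \<Rightarrow> complex" where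
  "y0_coeff y0 k \<equiv> L2_inner M y0 (\<phi> k)"

abbreviation y1_coeff :: "(('m \<Rightarrow> complex) \<Rightarrow> complex) \<Rightarrow> nat \<Rightarrow> complex" where
  "y1_coeff y1 k \<equiv> y1 (\<phi> k) / of_real (lam k)"

lemma wave_solution_iff:
  "wave_solution M lam \<phi> y0 y1 y \<longleftrightarrow>
     (\<forall>t. L2_sums M (\<lambda>j x. mode_coeff lam (y0_coeff y0) (y1_coeff y1) t j * \<phi> j x) (y t))"
  by (simp add: wave_solution_def mode_coeff_def)

lemma data_norm_tendsto:
  assumes "(y0, y1) \<in> nonzero_data M lam \<phi>"
  shows "(\<lambda>n. sqnorm n (y0_coeff y0) + sqnorm n (y1_coeff y1)) \<longlonglongrightarrow> data_norm_sq M lam \<phi> y0 y1"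
proof -
  have "(\<lambda>n. \<Sum>j<n. (cmod (y1 (\<phi> j)))\<^sup>2 / (lam j)\<^sup>2) \<longlonglongrightarrow> (\<Sum>j. (cmod (y1 (\<phi> j)))\<^sup>2 / (lam j)\<^sup>2)"
    using assms by (intro summable_LIMSEQ Hm1_summable) (simp add: nonzero_data_def)
  moreover have "sqnorm n (y1_coeff y1) = (\<Sum>j<n. (cmod (y1 (\<phi> j)))\<^sup>2 / (lam j)\<^sup>2)" for n
    by (simp add: sqnorm_def norm_divide power_divide)
  ultimately show ?thesis
    unfolding data_norm_sq_def using assms by (intro tendsto_add parseval) (simp_all add: nonzero_data_def)
qed

lemma sqnorm_mono: "m \<le> n \<Longrightarrow> sqnorm m c \<le> sqnorm n c"
  unfolding sqnorm_def by (rule sum_mono2) auto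

lemma data_norm_ge:
  assumes "(y0, y1) \<in> nonzero_data M lam \<phi>"
  shows "sqnorm n (y0_coeff y0) + sqnorm n (y1_coeff y1) \<le> data_norm_sq M lam \<phi> y0 y1"
  by (rule LIMSEQ_le_const[OF data_norm_tendsto[OF assms]]) (blast intro: add_mono sqnorm_mono)

text \<open>
  The quotient defining the observability ratio is a genuine one for nonzero data.
\<close>

lemma data_norm_pos:
  assumes "(y0, y1) \<in> nonzero_data M lam \<phi>"
  shows "0 < data_norm_sq M lam \<phi> y0 y1"
proof (rule ccontr)
  assume "\<not> 0 < data_norm_sq M lam \<phi> y0 y1"
  then have le: "sqnorm n (y0_coeff y0) + sqnorm n (y1_coeff y1) \<le> 0" for n
    using data_norm_ge[OF assms, of n] by linarith
  have z: "sqnorm n (y0_coeff y0) = 0" "sqnorm n (y1_coeff y1) = 0" for n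
    using le[of n] sqnorm_nonneg[of n "y0_coeff y0"] sqnorm_nonneg[of n "y1_coeff y1"] by linarith+
  have y0: "y0 \<in> L2_zero_mean M" and y1: "y1 \<in> Hm1 M lam \<phi>"
    using assms by (auto simp: nonzero_data_def)
  have "y1 (\<phi> j) = 0" for j
  proof -
    have "(cmod (y1_coeff y1 j))\<^sup>2 \<le> sqnorm (Suc j) (y1_coeff y1)"
      unfolding sqnorm_def by (rule member_le_sum) auto
    then show ?thesis using z(2)[of "Suc j"] lam_pos[of j] by simp
  qed
  then have "\<forall>f\<in>H1_zero_mean M lam \<phi>. y1 f = 0"
    using Hm1_determined_by_coefficients[OF y1] by blast
  moreover have "(LINT x|M. (cmod (y0 x))\<^sup>2) = 0"
    using LIMSEQ_unique[OF parseval[OF y0]] z(1) by simp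
  then have "AE x in M. y0 x = 0"
    using integral_nonneg_eq_0_iff_AE[OF L2_D(2)[OF L2_zero_mean_L2[OF y0]]] by simp
  ultimately show False using assms by (auto simp: nonzero_data_def)
qed

text \<open>
  The truncated energies converge for each \<open>t\<close> and are bounded by the norm of the data, so
  dominated convergence applies.
\<close>

lemma integral_energy_tendsto:
  assumes data: "(y0, y1) \<in> nonzero_data M lam \<phi>" and y: "wave_solution M lam \<phi> y0 y1 y" and \<omega>: "\<omega> \<in> sets M"
  shows "(\<lambda>n. integral {0..T} (\<lambda>t. qform (gram M \<phi> \<omega>) n (mode_coeff lam (y0_coeff y0) (y1_coeff y1) t)))
    \<longlonglongrightarrow> (LINT t:{0..T}|lborel. LINT x:\<omega>|M. (cmod (y t x))\<^sup>2)"
proof -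
  interpret gram_bounds "gram M \<phi> \<omega>" by (rule gram_bounds_gram[OF \<omega>])
  let ?E = "\<lambda>n t. qform (gram M \<phi> \<omega>) n (mode_coeff lam (y0_coeff y0) (y1_coeff y1) t)"
  let ?D = "data_norm_sq M lam \<phi> y0 y1"
  have lim: "(\<lambda>n. ?E n t) \<longlonglongrightarrow> (LINT x:\<omega>|M. (cmod (y t x))\<^sup>2)" for t
    using y unfolding wave_solution_iff by (intro L2_sums_energy \<omega>) blast
  have int: "set_integrable lborel {0..T} (?E n)" for n
    by (intro borel_integrable_atLeastAtMost' continuous_intros)
  have eq: "integral {0..T} (?E n) = (LINT t|lborel. indicator {0..T} t *\<^sub>R ?E n t)" for n
    using set_borel_integral_eq_integral(2)[OF int] by (simp add: set_lebesgue_integral_def)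
  have meas: "(\<lambda>t. indicator {0..T} t *\<^sub>R ?E n t) \<in> borel_measurable lborel" for n
    using int unfolding set_integrable_def by (rule borel_measurable_integrable)
  have pt: "(\<lambda>n. indicator {0..T} t *\<^sub>R ?E n t) \<longlonglongrightarrow> indicator {0..T} t *\<^sub>R (LINT x:\<omega>|M. (cmod (y t x))\<^sup>2)" for t
    by (intro tendsto_intros lim)
  have le: "?E n t \<le> ?D" for n t
    using qform_le[of n] sqnorm_mode_coeff_le[of n lam "y0_coeff y0" "y1_coeff y1" t] data_norm_ge[OF data, of n]
    by (meson order_trans)
  show ?thesis
    unfolding eq set_lebesgue_integral_def[where M = lborel]
  proof (rule integral_dominated_convergence)
    show "(\<lambda>t. indicator {0..T} t *\<^sub>R (LINT x:\<omega>|M. (cmod (y t x))\<^sup>2)) \<in> borel_measurable lborel"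
      by (rule borel_measurable_LIMSEQ_metric[OF meas pt])
    show "integrable lborel (\<lambda>t. indicator {0..T} t *\<^sub>R ?D)"
      using integrable_real_indicator[of "{0..T}" lborel] by (cases "0 \<le> T") (auto simp: emeasure_lborel_Icc_eq)
    show "AE t in lborel. norm (indicator {0..T} t *\<^sub>R ?E n t) \<le> indicator {0..T} t *\<^sub>R ?D" for n
      using qform_nonneg le by (auto simp: indicator_def)
  qed (use meas pt in auto)
qed

text \<open>
  Arbitrary nonzero finite coefficient sequences come from admissible data and an explicit wave.
\<close>

lemma finite_data:
  fixes p q :: "nat \<Rightarrow> complex" and n :: nat
  defines "P \<equiv> \<lambda>k. if k < n then p k else 0" and "Q \<equiv> \<lambda>k. if k < n then q k else 0"
  assumes nz: "sqnorm n p + sqnorm n q \<noteq> 0"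
  obtains y0 y1 y where "(y0, y1) \<in> nonzero_data M lam \<phi>" "wave_solution M lam \<phi> y0 y1 y"
    "y0_coeff y0 = P" "\<And>k. y1 (\<phi> k) = of_real (lam k) * Q k"
    "data_norm_sq M lam \<phi> y0 y1 = sqnorm n p + sqnorm n q"
    "\<And>t. y t = (\<lambda>x. \<Sum>k<n. mode_coeff lam p q t k * \<phi> k x)"
proof -
  define y0 where "y0 x = (\<Sum>k<n. p k * \<phi> k x)" for x
  define y1 where "y1 f = (\<Sum>k<n. of_real (lam k) * q k * cnj (L2_inner M f (\<phi> k)))" for f
  have y0: "y0 \<in> L2_zero_mean M" "y0_coeff y0 = P"
    unfolding y0_def[abs_def] P_def by (simp_all add: combination_zero_mean inner_combination fun_eq_iff)
  have y1c: "y1 (\<phi> k) = of_real (lam k) * Q k" for k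
    by (simp add: y1_def orthonormal Q_def if_distrib[where f = cnj] if_distrib[where f = "\<lambda>x. _ * x"] cong: if_cong)
  then have y1_Q: "y1_coeff y1 = Q"
    using lam_pos by (simp add: fun_eq_iff less_imp_neq[symmetric])
  have y1: "y1 \<in> Hm1 M lam \<phi>"
    unfolding Hm1_def
  proof (intro CollectI conjI ballI allI exI)
    fix f h c assume f: "f \<in> H1_zero_mean M lam \<phi>" and h: "h \<in> H1_zero_mean M lam \<phi>"
    have "L2_inner M (\<lambda>x. f x + c * h x) (\<phi> k) = L2_inner M f (\<phi> k) + c * L2_inner M h (\<phi> k)" for k
      using f h by (simp add: L2_inner_add_left L2_inner_scale_left L2_scale H1_L2)
    then show "y1 (\<lambda>x. f x + c * h x) = y1 f + cnj c * y1 h"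
      by (simp add: y1_def sum_distrib_left algebra_simps sum.distrib)
  next
    fix f assume f: "f \<in> H1_zero_mean M lam \<phi>"
    have "cmod (y1 f) \<le> (\<Sum>k<n. cmod (q k) * (lam k * cmod (L2_inner M f (\<phi> k))))"
      unfolding y1_def using lam_pos
      by (intro order_trans[OF norm_sum] sum_mono) (simp add: norm_mult less_imp_le mult_ac)
    also have "\<dots> \<le> (\<Sum>k<n. cmod (q k) * H1_norm M lam \<phi> f)"
      by (intro sum_mono mult_left_mono coefficient_le_H1_norm f) auto
    finally show "cmod (y1 f) \<le> (\<Sum>k<n. cmod (q k)) * H1_norm M lam \<phi> f"
      by (simp add: sum_distrib_right)
  qed
  have sq: "sqnorm m P + sqnorm m Q = sqnorm n p + sqnorm n q" if "n \<le> m" for m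
    using that sqnorm_extend[of n P m] sqnorm_extend[of n Q m] sqnorm_cong[of n P p] sqnorm_cong[of n Q q]
    by (simp add: P_def Q_def)
  have "\<not> ((AE x in M. y0 x = 0) \<and> (\<forall>f\<in>H1_zero_mean M lam \<phi>. y1 f = 0))"
  proof
    assume z: "(AE x in M. y0 x = 0) \<and> (\<forall>f\<in>H1_zero_mean M lam \<phi>. y1 f = 0)"
    then have "y0_coeff y0 k = 0" for k
      unfolding L2_inner_def by (intro integral_eq_zero_AE) auto
    then have "P k = 0" for k unfolding y0(2)[symmetric] .
    moreover have "Q k = 0" for k using z phi_H1[of k] y1c[of k] lam_pos[of k] by auto
    ultimately show False using sq[of n] nz by (simp add: sqnorm_def)
  qed
  then have data: "(y0, y1) \<in> nonzero_data M lam \<phi>"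
    using y0 y1 by (simp add: nonzero_data_def)
  have sol: "wave_solution M lam \<phi> y0 y1 (\<lambda>t x. \<Sum>k<n. mode_coeff lam p q t k * \<phi> k x)"
    unfolding wave_solution_iff y0 y1_Q
  proof
    fix t
    have "mode_coeff lam P Q t = (\<lambda>j. if j < n then mode_coeff lam p q t j else 0)"
      by (simp add: fun_eq_iff mode_coeff_def P_def Q_def)
    then show "L2_sums M (\<lambda>j x. mode_coeff lam P Q t j * \<phi> j x) (\<lambda>x. \<Sum>k<n. mode_coeff lam p q t k * \<phi> k x)"
      using L2_sums_finite[of n "mode_coeff lam p q t"] by simp
  qed
  have "(\<lambda>m. sqnorm m P + sqnorm m Q) \<longlonglongrightarrow> sqnorm n p + sqnorm n q"
    by (rule tendsto_eventually) (use sq in \<open>auto simp: eventually_sequentially\<close>)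
  then have "data_norm_sq M lam \<phi> y0 y1 = sqnorm n p + sqnorm n q"
    using LIMSEQ_unique[OF data_norm_tendsto[OF data]] y0 y1_Q by simp
  then show thesis using that[OF data sol] y0 y1c by simp
qed

text \<open>
  The observability constant is the largest \<open>m\<close> admissible for finite sums.
\<close>

theorem obs_const_above_iff_observes:
  assumes \<omega>: "\<omega> \<in> sets M" and T: "0 \<le> T"
  shows "m \<le> obs_const_above M lam \<phi> N \<omega> T \<longleftrightarrow> observes lam (gram M \<phi> \<omega>) N T m"
proof -
  interpret gram_bounds "gram M \<phi> \<omega>" by (rule gram_bounds_gram[OF \<omega>])
  let ?S = "{obs_ratio M lam \<phi> \<omega> T y0 y1 y | y0 y1 y.
     (y0, y1) \<in> nonzero_data M lam \<phi> \<and> wave_solution M lam \<phi> y0 y1 y \<and>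
     (\<forall>j<N. L2_inner M y0 (\<phi> j) = 0 \<and> y1 (\<phi> j) = 0)}"
  have lower: "a \<le> r" if r: "r \<in> ?S" and a: "observes lam (gram M \<phi> \<omega>) N T a" for a r
  proof -
    obtain y0 y1 y where r_eq: "r = obs_ratio M lam \<phi> \<omega> T y0 y1 y" and data: "(y0, y1) \<in> nonzero_data M lam \<phi>"
      and sol: "wave_solution M lam \<phi> y0 y1 y" and z: "\<forall>j<N. L2_inner M y0 (\<phi> j) = 0 \<and> y1 (\<phi> j) = 0"
      using r by blast
    have "a * data_norm_sq M lam \<phi> y0 y1 \<le> (LINT t:{0..T}|lborel. LINT x:\<omega>|M. (cmod (y t x))\<^sup>2)"
    proof (rule LIMSEQ_le[OF tendsto_mult[OF tendsto_const data_norm_tendsto[OF data]] integral_energy_tendsto[OF data sol \<omega>]])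
      show "\<exists>n0. \<forall>n\<ge>n0. a * (sqnorm n (y0_coeff y0) + sqnorm n (y1_coeff y1))
          \<le> integral {0..T} (\<lambda>t. qform (gram M \<phi> \<omega>) n (mode_coeff lam (y0_coeff y0) (y1_coeff y1) t))"
        using observesD[OF a] z by simp
    qed
    then show ?thesis using data_norm_pos[OF data] by (simp add: r_eq obs_ratio_def field_simps)
  qed
  have attained: "(observed_energy lam (gram M \<phi> \<omega>) n p q T) / (sqnorm n p + sqnorm n q) \<in> ?S"
    if z: "\<forall>k<N. p k = 0 \<and> q k = 0" and nz: "sqnorm n p + sqnorm n q \<noteq> 0" for n p q
  proof -
    obtain y0 y1 y where y: "(y0, y1) \<in> nonzero_data M lam \<phi>" "wave_solution M lam \<phi> y0 y1 y"
      "y0_coeff y0 = (\<lambda>k. if k < n then p k else 0)" "\<And>k. y1 (\<phi> k) = of_real (lam k) * (if k < n then q k else 0)"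
      "data_norm_sq M lam \<phi> y0 y1 = sqnorm n p + sqnorm n q"
      "\<And>t. y t = (\<lambda>x. \<Sum>k<n. mode_coeff lam p q t k * \<phi> k x)"
      using finite_data[OF nz] by blast
    have "set_integrable lborel {0..T} (\<lambda>t. qform (gram M \<phi> \<omega>) n (mode_coeff lam p q t))"
      by (intro borel_integrable_atLeastAtMost' continuous_intros)
    from set_borel_integral_eq_integral(2)[OF this]
    have "obs_ratio M lam \<phi> \<omega> T y0 y1 y = (observed_energy lam (gram M \<phi> \<omega>) n p q T) / (sqnorm n p + sqnorm n q)"
      unfolding obs_ratio_def y(5,6) by (simp add: set_integral_combination[OF \<omega>])
    moreover have "\<forall>j<N. L2_inner M y0 (\<phi> j) = 0 \<and> y1 (\<phi> j) = 0"
      using z y(4) fun_cong[OF y(3)] by simp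
    ultimately show ?thesis using y(1,2)
      by (intro CollectI exI[of _ y0] exI[of _ y1] exI[of _ y]) simp
  qed
  have ne: "?S \<noteq> {}"
  proof -
    let ?p = "\<lambda>k. if k = N then 1 else (0::complex)"
    have "sqnorm (Suc N) ?p + sqnorm (Suc N) (\<lambda>_. 0) = 1" by (simp add: sqnorm_def)
    then show ?thesis using attained[of ?p "\<lambda>_. 0" "Suc N"] by auto
  qed
  have bdd: "bdd_below ?S"
    by (rule bdd_belowI[where m = 0]) (use lower observes_zero[OF T] in blast)
  show ?thesis
  proof
    assume "observes lam (gram M \<phi> \<omega>) N T m"
    then show "m \<le> obs_const_above M lam \<phi> N \<omega> T"
      unfolding obs_const_above_def by (intro cInf_greatest ne) (rule lower)
  next
    assume m: "m \<le> obs_const_above M lam \<phi> N \<omega> T"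
    show "observes lam (gram M \<phi> \<omega>) N T m"
      unfolding observes_def
    proof (intro allI impI)
      fix p q :: "nat \<Rightarrow> complex" and n assume z: "\<forall>k<N. p k = 0 \<and> q k = 0"
      let ?I = "observed_energy lam (gram M \<phi> \<omega>) n p q T"
      show "m * (sqnorm n p + sqnorm n q) \<le> ?I"
      proof (cases "sqnorm n p + sqnorm n q = 0")
        case True
        then show ?thesis by (simp add: integral_nonneg qform_nonneg)
      next
        case False
        then have "0 < sqnorm n p + sqnorm n q"
          using sqnorm_nonneg[of n p] sqnorm_nonneg[of n q] by linarith
        moreover have "m \<le> ?I / (sqnorm n p + sqnorm n q)"
          using m cInf_lower[OF attained[OF z False] bdd] unfolding obs_const_above_def by linarith
        ultimately show ?thesis by (simp add: field_simps)
      qed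
    qed
  qed
qed

lemma obs_const_eq: "obs_const M lam \<phi> \<omega> T = obs_const_above M lam \<phi> 0 \<omega> T"
  by (simp add: obs_const_def obs_const_above_def)

end

section \<open>Continuously differentiable functions\<close>

text \<open>
  Continuous differentiability, meant for open sets; the derivative is continuous in each fixed
  direction.  This is the case \<open>k = 1\<close> of \<open>Ck_on\<close>.
\<close>

definition C1_on :: "'a::real_normed_vector set \<Rightarrow> ('a \<Rightarrow> 'b::real_normed_vector) \<Rightarrow> bool" where
  "C1_on S f \<longleftrightarrow> (\<forall>x\<in>S. f differentiable at x) \<and>
     (\<forall>v. continuous_on S (\<lambda>x. frechet_derivative f (at x) v))"

lemma C1_onI:
  assumes "\<And>x. x \<in> S \<Longrightarrow> (f has_derivative f' x) (at x)" "\<And>v. continuous_on S (\<lambda>x. f' x v)"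
  shows "C1_on S f"
proof -
  have "frechet_derivative f (at x) = f' x" if "x \<in> S" for x
    using frechet_derivative_at[OF assms(1)[OF that]] by simp
  then show ?thesis
    using assms by (auto simp: C1_on_def differentiable_def cong: continuous_on_cong)
qed

lemma C1_on_has_derivative:
  "C1_on S f \<Longrightarrow> x \<in> S \<Longrightarrow> (f has_derivative frechet_derivative f (at x)) (at x)"
  by (simp add: C1_on_def frechet_derivative_works[symmetric])

lemma C1_on_differentiable: "C1_on S f \<Longrightarrow> x \<in> S \<Longrightarrow> f differentiable at x"
  by (simp add: C1_on_def)

lemma C1_on_continuous_derivative:
  "C1_on S f \<Longrightarrow> continuous_on S (\<lambda>x. frechet_derivative f (at x) v)"
  by (simp add: C1_on_def)

lemma C1_on_continuous: "C1_on S f \<Longrightarrow> continuous_on S f"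
  by (meson C1_on_has_derivative continuous_at_imp_continuous_on has_derivative_continuous)

lemma Ck_on_C1: "Ck_on (Suc k) S f \<Longrightarrow> C1_on S f"
proof -
  have "continuous_on S h" if "Ck_on k S h" for h :: "'a \<Rightarrow> 'b"
  proof (cases k)
    case (Suc k')
    then show ?thesis
      using that by (auto intro!: continuous_at_imp_continuous_on differentiable_imp_continuous_within)
  qed (use that in simp)
  then show "Ck_on (Suc k) S f \<Longrightarrow> C1_on S f" by (simp add: C1_on_def)
qed

lemma smooth_on_C1: "smooth_on S f \<Longrightarrow> C1_on S f"
  unfolding smooth_on_def by (blast intro: Ck_on_C1)

lemma smooth_on_derivative_C1: "smooth_on S f \<Longrightarrow> C1_on S (\<lambda>x. frechet_derivative f (at x) v)"
  unfolding smooth_on_def by (metis Ck_on.simps(2) Ck_on_C1)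

lemma C1_on_const [simp]: "C1_on S (\<lambda>x. c)"
  by (rule C1_onI) (auto intro!: derivative_eq_intros)

lemma C1_on_bounded_linear:
  assumes "bounded_linear L" "C1_on S f" shows "C1_on S (\<lambda>x. L (f x))"
  by (rule C1_onI[OF bounded_linear.has_derivative[OF assms(1) C1_on_has_derivative[OF assms(2)]]])
    (auto intro!: linear_continuous_on_compose bounded_linear.continuous_on[OF assms(1)] C1_on_continuous_derivative assms)

lemma C1_on_add: "C1_on S f \<Longrightarrow> C1_on S h \<Longrightarrow> C1_on S (\<lambda>x. f x + h x)"
  by (rule C1_onI[OF has_derivative_add[OF C1_on_has_derivative C1_on_has_derivative]])
    (auto intro!: continuous_intros C1_on_continuous_derivative)

lemma C1_on_diff: "C1_on S f \<Longrightarrow> C1_on S h \<Longrightarrow> C1_on S (\<lambda>x. f x - h x)"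
  by (rule C1_onI[OF has_derivative_diff[OF C1_on_has_derivative C1_on_has_derivative]])
    (auto intro!: continuous_intros C1_on_continuous_derivative)

lemma C1_on_sum: "(\<And>k. k \<in> I \<Longrightarrow> C1_on S (f k)) \<Longrightarrow> C1_on S (\<lambda>x. \<Sum>k\<in>I. f k x)"
  by (induction I rule: infinite_finite_induct) (auto intro: C1_on_add)

lemma C1_on_bilinear:
  assumes "bounded_bilinear B" "C1_on S f" "C1_on S h" shows "C1_on S (\<lambda>x. B (f x) (h x))"
proof (rule C1_onI)
  show "((\<lambda>x. B (f x) (h x)) has_derivative
      (\<lambda>v. B (f x) (frechet_derivative h (at x) v) + B (frechet_derivative f (at x) v) (h x))) (at x)" if "x \<in> S" for x
    by (rule bounded_bilinear.FDERIV[OF assms(1) C1_on_has_derivative[OF assms(2) that] C1_on_has_derivative[OF assms(3) that]])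
  show "continuous_on S (\<lambda>x. B (f x) (frechet_derivative h (at x) v) + B (frechet_derivative f (at x) v) (h x))" for v
    by (intro continuous_on_add bounded_bilinear.continuous_on[OF assms(1)] C1_on_continuous_derivative[OF assms(2)]
      C1_on_continuous_derivative[OF assms(3)] C1_on_continuous[OF assms(2)] C1_on_continuous[OF assms(3)])
qed

lemma C1_on_mult:
  fixes f h :: "_ \<Rightarrow> 'b::real_normed_algebra"
  shows "C1_on S f \<Longrightarrow> C1_on S h \<Longrightarrow> C1_on S (\<lambda>x. f x * h x)"
  by (rule C1_on_bilinear[OF bounded_bilinear_mult])

lemma C1_on_scaleR: "C1_on S f \<Longrightarrow> C1_on S h \<Longrightarrow> C1_on S (\<lambda>x. f x *\<^sub>R h x)"
  by (rule C1_on_bilinear[OF bounded_bilinear_scaleR])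

lemma C1_on_prod:
  fixes f :: "_ \<Rightarrow> _ \<Rightarrow> 'b::real_normed_field"
  shows "(\<And>k. k \<in> I \<Longrightarrow> C1_on S (f k)) \<Longrightarrow> C1_on S (\<lambda>x. \<Prod>k\<in>I. f k x)"
  by (induction I rule: infinite_finite_induct) (auto intro: C1_on_mult)

lemma C1_on_compose_real:
  fixes f :: "_ \<Rightarrow> real"
  assumes f: "C1_on S f" and h: "\<And>x. x \<in> S \<Longrightarrow> (h has_real_derivative h' (f x)) (at (f x))"
    and cont: "continuous_on (f ` S) h'"
  shows "C1_on S (\<lambda>x. h (f x))"
proof (rule C1_onI)
  fix x assume x: "x \<in> S"
  show "((\<lambda>x. h (f x)) has_derivative (\<lambda>v. h' (f x) * frechet_derivative f (at x) v)) (at x)"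
    using has_derivative_compose[OF C1_on_has_derivative[OF f x] h[OF x, unfolded has_field_derivative_def]] .
qed (intro continuous_intros continuous_on_compose2[OF cont] C1_on_continuous[OF f] C1_on_continuous_derivative[OF f] order_refl)

lemma C1_on_inverse:
  fixes f :: "_ \<Rightarrow> real" assumes "C1_on S f" "\<And>x. x \<in> S \<Longrightarrow> f x \<noteq> 0"
  shows "C1_on S (\<lambda>x. inverse (f x))"
  by (rule C1_on_compose_real[where h' = "\<lambda>y. - (inverse y * inverse y)"])
    (use assms in \<open>auto intro!: derivative_eq_intros continuous_intros simp: power2_eq_square\<close>)

lemma C1_on_sqrt:
  fixes f :: "_ \<Rightarrow> real" assumes "C1_on S f" "\<And>x. x \<in> S \<Longrightarrow> 0 < f x"
  shows "C1_on S (\<lambda>x. sqrt (f x))"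
proof (rule C1_on_compose_real[OF assms(1), where h' = "\<lambda>y. inverse (sqrt y) / 2"])
  show "(sqrt has_real_derivative inverse (sqrt (f x)) / 2) (at (f x))" if "x \<in> S" for x
    by (rule DERIV_real_sqrt) (rule assms(2)[OF that])
  have "sqrt y \<noteq> 0" if "y \<in> f ` S" for y using that assms(2) by force
  then show "continuous_on (f ` S) (\<lambda>y. inverse (sqrt y) / 2)" by (intro continuous_intros) auto
qed

text \<open>
  The square of the positive part is \<open>C\<^sup>1\<close>, also at the origin.
\<close>

lemma C1_on_bump:
  fixes f :: "_ \<Rightarrow> real" assumes "C1_on S f"
  shows "C1_on S (\<lambda>x. (max 0 (f x))\<^sup>2)"
proof (rule C1_on_compose_real[OF assms, where h' = "\<lambda>y. 2 * max 0 y"])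
  fix x
  have "((\<lambda>y. (max 0 y)\<^sup>2) has_real_derivative 2 * max 0 y) (at y)" for y :: real
  proof (cases y "0::real" rule: linorder_cases)
    case less
    have ev: "\<forall>\<^sub>F z in nhds y. 0 = (max 0 z)\<^sup>2"
      using eventually_nhds_in_open[of "{..<0}" y] less by (auto elim: eventually_mono)
    have "((\<lambda>y. (max 0 y)\<^sup>2) has_real_derivative 0) (at y)"
      by (rule DERIV_cong_ev[OF refl ev refl, THEN iffD1]) simp
    then show ?thesis using less by simp
  next
    case equal
    have "((\<lambda>h::real. (max 0 h)\<^sup>2 / h) \<longlongrightarrow> 0) (at 0)"
    proof (rule tendsto_rabs_zero_cancel, rule tendsto_sandwich[OF _ _ tendsto_const])
      show "\<forall>\<^sub>F h in at 0. \<bar>(max 0 h)\<^sup>2 / h\<bar> \<le> \<bar>h :: real\<bar>"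
        by (intro always_eventually allI) (auto simp: max_def power2_eq_square)
      show "((\<lambda>h::real. \<bar>h\<bar>) \<longlongrightarrow> 0) (at 0)" by (intro tendsto_rabs_zero tendsto_ident_at)
    qed simp
    then show ?thesis using equal by (simp add: DERIV_def)
  next
    case greater
    have ev: "\<forall>\<^sub>F z in nhds y. z\<^sup>2 = (max 0 z)\<^sup>2"
      using eventually_nhds_in_open[of "{0<..}" y] greater by (auto elim: eventually_mono)
    have "((\<lambda>y. (max 0 y)\<^sup>2) has_real_derivative 2 * y) (at y)"
      by (rule DERIV_cong_ev[OF refl ev refl, THEN iffD1]) (auto intro!: derivative_eq_intros)
    then show ?thesis using greater by simp
  qed
  then show "((\<lambda>y. (max 0 y)\<^sup>2) has_real_derivative 2 * max 0 (f x)) (at (f x))" .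
qed (intro continuous_intros)

lemma C1_on_local:
  assumes "\<And>x. x \<in> S \<Longrightarrow> \<exists>V h. open V \<and> x \<in> V \<and> C1_on V h \<and> (\<forall>z\<in>V. f z = h z)"
  shows "C1_on S f"
proof -
  have *: "(f has_derivative frechet_derivative h (at z)) (at z)"
    if "open V" "z \<in> V" "C1_on V h" "\<forall>z\<in>V. f z = h z" for V h z
    by (rule has_derivative_transform_within_open[OF C1_on_has_derivative[OF that(3,2)] that(1,2)])
      (use that in auto)
  have "f differentiable at x" if "x \<in> S" for x
    using assms[OF that] * unfolding differentiable_def by blast
  moreover have "isCont (\<lambda>x. frechet_derivative f (at x) v) x" if "x \<in> S" for x v
  proof -
    obtain V h where V: "open V" "x \<in> V" "C1_on V h" "\<forall>z\<in>V. f z = h z" using assms[OF \<open>x \<in> S\<close>] by blast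
    have "isCont (\<lambda>x. frechet_derivative h (at x) v) x"
      using C1_on_continuous_derivative[OF V(3)] V(1,2) by (simp add: continuous_on_eq_continuous_at)
    moreover have "\<forall>\<^sub>F z in nhds x. frechet_derivative f (at z) v = frechet_derivative h (at z) v"
      using eventually_nhds_in_open[OF V(1,2)]
      by eventually_elim (metis * V frechet_derivative_at)
    ultimately show ?thesis by (simp add: isCont_cong)
  qed
  ultimately show ?thesis by (auto simp: C1_on_def intro: continuous_at_imp_continuous_on)
qed

lemma C1_on_cong:
  assumes "open S" "C1_on S h" "\<And>x. x \<in> S \<Longrightarrow> f x = h x" shows "C1_on S f"
  using assms by (intro C1_on_local) blast

lemma frechet_derivative_cong:
  assumes "open S" "x \<in> S" "\<And>x. x \<in> S \<Longrightarrow> f x = h x"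
  shows "frechet_derivative f (at x) = frechet_derivative h (at x)"
proof -
  have "(f has_derivative f') (at x) \<longleftrightarrow> (h has_derivative f') (at x)" for f'
    using has_derivative_transform_within_open[OF _ assms(1,2)] assms(3) by metis
  then show ?thesis by (simp add: frechet_derivative_def)
qed

lemma Ck_on_cong:
  assumes "open S" "\<And>x. x \<in> S \<Longrightarrow> f x = h x" "Ck_on k S f"
  shows "Ck_on k S h"
  using assms(2,3)
proof (induction k arbitrary: f h)
  case 0
  then show ?case by (simp cong: continuous_on_cong)
next
  case (Suc k)
  have eq: "frechet_derivative f (at x) = frechet_derivative h (at x)" if "x \<in> S" for x
    by (rule frechet_derivative_cong[OF assms(1) that Suc.prems(1)])
  have "h differentiable at x" if "x \<in> S" for x
  proof -
    have "f differentiable at x" using Suc.prems(2) that by simp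
    then obtain D where "(f has_derivative D) (at x)" unfolding differentiable_def by (rule exE)
    then have "(h has_derivative D) (at x)"
      by (rule has_derivative_transform_within_open[OF _ assms(1) that Suc.prems(1)])
    then show ?thesis by (rule differentiableI)
  qed
  moreover have "Ck_on k S (\<lambda>x. frechet_derivative h (at x) v)" for v
    by (rule Suc.IH[of "\<lambda>x. frechet_derivative f (at x) v"]) (use Suc.prems eq in auto)
  ultimately show ?case by simp
qed

lemma Ck_on_linear_combination:
  fixes f h :: "'a::real_normed_vector \<Rightarrow> complex"
  assumes "open S" "Ck_on k S f" "Ck_on k S h"
  shows "Ck_on k S (\<lambda>x. f x + c * h x)"
  using assms(2,3)
proof (induction k arbitrary: f h)
  case 0
  then show ?case by (auto intro!: continuous_intros)
next
  case (Suc k)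
  have d: "((\<lambda>x. f x + c * h x) has_derivative
      (\<lambda>v. frechet_derivative f (at x) v + c * frechet_derivative h (at x) v)) (at x)" if "x \<in> S" for x
    using Suc.prems that by (auto intro!: derivative_eq_intros simp: frechet_derivative_works[symmetric])
  have "Ck_on k S (\<lambda>x. frechet_derivative (\<lambda>x. f x + c * h x) (at x) v)" for v
  proof (rule Ck_on_cong[OF assms(1)])
    show "Ck_on k S (\<lambda>x. frechet_derivative f (at x) v + c * frechet_derivative h (at x) v)"
      by (rule Suc.IH) (use Suc.prems in simp_all)
    show "frechet_derivative f (at x) v + c * frechet_derivative h (at x) v
        = frechet_derivative (\<lambda>x. f x + c * h x) (at x) v" if "x \<in> S" for x
      using d[OF that] by (rule fun_cong[OF frechet_derivative_at])
  qed
  moreover have "(\<lambda>x. f x + c * h x) differentiable at x" if "x \<in> S" for x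
    using d[OF that] by (rule differentiableI)
  ultimately show ?case by simp
qed

lemma smooth_on_linear_combination:
  fixes f h :: "'a::real_normed_vector \<Rightarrow> complex"
  shows "open S \<Longrightarrow> smooth_on S f \<Longrightarrow> smooth_on S h \<Longrightarrow> smooth_on S (\<lambda>x. f x + c * h x)"
  by (simp add: smooth_on_def Ck_on_linear_combination)

lemma Ck_on_const: "Ck_on k S (\<lambda>x. c)"
  by (induction k arbitrary: c) (auto simp: frechet_derivative_const)

section \<open>The divergence theorem for compactly supported functions\<close>

text \<open>
  By translation invariance the difference quotients of \<open>F\<close> have integral zero.  They converge
  to the derivative and, by the mean value theorem, are dominated by a multiple of the indicator
  of a ball.
\<close>

lemma integral_directional_derivative_real:
  fixes F :: "'a::euclidean_space \<Rightarrow> real"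
  assumes F: "\<And>x. (F has_derivative F' x) (at x)" and cont: "continuous_on UNIV (\<lambda>x. F' x e)"
    and K: "compact K" "\<And>x. x \<notin> K \<Longrightarrow> F x = 0"
  shows "(LINT x|lborel. F' x e) = 0"
proof -
  have line: "((\<lambda>t. F (x + t *\<^sub>R e)) has_real_derivative F' (x + t *\<^sub>R e) e) (at t)" for x t
  proof -
    have "((\<lambda>t. F (x + t *\<^sub>R e)) has_derivative (\<lambda>s. F' (x + t *\<^sub>R e) (s *\<^sub>R e))) (at t)"
      by (rule has_derivative_compose[OF _ F]) (auto intro!: derivative_eq_intros)
    moreover have "F' (x + t *\<^sub>R e) (s *\<^sub>R e) = F' (x + t *\<^sub>R e) e * s" for s
      using linear_scale[OF has_derivative_linear[OF F[of "x + t *\<^sub>R e"]]] by simp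
    ultimately show ?thesis by (simp add: has_field_derivative_def)
  qed
  have F'0: "F' x e = 0" if "x \<notin> K" for x
  proof -
    have "(F has_derivative (\<lambda>_. 0)) (at x)"
      by (rule has_derivative_transform_within_open[of "\<lambda>_. 0" _ _ _ "- K"])
        (use K that in \<open>auto intro!: open_Compl compact_imp_closed\<close>)
    then show ?thesis using has_derivative_unique[OF F] by metis
  qed
  obtain B where B: "\<And>x. \<bar>F' x e\<bar> \<le> B" and B0: "0 \<le> B"
  proof -
    have "bounded ((\<lambda>x. F' x e) ` K)"
      by (intro compact_imp_bounded compact_continuous_image K continuous_on_subset[OF cont]) auto
    then obtain B where "\<And>x. x \<in> K \<Longrightarrow> \<bar>F' x e\<bar> \<le> B" by (auto simp: bounded_iff)
    then have "\<bar>F' x e\<bar> \<le> max B 0" for x using F'0[of x] by (cases "x \<in> K") (auto simp: le_max_iff_disj)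
    then show ?thesis by (intro that[of "max B 0"]) simp_all
  qed
  obtain R where R: "K \<subseteq> cball 0 R"
    using bounded_subset_ballD[OF compact_imp_bounded[OF K(1)], of 0] ball_subset_cball by blast
  define D where "D n x = (F (x + (1 / real (Suc n)) *\<^sub>R e) - F x) / (1 / real (Suc n))" for n x
  have D_lim: "(\<lambda>n. D n x) \<longlonglongrightarrow> F' x e" for x
  proof -
    have "((\<lambda>h. (F (x + h *\<^sub>R e) - F x) / h) \<longlongrightarrow> F' x e) (at 0)"
      using line[of x 0] by (simp add: DERIV_def)
    moreover have "filterlim (\<lambda>n. 1 / real (Suc n)) (at 0) sequentially"
      using LIMSEQ_inverse_real_of_nat by (simp add: filterlim_at inverse_eq_divide)
    ultimately show ?thesis unfolding D_def by (rule filterlim_compose)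
  qed
  have D_bound: "\<bar>D n x\<bar> \<le> B * indicator (cball 0 (R + norm e)) x" for n x
  proof (cases "x \<in> cball 0 (R + norm e)")
    case True
    let ?h = "1 / real (Suc n)"
    obtain z where "F (x + ?h *\<^sub>R e) - F (x + 0 *\<^sub>R e) = (?h - 0) * F' (x + z *\<^sub>R e) e"
      using MVT2[of 0 ?h "\<lambda>t. F (x + t *\<^sub>R e)" "\<lambda>t. F' (x + t *\<^sub>R e) e"] line by force
    then have "D n x = F' (x + z *\<^sub>R e) e" by (simp add: D_def field_simps)
    then show ?thesis using B True by simp
  next
    case False
    have "norm ((1 / real (Suc n)) *\<^sub>R e) \<le> 1 * norm e"
      unfolding norm_scaleR by (intro mult_right_mono) auto
    then have "R < norm (x + (1 / real (Suc n)) *\<^sub>R e)"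
      using False norm_triangle_ineq4[of "x + (1 / real (Suc n)) *\<^sub>R e" "(1 / real (Suc n)) *\<^sub>R e"] by simp
    moreover have "R < norm x" using False norm_ge_zero[of e] unfolding mem_cball_0 by linarith
    ultimately have "x \<notin> K" "x + (1 / real (Suc n)) *\<^sub>R e \<notin> K" using R by auto
    then show ?thesis using K(2) B0 by (simp add: D_def)
  qed
  have contF: "continuous_on UNIV F"
    using F by (auto intro!: continuous_at_imp_continuous_on has_derivative_continuous)
  have intF: "integrable lborel F"
  proof -
    have "integrable lborel (\<lambda>x. indicator K x *\<^sub>R F x)"
      by (rule borel_integrable_compact[OF K(1)]) (rule continuous_on_subset[OF contF], simp)
    moreover have "indicator K x *\<^sub>R F x = F x" for x using K(2)[of x] by (cases "x \<in> K") auto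
    ultimately show ?thesis by (simp only:)
  qed
  have shift: "integrable lborel (\<lambda>x. F (x + c))" "(LINT x|lborel. F (x + c)) = (LINT x|lborel. F x)" for c
  proof -
    have m: "(+) c \<in> measurable lborel borel" by simp
    have mF: "F \<in> borel_measurable borel" by (rule borel_measurable_continuous_onI[OF contF])
    show "integrable lborel (\<lambda>x. F (x + c))"
      using integrable_distr_eq[OF m mF] intF by (simp add: lborel_distr_plus add.commute)
    show "(LINT x|lborel. F (x + c)) = (LINT x|lborel. F x)"
      using integral_distr[OF m mF] by (simp add: lborel_distr_plus add.commute)
  qed
  have "(\<lambda>n. LINT x|lborel. D n x) \<longlonglongrightarrow> (LINT x|lborel. F' x e)"
  proof (rule integral_dominated_convergence)
    show "integrable lborel (\<lambda>x. B * indicator (cball 0 (R + norm e)) x)"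
      using emeasure_bounded_finite[of "cball 0 (R + norm e)"] by (intro integrable_mult_right) (simp add: integrable_indicator_iff)
    show "(\<lambda>x. F' x e) \<in> borel_measurable lborel"
      using borel_measurable_continuous_onI[OF cont] by simp
    show "D n \<in> borel_measurable lborel" for n
      unfolding D_def[abs_def] by (intro borel_measurable_divide borel_measurable_diff borel_measurable_const)
        (use shift(1) intF in \<open>auto dest: borel_measurable_integrable\<close>)
  qed (use D_lim D_bound in auto)
  moreover have "(LINT x|lborel. D n x) = 0" for n
    unfolding D_def using shift intF by simp
  ultimately show ?thesis by (simp add: LIMSEQ_const_iff)
qed

lemma integral_directional_derivative:
  fixes F :: "'a::euclidean_space \<Rightarrow> complex"
  assumes S: "open S" and F: "C1_on S F" and K: "compact K" "K \<subseteq> S" "\<And>x. x \<in> S - K \<Longrightarrow> F x = 0"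
  shows "integrable lborel (\<lambda>x. indicator S x *\<^sub>R frechet_derivative F (at x) e)"
    and "(LINT x|lborel. indicator S x *\<^sub>R frechet_derivative F (at x) e) = 0"
proof -
  \<comment> \<open>extension by zero is \<open>C\<^sup>1\<close> because \<open>S\<close> and the complement of \<open>K\<close> are open
      and cover the space\<close>
  define H where "H x = (if x \<in> S then F x else 0)" for x
  have "C1_on UNIV H"
  proof (rule C1_on_local)
    fix x
    show "\<exists>V h. open V \<and> x \<in> V \<and> C1_on V h \<and> (\<forall>z\<in>V. H z = h z)"
    proof (cases "x \<in> S")
      case True
      then show ?thesis using S F by (intro exI[of _ S] exI[of _ F]) (simp add: H_def)
    next
      case False
      have "open (- K)" using K(1) by (intro open_Compl compact_imp_closed)
      moreover have "x \<in> - K" using False K(2) by auto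
      moreover have "\<forall>z\<in>- K. H z = 0" using K(3) by (auto simp: H_def)
      ultimately show ?thesis using C1_on_const by blast
    qed
  qed
  note H = C1_on_has_derivative[OF this, OF UNIV_I] and contH = C1_on_continuous_derivative[OF this]
  have H0: "H x = 0" if "x \<notin> K" for x using that K(3) by (auto simp: H_def)
  have H'0: "frechet_derivative H (at x) e = 0" if "x \<notin> K" for x
  proof -
    have "(H has_derivative (\<lambda>_. 0)) (at x)"
      by (rule has_derivative_transform_within_open[of "\<lambda>_. 0" _ _ _ "- K"])
        (use K(1) H0 that in \<open>auto intro!: open_Compl compact_imp_closed\<close>)
    then show ?thesis using has_derivative_unique[OF H] by metis
  qed
  have eq: "indicator S x *\<^sub>R frechet_derivative F (at x) e = frechet_derivative H (at x) e" for x
  proof (cases "x \<in> S")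
    case True
    then show ?thesis using frechet_derivative_cong[OF S True, of H F] by (simp add: H_def)
  next
    case False
    then show ?thesis using H'0 K(2) by auto
  qed
  have int: "integrable lborel (\<lambda>x. frechet_derivative H (at x) e)"
  proof -
    have "integrable lborel (\<lambda>x. indicator K x *\<^sub>R frechet_derivative H (at x) e)"
      by (rule borel_integrable_compact[OF K(1)]) (rule continuous_on_subset[OF contH], simp)
    moreover have "indicator K x *\<^sub>R frechet_derivative H (at x) e = frechet_derivative H (at x) e" for x
      using H'0[of x] by (cases "x \<in> K") auto
    ultimately show ?thesis by (simp only:)
  qed
  then show "integrable lborel (\<lambda>x. indicator S x *\<^sub>R frechet_derivative F (at x) e)" by (simp add: eq)
  have "(LINT x|lborel. Re (frechet_derivative H (at x) e)) = 0"
    by (rule integral_directional_derivative_real[of "\<lambda>x. Re (H x)" "\<lambda>x v. Re (frechet_derivative H (at x) v)", OF _ _ K(1)])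
      (auto intro!: has_derivative_Re H continuous_intros contH simp: H0)
  moreover have "(LINT x|lborel. Im (frechet_derivative H (at x) e)) = 0"
    by (rule integral_directional_derivative_real[of "\<lambda>x. Im (H x)" "\<lambda>x v. Im (frechet_derivative H (at x) v)", OF _ _ K(1)])
      (auto intro!: has_derivative_Im H continuous_intros contH simp: H0)
  ultimately show "(LINT x|lborel. indicator S x *\<^sub>R frechet_derivative F (at x) e) = 0"
    unfolding eq using int by (simp add: complex_eq_iff)
qed

section \<open>Positive-definite matrices and partial derivatives\<close>

lemma positive_definite_invertible:
  fixes A :: "real^'n^'n"
  assumes "\<And>w. w \<noteq> 0 \<Longrightarrow> 0 < w \<bullet> (A *v w)" shows "invertible A"
  unfolding invertible_left_inverse matrix_left_invertible_ker
  using assms by (metis inner_zero_right less_irrefl)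

text \<open>
  The determinant does not vanish on the segment from the identity to \<open>A\<close>.
\<close>

lemma positive_definite_det_pos:
  fixes A :: "real^'n^'n"
  assumes "\<And>w. w \<noteq> 0 \<Longrightarrow> 0 < w \<bullet> (A *v w)" shows "0 < det A"
proof (rule ccontr)
  assume neg: "\<not> 0 < det A"
  let ?P = "\<lambda>t::real. t *\<^sub>R A + (1 - t) *\<^sub>R mat 1"
  have "continuous_on {0..1} (\<lambda>t. det (?P t))"
    unfolding det_def by (intro continuous_intros) 
  then obtain t where t: "0 \<le> t" "t \<le> 1" "det (?P t) = 0"
    using IVT2'[of "\<lambda>t. det (?P t)" 1 0 0] neg by auto
  have "0 < w \<bullet> (?P t *v w)" if w: "w \<noteq> 0" for w
  proof -
    have "w \<bullet> (?P t *v w) = t * (w \<bullet> (A *v w)) + (1 - t) * (w \<bullet> w)"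
      by (simp add: matrix_vector_mult_add_rdistrib scaleR_matrix_vector_assoc[symmetric] inner_add_right)
    moreover have "0 < w \<bullet> (A *v w)" "0 < w \<bullet> w" using assms w by auto
    ultimately show ?thesis
      using t by (cases "t = 0") (auto intro!: add_pos_nonneg)
  qed
  then have "invertible (?P t)" by (rule positive_definite_invertible)
  then show False using t by (simp add: invertible_det_nz)
qed

lemma matrix_inv_right_inverse: "invertible A \<Longrightarrow> A ** matrix_inv A = mat 1"
  and matrix_inv_left_inverse: "invertible A \<Longrightarrow> matrix_inv A ** A = mat 1"
  unfolding matrix_inv_def invertible_def by (metis (mono_tags, lifting) someI_ex)+

text \<open>
  Cramer's rule; it shows that the inverse metric is as regular as the metric.
\<close>

lemma matrix_inv_entry:
  fixes A :: "real^'n^'n"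
  assumes "det A \<noteq> 0"
  shows "matrix_inv A $ a $ b = det (\<chi> i j. if j = a then axis b 1 $ i else A $ i $ j) / det A"
proof -
  have "A *v (matrix_inv A *v axis b 1) = axis b 1"
    using assms by (simp add: matrix_vector_mul_assoc matrix_inv_right_inverse invertible_det_nz)
  then have "matrix_inv A *v axis b 1 = (\<chi> k. det (\<chi> i j. if j = k then axis b 1 $ i else A $ i $ j) / det A)"
    using cramer[OF assms] by blast
  moreover have "(matrix_inv A *v axis b 1) $ a = matrix_inv A $ a $ b"
    by (simp add: matrix_vector_mult_basis column_def)
  ultimately show ?thesis by simp
qed

lemma matrix_inv_symmetric:
  fixes A :: "real^'n^'n"
  assumes "transpose A = A" "invertible A"
  shows "transpose (matrix_inv A) = matrix_inv A"
proof -
  have "transpose (matrix_inv A) ** A = mat 1"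
    using arg_cong[OF matrix_inv_right_inverse[OF assms(2)], of transpose]
    by (simp add: matrix_transpose_mul assms(1) transpose_mat)
  then have "transpose (matrix_inv A) ** A ** matrix_inv A = matrix_inv A" by simp
  then show ?thesis by (simp add: matrix_mul_assoc[symmetric] matrix_inv_right_inverse assms(2))
qed

text \<open>
  The inverse of a covariant 2-tensor transforms contravariantly.
\<close>

lemma matrix_inv_congruence:
  fixes A B J :: "real^'n^'n"
  assumes eq: "A = transpose J ** B ** J" and A: "invertible A"
  shows "J ** matrix_inv A ** transpose J = matrix_inv B"
proof -
  let ?X = "J ** matrix_inv A ** transpose J"
  have id: "transpose J ** (B ** (J ** matrix_inv A)) = mat 1"
    using matrix_inv_right_inverse[OF A] unfolding eq by (simp add: matrix_mul_assoc)
  then have "B ** (J ** matrix_inv A) ** transpose J = mat 1"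
    using matrix_left_right_inverse by blast
  then have BX: "B ** ?X = mat 1" by (simp add: matrix_mul_assoc)
  then have "invertible B" by (auto simp: invertible_right_inverse)
  have "?X = matrix_inv B ** B ** ?X" by (simp add: matrix_inv_left_inverse \<open>invertible B\<close>)
  also have "\<dots> = matrix_inv B" using BX by (simp add: matrix_mul_assoc[symmetric])
  finally show ?thesis .
qed

lemma C1_on_det:
  fixes A :: "'a::real_normed_vector \<Rightarrow> real^'n^'n"
  assumes "\<And>i j. C1_on S (\<lambda>x. A x $ i $ j)"
  shows "C1_on S (\<lambda>x. det (A x))"
  unfolding det_def by (intro C1_on_sum C1_on_mult C1_on_const C1_on_prod assms)

lemma C1_on_entry:
  fixes A :: "'a::real_normed_vector \<Rightarrow> real^'n^'n"
  assumes "C1_on S A" shows "C1_on S (\<lambda>x. A x $ i $ j)"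
  using assms by (intro C1_on_bounded_linear[OF bounded_linear_vec_nth])

lemma C1_on_matrix_inv_entry:
  fixes A :: "'a::real_normed_vector \<Rightarrow> real^'n^'n"
  assumes "open S" "C1_on S A" "\<And>x. x \<in> S \<Longrightarrow> det (A x) \<noteq> 0"
  shows "C1_on S (\<lambda>x. matrix_inv (A x) $ a $ b)"
proof (rule C1_on_cong[OF assms(1)])
  show "matrix_inv (A x) $ a $ b = det (\<chi> i j. if j = a then axis b 1 $ i else A x $ i $ j) * inverse (det (A x))" if "x \<in> S" for x
    using matrix_inv_entry[OF assms(3)[OF that]] by (simp add: divide_inverse)
  have "C1_on S (\<lambda>x. (\<chi> i j. if j = a then axis b 1 $ i else A x $ i $ j) $ k $ l)" for k l
    using C1_on_entry[OF assms(2), of k l] by (cases "l = a") auto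
  then have "C1_on S (\<lambda>x. det (\<chi> i j. if j = a then axis b 1 $ i else A x $ i $ j))"
    by (rule C1_on_det)
  moreover have "C1_on S (\<lambda>x. inverse (det (A x)))"
    by (rule C1_on_inverse[OF C1_on_det[OF C1_on_entry[OF assms(2)]] assms(3)])
  ultimately show "C1_on S (\<lambda>x. det (\<chi> i j. if j = a then axis b 1 $ i else A x $ i $ j) * inverse (det (A x)))"
    by (rule C1_on_mult)
qed

lemma partial_deriv_add_scale:
  assumes "f differentiable at x" "h differentiable at x"
  shows "partial_deriv a (\<lambda>x. f x + c * h x) x = partial_deriv a f x + c * partial_deriv a h x"
proof -
  have "((\<lambda>x. f x + c * h x) has_derivative
      (\<lambda>v. frechet_derivative f (at x) v + c * frechet_derivative h (at x) v)) (at x)"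
    using assms by (auto intro!: derivative_eq_intros simp: frechet_derivative_works[symmetric])
  from frechet_derivative_at[OF this] show ?thesis
    by (simp add: partial_deriv_def fun_eq_iff)
qed

lemma partial_deriv_mult_cnj:
  assumes "f differentiable at x" "h differentiable at x"
  shows "partial_deriv a (\<lambda>x. f x * cnj (h x)) x = f x * cnj (partial_deriv a h x) + partial_deriv a f x * cnj (h x)"
proof -
  have "((\<lambda>x. f x * cnj (h x)) has_derivative
      (\<lambda>v. f x * cnj (frechet_derivative h (at x) v) + frechet_derivative f (at x) v * cnj (h x))) (at x)"
    using assms by (auto intro!: derivative_eq_intros simp: frechet_derivative_works[symmetric])
  from frechet_derivative_at[OF this] show ?thesis
    by (simp add: partial_deriv_def fun_eq_iff)
qed

lemma partial_deriv_cong: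
  assumes "open S" "x \<in> S" "\<And>x. x \<in> S \<Longrightarrow> f x = h x"
  shows "partial_deriv a f x = partial_deriv a h x"
  by (simp add: partial_deriv_def frechet_derivative_cong[OF assms])

lemma partial_deriv_chain:
  fixes \<tau> :: "real^'n \<Rightarrow> real^'n"
  assumes \<tau>: "\<tau> differentiable at x" and f: "f differentiable at (\<tau> x)"
  shows "partial_deriv b (\<lambda>z. f (\<tau> z)) x =
     (\<Sum>c\<in>UNIV. of_real (matrix (frechet_derivative \<tau> (at x)) $ c $ b) * partial_deriv c f (\<tau> x))"
proof -
  let ?D = "frechet_derivative \<tau> (at x)" and ?F = "frechet_derivative f (at (\<tau> x))"
  have D: "(\<tau> has_derivative ?D) (at x)" and F: "(f has_derivative ?F) (at (\<tau> x))"
    using \<tau> f by (auto simp: frechet_derivative_works[symmetric])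
  have "partial_deriv b (\<lambda>z. f (\<tau> z)) x = ?F (?D (axis b 1))"
    using frechet_derivative_at[OF has_derivative_compose[OF D F]] by (simp add: partial_deriv_def fun_eq_iff)
  also have "?D (axis b 1) = (\<Sum>c\<in>UNIV. (matrix ?D $ c $ b) *\<^sub>R axis c 1)"
    by (simp add: matrix_def vec_eq_iff sum_component axis_def if_distrib[where f = "\<lambda>x. _ * x"] cong: if_cong)
  also have "?F \<dots> = (\<Sum>c\<in>UNIV. of_real (matrix ?D $ c $ b) * partial_deriv c f (\<tau> x))"
    by (simp add: linear_sum[OF has_derivative_linear[OF F]] linear_scale[OF has_derivative_linear[OF F]] partial_deriv_def)
      (simp add: scaleR_conv_of_real)
  finally show ?thesis .
qed

section \<open>Gradients and bump functions on the manifold\<close>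

context closed_riemannian_manifold
begin

abbreviation chart_image :: "'i \<Rightarrow> (real^'n) set" where
  "chart_image i \<equiv> \<kappa> i ` U i"

abbreviation inv_chart :: "'i \<Rightarrow> real^'n \<Rightarrow> 'm" where
  "inv_chart i \<equiv> chart_inv U \<kappa> i"

lemma chart_simps [simp]:
  "p \<in> U i \<Longrightarrow> inv_chart i (\<kappa> i p) = p"
  "x \<in> chart_image i \<Longrightarrow> inv_chart i x \<in> U i"
  "x \<in> chart_image i \<Longrightarrow> \<kappa> i (inv_chart i x) = x"
  using chart[of i] by (auto simp: homeomorphism_def)

lemma continuous_chart: "continuous_on (U i) (\<kappa> i)"
  and continuous_inv_chart: "continuous_on (chart_image i) (inv_chart i)"
  using chart[of i] by (auto simp: homeomorphism_def)

lemma open_chart_image: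
  assumes "open V" shows "open (\<kappa> i ` (U i \<inter> V))"
proof -
  have "openin (top_of_set (U i)) (U i \<inter> V)" using assms by (rule openin_open_Int)
  from homeomorphism_imp_open_map[OF chart this] show ?thesis
    using open_image openin_open_trans by blast
qed

lemma det_metric_pos: "x \<in> chart_image i \<Longrightarrow> 0 < det (g i x)"
  by (intro positive_definite_det_pos metric_pos)

lemma metric_invertible: "x \<in> chart_image i \<Longrightarrow> invertible (g i x)"
  using det_metric_pos[of x i] by (simp add: invertible_det_nz)

abbreviation dens :: "'i \<Rightarrow> real^'n \<Rightarrow> real" where
  "dens i x \<equiv> sqrt (det (g i x))"

abbreviation metric_inv :: "'i \<Rightarrow> real^'n \<Rightarrow> 'n \<Rightarrow> 'n \<Rightarrow> real" where
  "metric_inv i x a b \<equiv> matrix_inv (g i x) $ a $ b"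

lemma C1_metric: "C1_on (chart_image i) (g i)"
  by (intro smooth_on_C1 metric_smooth)

lemma C1_dens: "C1_on (chart_image i) (dens i)"
  by (intro C1_on_sqrt C1_on_det C1_on_entry C1_metric det_metric_pos)

lemma C1_metric_inv: "C1_on (chart_image i) (\<lambda>x. metric_inv i x a b)"
  using det_metric_pos[of _ i] by (intro C1_on_matrix_inv_entry open_image C1_metric) force

lemma metric_inv_sym: "x \<in> chart_image i \<Longrightarrow> metric_inv i x a b = metric_inv i x b a"
proof -
  assume x: "x \<in> chart_image i"
  have "transpose (matrix_inv (g i x)) $ a $ b = metric_inv i x a b"
    by (simp only: matrix_inv_symmetric[OF metric_sym[OF x] metric_invertible[OF x]])
  then show ?thesis by (simp add: transpose_def)
qed

text \<open>
  Continuously differentiable functions on the manifold, tested in the charts of the given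
  atlas.
\<close>

definition C1_fun :: "('m \<Rightarrow> 'b::real_normed_vector) \<Rightarrow> bool" where
  "C1_fun f \<longleftrightarrow> (\<forall>i. C1_on (chart_image i) (f \<circ> inv_chart i))"

lemma smooth_fun_C1: "smooth_fun U \<kappa> u \<Longrightarrow> C1_fun u"
  by (simp add: smooth_fun_def C1_fun_def smooth_on_C1)

lemma continuous_on_atlas:
  assumes "\<And>i. continuous_on (U i) f" shows "continuous_on UNIV f"
  using continuous_on_open_UN[of UNIV U f] assms open_dom cover by simp

lemma C1_fun_continuous:
  assumes "C1_fun f" shows "continuous_on UNIV f"
proof (rule continuous_on_atlas)
  fix i
  have "continuous_on (U i) (\<lambda>p. (f \<circ> inv_chart i) (\<kappa> i p))"
  proof (rule continuous_on_compose2[OF C1_on_continuous continuous_chart])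
    show "C1_on (chart_image i) (f \<circ> inv_chart i)" using assms by (simp add: C1_fun_def)
  qed simp
  then show "continuous_on (U i) f" by (simp cong: continuous_on_cong)
qed

text \<open>
  The Hermitian product of two gradients,
  \<open>g\<^sup>a\<^sup>b \<partial>\<^sub>b u cnj (\<partial>\<^sub>a v)\<close>, first in a chart and then on the manifold.  The latter picks some
  chart around \<open>p\<close>; \<open>grad_product_chart\<close> shows that the choice does not matter.
\<close>

definition grad_chart :: "'i \<Rightarrow> ('m \<Rightarrow> complex) \<Rightarrow> ('m \<Rightarrow> complex) \<Rightarrow> 'm \<Rightarrow> complex" where
  "grad_chart i u v p = (\<Sum>a\<in>UNIV. \<Sum>b\<in>UNIV. of_real (metric_inv i (\<kappa> i p) a b) *
      partial_deriv b (u \<circ> inv_chart i) (\<kappa> i p) * cnj (partial_deriv a (v \<circ> inv_chart i) (\<kappa> i p)))"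

definition grad_product :: "('m \<Rightarrow> complex) \<Rightarrow> ('m \<Rightarrow> complex) \<Rightarrow> 'm \<Rightarrow> complex" where
  "grad_product u v p = grad_chart (SOME i. p \<in> U i) u v p"

lemma partial_deriv_transition:
  assumes u: "C1_fun u" and p: "p \<in> U i" "p \<in> U j"
  shows "partial_deriv b (u \<circ> inv_chart i) (\<kappa> i p) =
    (\<Sum>c\<in>UNIV. of_real (matrix (frechet_derivative (\<kappa> j \<circ> inv_chart i) (at (\<kappa> i p))) $ c $ b) *
       partial_deriv c (u \<circ> inv_chart j) (\<kappa> j p))"
proof -
  let ?V = "\<kappa> i ` (U i \<inter> U j)" and ?\<tau> = "\<kappa> j \<circ> inv_chart i"
  have V: "open ?V" "\<kappa> i p \<in> ?V" using open_chart_image[OF open_dom] p by auto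
  have \<tau>: "?\<tau> differentiable at (\<kappa> i p)"
    using smooth_on_C1[OF transition_smooth[of i j]] V(2) unfolding C1_on_def by blast
  have \<tau>p: "?\<tau> (\<kappa> i p) = \<kappa> j p" using p by simp
  have "u \<circ> inv_chart j differentiable at (?\<tau> (\<kappa> i p))"
    unfolding \<tau>p using u p by (auto simp: C1_fun_def C1_on_def)
  note chain = partial_deriv_chain[OF \<tau> this, of b, unfolded \<tau>p]
  have "partial_deriv b (u \<circ> inv_chart i) (\<kappa> i p) = partial_deriv b (\<lambda>z. (u \<circ> inv_chart j) (?\<tau> z)) (\<kappa> i p)"
    by (rule partial_deriv_cong[OF V]) auto
  then show ?thesis unfolding chain .
qed

lemma grad_chart_transition:
  assumes u: "C1_fun u" and v: "C1_fun v" and p: "p \<in> U i" "p \<in> U j"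
  shows "grad_chart i u v p = grad_chart j u v p"
proof -
  let ?J = "matrix (frechet_derivative (\<kappa> j \<circ> inv_chart i) (at (\<kappa> i p)))"
  let ?H = "\<lambda>a b. of_real (metric_inv i (\<kappa> i p) a b) :: complex"
  let ?du = "\<lambda>c. partial_deriv c (u \<circ> inv_chart j) (\<kappa> j p)" and ?dv = "\<lambda>c. partial_deriv c (v \<circ> inv_chart j) (\<kappa> j p)"
  let ?j = "\<lambda>c b. of_real (?J $ c $ b) :: complex"
  have "?J ** matrix_inv (g i (\<kappa> i p)) ** transpose ?J = matrix_inv (g j (\<kappa> j p))"
    using p by (intro matrix_inv_congruence metric_transform metric_invertible) auto
  then have "metric_inv j (\<kappa> j p) d c = (?J ** matrix_inv (g i (\<kappa> i p)) ** transpose ?J) $ d $ c" for c d by simp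
  then have H: "of_real (metric_inv j (\<kappa> j p) d c) = (\<Sum>b\<in>UNIV. \<Sum>a\<in>UNIV. ?j d a * ?H a b * ?j c b)" for c d
    by (simp add: matrix_matrix_mult_def transpose_def sum_distrib_right)
  let ?X = "\<lambda>a b c d. ?j d a * ?H a b * ?j c b * (?du c * cnj (?dv d))"
  have "grad_chart i u v p = (\<Sum>a\<in>UNIV. \<Sum>b\<in>UNIV. ?H a b * (\<Sum>c\<in>UNIV. ?j c b * ?du c) * cnj (\<Sum>d\<in>UNIV. ?j d a * ?dv d))"
    unfolding grad_chart_def partial_deriv_transition[OF u p] partial_deriv_transition[OF v p] ..
  also have "\<dots> = (\<Sum>a\<in>UNIV. \<Sum>b\<in>UNIV. \<Sum>c\<in>UNIV. \<Sum>d\<in>UNIV. ?X a b c d)"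
    by (simp add: sum_distrib_left sum_distrib_right mult_ac)
  also have "\<dots> = (\<Sum>a\<in>UNIV. \<Sum>c\<in>UNIV. \<Sum>b\<in>UNIV. \<Sum>d\<in>UNIV. ?X a b c d)"
    by (intro sum.cong refl sum.swap)
  also have "\<dots> = (\<Sum>c\<in>UNIV. \<Sum>a\<in>UNIV. \<Sum>b\<in>UNIV. \<Sum>d\<in>UNIV. ?X a b c d)"
    by (rule sum.swap)
  also have "\<dots> = (\<Sum>c\<in>UNIV. \<Sum>b\<in>UNIV. \<Sum>a\<in>UNIV. \<Sum>d\<in>UNIV. ?X a b c d)"
    by (intro sum.cong refl sum.swap)
  also have "\<dots> = (\<Sum>c\<in>UNIV. \<Sum>b\<in>UNIV. \<Sum>d\<in>UNIV. \<Sum>a\<in>UNIV. ?X a b c d)"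
    by (intro sum.cong refl sum.swap)
  also have "\<dots> = (\<Sum>c\<in>UNIV. \<Sum>d\<in>UNIV. \<Sum>b\<in>UNIV. \<Sum>a\<in>UNIV. ?X a b c d)"
    by (intro sum.cong refl sum.swap)
  also have "\<dots> = (\<Sum>d\<in>UNIV. \<Sum>c\<in>UNIV. \<Sum>b\<in>UNIV. \<Sum>a\<in>UNIV. ?X a b c d)"
    by (rule sum.swap)
  also have "\<dots> = (\<Sum>d\<in>UNIV. \<Sum>c\<in>UNIV. of_real (metric_inv j (\<kappa> j p) d c) * ?du c * cnj (?dv d))"
    unfolding H by (simp add: sum_distrib_right mult.assoc)
  also have "\<dots> = grad_chart j u v p" by (simp add: grad_chart_def)
  finally show ?thesis .
qed

lemma grad_product_chart:
  assumes "C1_fun u" "C1_fun v" "p \<in> U i" shows "grad_product u v p = grad_chart i u v p"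
  unfolding grad_product_def using assms by (intro grad_chart_transition someI[of "\<lambda>i. p \<in> U i"])

lemma in_some_chart: obtains i where "p \<in> U i"
  using cover by blast

lemma grad_product_cnj:
  assumes "C1_fun u" "C1_fun v" shows "grad_product v u p = cnj (grad_product u v p)"
proof -
  obtain i where p: "p \<in> U i" by (rule in_some_chart)
  have "grad_chart i v u p = cnj (grad_chart i u v p)"
    unfolding grad_chart_def cnj_sum complex_cnj_mult complex_cnj_complex_of_real complex_cnj_cnj
    by (subst sum.swap) (use p in \<open>simp add: metric_inv_sym[of "\<kappa> i p" i] mult_ac\<close>)
  then show ?thesis using assms p by (simp add: grad_product_chart)
qed

lemma continuous_grad_product:
  assumes u: "C1_fun u" and v: "C1_fun v" shows "continuous_on UNIV (grad_product u v)"
proof (rule continuous_on_atlas)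
  fix i
  have d: "continuous_on (chart_image i) (\<lambda>x. partial_deriv a (w \<circ> inv_chart i) x)" if "C1_fun w" for w a
    using that C1_on_continuous_derivative unfolding C1_fun_def partial_deriv_def by blast
  have comp: "continuous_on (U i) (\<lambda>p. h (\<kappa> i p))" if "continuous_on (chart_image i) h" for h :: "real^'n \<Rightarrow> complex"
    by (rule continuous_on_compose2[OF that continuous_chart]) auto
  have "continuous_on (chart_image i) (\<lambda>x. of_real (metric_inv i x a b) :: complex)" for a b
    by (intro continuous_intros C1_on_continuous C1_metric_inv)
  note H = comp[OF this]
  have "continuous_on (U i) (grad_chart i u v)"
    unfolding grad_chart_def[abs_def]
    by (intro continuous_on_sum continuous_on_mult continuous_on_cnj H comp[OF d] u v)
  then show "continuous_on (U i) (grad_product u v)"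
    using grad_product_chart[OF u v] by (simp cong: continuous_on_cong)
qed

lemma C1_fun_sum: "(\<And>k. k \<in> I \<Longrightarrow> C1_fun (f k)) \<Longrightarrow> C1_fun (\<lambda>p. \<Sum>k\<in>I. f k p)"
  by (simp add: C1_fun_def o_def C1_on_sum)

lemma C1_fun_const: "C1_fun (\<lambda>p. c)"
  by (simp add: C1_fun_def o_def)

lemma C1_fun_scaleR: "C1_fun f \<Longrightarrow> C1_fun h \<Longrightarrow> C1_fun (\<lambda>p. f p *\<^sub>R h p)"
  by (simp add: C1_fun_def o_def C1_on_scaleR)

lemma C1_fun_inverse:
  fixes f :: "'m \<Rightarrow> real"
  shows "C1_fun f \<Longrightarrow> (\<And>p. f p \<noteq> 0) \<Longrightarrow> C1_fun (\<lambda>p. inverse (f p))"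
  by (simp add: C1_fun_def o_def C1_on_inverse)

lemma grad_product_sum:
  assumes u: "C1_fun u" and f: "\<And>k. k \<in> I \<Longrightarrow> C1_fun (f k)" and I: "finite I"
  shows "grad_product u (\<lambda>p. \<Sum>k\<in>I. f k p) p = (\<Sum>k\<in>I. grad_product u (f k) p)"
proof -
  obtain i where p: "p \<in> U i" by (rule in_some_chart)
  have d: "((\<lambda>x. \<Sum>k\<in>I. f k (inv_chart i x)) has_derivative
     (\<lambda>v. \<Sum>k\<in>I. frechet_derivative (f k \<circ> inv_chart i) (at (\<kappa> i p)) v)) (at (\<kappa> i p))"
  proof (rule has_derivative_sum)
    fix k assume "k \<in> I"
    then have "C1_on (chart_image i) (f k \<circ> inv_chart i)" using f by (simp add: C1_fun_def)
    from C1_on_has_derivative[OF this] p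
    show "((\<lambda>x. f k (inv_chart i x)) has_derivative frechet_derivative (f k \<circ> inv_chart i) (at (\<kappa> i p))) (at (\<kappa> i p))"
      by (simp add: o_def)
  qed
  have "partial_deriv a ((\<lambda>p. \<Sum>k\<in>I. f k p) \<circ> inv_chart i) (\<kappa> i p) = (\<Sum>k\<in>I. partial_deriv a (f k \<circ> inv_chart i) (\<kappa> i p))" for a
    using fun_cong[OF frechet_derivative_at[OF d]] by (simp add: partial_deriv_def o_def)
  then have "grad_chart i u (\<lambda>p. \<Sum>k\<in>I. f k p) p = (\<Sum>a\<in>UNIV. \<Sum>b\<in>UNIV. \<Sum>k\<in>I. of_real (metric_inv i (\<kappa> i p) a b) *
      partial_deriv b (u \<circ> inv_chart i) (\<kappa> i p) * cnj (partial_deriv a (f k \<circ> inv_chart i) (\<kappa> i p)))"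
    by (simp add: grad_chart_def sum_distrib_left)
  also have "\<dots> = (\<Sum>a\<in>UNIV. \<Sum>k\<in>I. \<Sum>b\<in>UNIV. of_real (metric_inv i (\<kappa> i p) a b) *
      partial_deriv b (u \<circ> inv_chart i) (\<kappa> i p) * cnj (partial_deriv a (f k \<circ> inv_chart i) (\<kappa> i p)))"
    by (intro sum.cong refl sum.swap)
  also have "\<dots> = (\<Sum>k\<in>I. grad_chart i u (f k) p)"
    unfolding grad_chart_def by (rule sum.swap)
  finally show ?thesis using u f p by (simp add: grad_product_chart C1_fun_sum)
qed

lemma grad_product_const: "C1_fun u \<Longrightarrow> grad_product u (\<lambda>p. c) p = 0"
proof -
  assume u: "C1_fun u"
  obtain i where p: "p \<in> U i" by (rule in_some_chart)
  then show ?thesis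
    by (simp add: grad_product_chart[OF u C1_fun_const p] grad_chart_def partial_deriv_def o_def)
qed

text \<open>
  The preimage of a closed coordinate ball.
\<close>

definition chart_ball :: "'i \<Rightarrow> real^'n \<Rightarrow> real \<Rightarrow> 'm set" where
  "chart_ball i c r = {p \<in> U i. \<kappa> i p \<in> cball c r}"

text \<open>
  For \<open>0 < r\<close>, a nonnegative function that is positive exactly on the open coordinate ball of
  radius \<open>r\<close> about \<open>c\<close>.  It is \<open>C\<^sup>1\<close> if the closed ball lies in the chart image; the partition
  needs no higher regularity.
\<close>

definition bump :: "'i \<Rightarrow> real^'n \<Rightarrow> real \<Rightarrow> 'm \<Rightarrow> real" where
  "bump i c r p = (if p \<in> U i then (max 0 (r\<^sup>2 - (\<kappa> i p - c) \<bullet> (\<kappa> i p - c)))\<^sup>2 else 0)"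

lemma compact_chart_ball:
  assumes "cball c r \<subseteq> chart_image i" shows "compact (chart_ball i c r)"
proof -
  have "compact (inv_chart i ` cball c r)"
    by (intro compact_continuous_image continuous_on_subset[OF continuous_inv_chart assms]) simp
  also have "inv_chart i ` cball c r = chart_ball i c r"
  proof
    show "inv_chart i ` cball c r \<subseteq> chart_ball i c r"
      using assms by (auto simp: chart_ball_def subset_iff simp del: mem_cball) 
    show "chart_ball i c r \<subseteq> inv_chart i ` cball c r"
    proof
      fix p assume "p \<in> chart_ball i c r"
      then have "p \<in> U i" "\<kappa> i p \<in> cball c r" by (auto simp only: chart_ball_def mem_Collect_eq)
      then show "p \<in> inv_chart i ` cball c r" by (intro image_eqI[of _ _ "\<kappa> i p"]) simp_all
    qed
  qed
  finally show ?thesis .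
qed

lemma bump_nonneg: "0 \<le> bump i c r p"
  by (simp add: bump_def)

lemma bump_pos:
  assumes "p \<in> U i" "0 < r" shows "0 < bump i (\<kappa> i p) r p"
  using assms by (simp add: bump_def max_def)

lemma bump_zero: assumes "p \<notin> chart_ball i c r" "0 < r" shows "bump i c r p = 0"
proof (cases "p \<in> U i")
  case True
  then have "r < norm (\<kappa> i p - c)" using assms by (simp add: chart_ball_def dist_norm norm_minus_commute)
  then have "r\<^sup>2 < (norm (\<kappa> i p - c))\<^sup>2" using assms by (intro power_strict_mono) auto
  then show ?thesis by (simp add: bump_def power2_norm_eq_inner)
qed (simp add: bump_def)

text \<open>
  In another chart the bump function is \<open>C\<^sup>1\<close> on the overlap because transition maps are smooth,
  and it vanishes off the compact, hence closed, coordinate ball.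
\<close>

lemma C1_fun_bump:
  assumes c: "cball c r \<subseteq> chart_image i" and r: "0 < r" shows "C1_fun (bump i c r)"
  unfolding C1_fun_def
proof
  fix j
  show "C1_on (chart_image j) (bump i c r \<circ> inv_chart j)"
  proof (rule C1_on_local)
    fix x assume x: "x \<in> chart_image j"
    show "\<exists>V h. open V \<and> x \<in> V \<and> C1_on V h \<and> (\<forall>z\<in>V. (bump i c r \<circ> inv_chart j) z = h z)"
    proof (cases "inv_chart j x \<in> U i")
      case True
      let ?V = "\<kappa> j ` (U j \<inter> U i)" and ?\<tau> = "\<kappa> i \<circ> inv_chart j"
      have "C1_on ?V ?\<tau>" by (intro smooth_on_C1 transition_smooth)
      then have "C1_on ?V (\<lambda>z. (max 0 (r\<^sup>2 - (?\<tau> z - c) \<bullet> (?\<tau> z - c)))\<^sup>2)"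
        by (intro C1_on_bump C1_on_diff C1_on_const C1_on_bilinear[OF bounded_bilinear_inner])
      moreover have "x \<in> ?V" using True x by (metis IntI chart_simps(2,3) imageI)
      ultimately show ?thesis
        using open_chart_image[OF open_dom]
        by (intro exI[of _ ?V] exI[of _ "\<lambda>z. (max 0 (r\<^sup>2 - (?\<tau> z - c) \<bullet> (?\<tau> z - c)))\<^sup>2"]) (auto simp: bump_def)
    next
      case False
      let ?V = "\<kappa> j ` (U j \<inter> - chart_ball i c r)"
      have "open ?V"
        using compact_chart_ball[OF c] by (intro open_chart_image open_Compl compact_imp_closed)
      moreover have "x \<in> ?V"
        using False x chart_simps(2,3)[OF x] unfolding chart_ball_def by (intro image_eqI[of _ _ "inv_chart j x"]) auto
      moreover have "\<forall>z\<in>?V. (bump i c r \<circ> inv_chart j) z = 0" using bump_zero r by auto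
      ultimately show ?thesis using C1_on_const by blast
    qed
  qed
qed

lemma finite_bump_cover:
  "\<exists>B. finite B \<and> (\<forall>i c r. (i, c, r) \<in> B \<longrightarrow> 0 < r \<and> cball c r \<subseteq> chart_image i) \<and>
     (\<forall>p. \<exists>(i, c, r)\<in>B. 0 < bump i c r p)"
proof -
  define A where "A = {(i, c, r). 0 < r \<and> cball c r \<subseteq> chart_image i}"
  define V where "V t = (case t of (i, c, r) \<Rightarrow> {p. 0 < bump i c r p})" for t
  have "open (V t)" if "t \<in> A" for t
  proof -
    obtain i c r where t: "t = (i, c, r)" by (cases t)
    have "continuous_on UNIV (bump i c r)"
      using that by (intro C1_fun_continuous C1_fun_bump) (auto simp: t A_def)
    then show ?thesis unfolding V_def t by (simp add: open_Collect_less)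
  qed
  moreover have "UNIV \<subseteq> (\<Union>t\<in>A. V t)"
  proof
    fix p :: 'm
    obtain i where p: "p \<in> U i" by (rule in_some_chart)
    obtain r where "0 < r" "cball (\<kappa> i p) r \<subseteq> chart_image i"
      using open_image[of i] p by (meson imageI open_contains_cball)
    then have "(i, \<kappa> i p, r) \<in> A" "p \<in> V (i, \<kappa> i p, r)"
      using p by (auto simp: A_def V_def bump_pos)
    then show "p \<in> (\<Union>t\<in>A. V t)" by blast
  qed
  ultimately obtain B where "B \<subseteq> A" "finite B" "UNIV \<subseteq> (\<Union>t\<in>B. V t)"
    using compactE_image[OF compact_manifold, of A V] by metis
  note B = this
  show ?thesis
  proof (intro exI[of _ B] conjI allI impI B(2))
    show "0 < r" "cball c r \<subseteq> chart_image i" if "(i, c, r) \<in> B" for i c r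
      using B(1) that by (auto simp: A_def)
    show "\<exists>(i, c, r)\<in>B. 0 < bump i c r p" for p
    proof -
      obtain t where "t \<in> B" "p \<in> V t" using B(3) by blast
      then show ?thesis by (intro bexI[of _ t]) (auto simp: V_def split: prod.splits)
    qed
  qed
qed

end

section \<open>Riemannian volume and symmetry of the Laplacian\<close>

text \<open>
  A closed Riemannian manifold with its volume on Borel sets.
\<close>

locale riemannian_measure = closed_riemannian_manifold U \<kappa> g
  for U :: "'i \<Rightarrow> 'm::{t2_space, second_countable_topology} set"
    and \<kappa> :: "'i \<Rightarrow> 'm \<Rightarrow> real^'n" and g +
  fixes vol :: "'m measure"
  assumes volume: "riemannian_volume U \<kappa> g vol"
begin

lemma sets_vol [measurable_cong, simp]: "sets vol = sets borel"
  using volume by (simp add: riemannian_volume_def)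

lemma space_vol [simp]: "space vol = UNIV"
  using sets_eq_imp_space_eq[OF sets_vol] by simp

lemma emeasure_vol_chart:
  "B \<in> sets borel \<Longrightarrow> B \<subseteq> U i \<Longrightarrow> emeasure vol B = (\<integral>\<^sup>+x\<in>\<kappa> i ` B. ennreal (dens i x) \<partial>lborel)"
  using volume by (simp add: riemannian_volume_def)

lemma borel_U [measurable, simp]: "U i \<in> sets borel" and borel_chart_image [measurable, simp]: "chart_image i \<in> sets borel"
  using open_dom open_image by simp_all

lemma measurable_dens: "(\<lambda>x. indicator (chart_image i) x *\<^sub>R dens i x) \<in> borel_measurable borel"
  by (rule borel_measurable_continuous_on_indicator[OF borel_chart_image C1_on_continuous[OF C1_dens]])

lemma integral_in_chart:
  fixes F :: "'m \<Rightarrow> complex"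
  assumes F: "F \<in> borel_measurable borel" and zero: "\<And>p. p \<notin> U i \<Longrightarrow> F p = 0"
  shows "(LINT p|vol. F p) = (LINT x|lborel. indicator (chart_image i) x *\<^sub>R dens i x *\<^sub>R F (inv_chart i x))"
proof -
  let ?S = "chart_image i"
  define h where "h x = (if x \<in> ?S then inv_chart i x else undefined)" for x
  define d where "d x = indicator ?S x *\<^sub>R dens i x" for x
  have d: "d \<in> borel_measurable borel" unfolding d_def[abs_def] by (rule measurable_dens)
  have d0: "0 \<le> d x" for x using det_metric_pos[of x i] by (auto simp: d_def indicator_def)
  have h: "h \<in> measurable borel borel"
    unfolding h_def[abs_def]
  proof (rule measurable_If_restrict_space_iff[THEN iffD2])
    show "inv_chart i \<in> measurable (restrict_space borel {x. x \<in> ?S}) borel \<and>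
      (\<lambda>x. undefined) \<in> measurable (restrict_space borel {x. x \<notin> ?S}) borel"
      using borel_measurable_continuous_on_restrict[OF continuous_inv_chart[of i]] by simp
  qed simp
  \<comment> \<open>the volume restricted to the chart domain is the image of the density \<open>sqrt (det g)\<close>\<close>
  have eq: "density vol (\<lambda>p. ennreal (indicator (U i) p)) = distr (density lborel (\<lambda>x. ennreal (d x))) borel h"
  proof (rule measure_eqI)
    fix B assume "B \<in> sets (density vol (\<lambda>p. ennreal (indicator (U i) p)))"
    then have B: "B \<in> sets borel" by simp
    have B': "B \<inter> U i \<in> sets borel" using B by simp
    have img: "\<kappa> i ` (B \<inter> U i) = {x \<in> ?S. h x \<in> B}"
    proof (intro equalityI subsetI)
      fix x assume "x \<in> {x \<in> ?S. h x \<in> B}"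
      then have "x = \<kappa> i (inv_chart i x)" "inv_chart i x \<in> B \<inter> U i" by (auto simp: h_def)
      then show "x \<in> \<kappa> i ` (B \<inter> U i)" by (rule image_eqI)
    next
      fix x assume "x \<in> \<kappa> i ` (B \<inter> U i)"
      then obtain p where p: "p \<in> B" "p \<in> U i" "x = \<kappa> i p" by blast
      then have "x \<in> ?S" "h x = p" by (simp_all add: h_def)
      then show "x \<in> {x \<in> ?S. h x \<in> B}" using p(1) by simp
    qed
    have "emeasure (density vol (\<lambda>p. ennreal (indicator (U i) p))) B = emeasure vol (B \<inter> U i)"
      using B by (subst emeasure_density) (auto simp: ennreal_indicator indicator_inter_arith[symmetric] Int_commute nn_integral_indicator simp flip: indicator_inter_arith)
    also have "\<dots> = (\<integral>\<^sup>+x\<in>\<kappa> i ` (B \<inter> U i). ennreal (dens i x) \<partial>lborel)"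
      by (rule emeasure_vol_chart[OF B']) simp
    also have "\<dots> = (\<integral>\<^sup>+x. ennreal (d x) * indicator (h -` B) x \<partial>lborel)"
      unfolding img by (intro nn_integral_cong) (auto simp: d_def indicator_def)
    also have "\<dots> = emeasure (distr (density lborel (\<lambda>x. ennreal (d x))) borel h) B"
      using B h d by (simp add: emeasure_distr emeasure_density measurable_sets_borel)
    finally show "emeasure (density vol (\<lambda>p. ennreal (indicator (U i) p))) B = \<dots>" .
  qed simp
  have "(LINT p|vol. F p) = (LINT p|vol. indicator (U i) p *\<^sub>R F p)"
    using zero by (intro Bochner_Integration.integral_cong) (auto simp: indicator_def)
  also have "\<dots> = (LINT p|density vol (\<lambda>p. ennreal (indicator (U i) p)). F p)"
    by (rule integral_density[symmetric]) (use F in auto)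
  also have "\<dots> = (LINT x|density lborel (\<lambda>x. ennreal (d x)). F (h x))"
    unfolding eq by (rule integral_distr) (use h F in auto)
  also have "\<dots> = (LINT x|lborel. d x *\<^sub>R F (h x))"
    by (rule integral_density) (use measurable_compose[OF h F] d d0 in auto)
  also have "\<dots> = (LINT x|lborel. indicator ?S x *\<^sub>R dens i x *\<^sub>R F (inv_chart i x))"
    by (intro Bochner_Integration.integral_cong) (auto simp: d_def h_def indicator_def)
  finally show ?thesis .
qed

lemma emeasure_chart_ball_finite:
  assumes c: "cball c r \<subseteq> chart_image i" shows "emeasure vol (chart_ball i c r) < \<infinity>"
proof -
  have "\<kappa> i ` chart_ball i c r = cball c r"
    using c unfolding chart_ball_def by blast
  moreover have "chart_ball i c r \<in> sets borel"
    using compact_chart_ball[OF c] by (simp add: compact_imp_closed)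
  moreover have "chart_ball i c r \<subseteq> U i" by (auto simp: chart_ball_def)
  ultimately have "emeasure vol (chart_ball i c r) = (\<integral>\<^sup>+x\<in>cball c r. ennreal (dens i x) \<partial>lborel)"
    using emeasure_vol_chart by metis
  also have "\<dots> = (\<integral>\<^sup>+x. ennreal (indicator (cball c r) x *\<^sub>R dens i x) \<partial>lborel)"
    by (intro nn_integral_cong) (auto simp: indicator_def)
  also have "\<dots> < \<infinity>"
  proof -
    have "integrable lborel (\<lambda>x. indicator (cball c r) x *\<^sub>R dens i x)"
      by (intro borel_integrable_compact continuous_on_subset[OF C1_on_continuous[OF C1_dens] c]) simp
    moreover have "0 \<le> indicator (cball c r) x *\<^sub>R dens i x" for x
      using det_metric_pos[of x i] c by (cases "x \<in> cball c r") (auto simp: less_imp_le)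
    ultimately show ?thesis by (simp add: nn_integral_eq_integral)
  qed
  finally show ?thesis .
qed

lemma finite_vol: "finite_measure vol"
proof
  obtain B :: "('i \<times> (real^'n) \<times> real) set" where B: "finite B"
    "\<forall>i c r. (i, c, r) \<in> B \<longrightarrow> 0 < r \<and> cball c r \<subseteq> chart_image i"
    "\<forall>p. \<exists>(i, c, r)\<in>B. 0 < bump i c r p"
    using finite_bump_cover by blast
  let ?W = "\<lambda>t. case t of (i, c, r) \<Rightarrow> chart_ball i c r"
  have W: "?W t \<in> sets vol \<and> emeasure vol (?W t) < \<infinity>" if t: "t \<in> B" for t
  proof -
    obtain i c r where t_eq: "t = (i, c, r)" by (cases t)
    have c: "cball c r \<subseteq> chart_image i" using B(2) t t_eq by blast
    show ?thesis using compact_chart_ball[OF c] emeasure_chart_ball_finite[OF c]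
      by (simp add: t_eq compact_imp_closed)
  qed
  have "UNIV \<subseteq> (\<Union>t\<in>B. ?W t)"
  proof
    fix p :: 'm
    obtain i c r where t: "(i, c, r) \<in> B" "0 < bump i c r p" using B(3) by blast
    then have "p \<in> chart_ball i c r" using bump_zero[of p i c r] B(2) t by force
    then show "p \<in> (\<Union>t\<in>B. ?W t)" using t(1) by force
  qed
  then have eq: "UNIV = (\<Union>t\<in>B. ?W t)" by blast
  have "emeasure vol (\<Union>t\<in>B. ?W t) \<le> (\<Sum>t\<in>B. emeasure vol (?W t))"
    by (rule emeasure_subadditive_finite[OF B(1)]) (use W in auto)
  also have "\<dots> < \<infinity>" using W by (simp add: B(1))
  finally show "emeasure vol (space vol) \<noteq> \<infinity>" unfolding space_vol eq by simp
qed

sublocale finite_measure vol by (rule finite_vol)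

lemma emeasure_open_pos:
  assumes "open V" "V \<noteq> {}" shows "emeasure vol V \<noteq> 0"
proof
  assume z: "emeasure vol V = 0"
  obtain p i where p: "p \<in> V" "p \<in> U i" using assms(2) cover by blast
  let ?O = "\<kappa> i ` (U i \<inter> V)"
  have O: "open ?O" "?O \<subseteq> chart_image i" "\<kappa> i p \<in> ?O" using open_chart_image[OF assms(1)] p by auto
  have "emeasure vol (U i \<inter> V) = 0"
    using z emeasure_mono[of "U i \<inter> V" V vol] assms(1) by simp
  then have "(\<integral>\<^sup>+x\<in>?O. ennreal (dens i x) \<partial>lborel) = 0"
    using emeasure_vol_chart[of "U i \<inter> V" i] assms(1) open_dom by (simp add: open_Int)
  moreover have "(\<lambda>x. ennreal (dens i x) * indicator ?O x) \<in> borel_measurable lborel"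
  proof -
    have "(\<lambda>x. ennreal (indicator ?O x *\<^sub>R dens i x)) \<in> borel_measurable borel"
      using O borel_measurable_continuous_on_indicator[OF _ continuous_on_subset[OF C1_on_continuous[OF C1_dens] O(2)]]
      by (intro measurable_compose[OF _ measurable_ennreal]) auto
    also have "(\<lambda>x. ennreal (indicator ?O x *\<^sub>R dens i x)) = (\<lambda>x. ennreal (dens i x) * indicator ?O x)"
      by (auto simp: indicator_def)
    finally show ?thesis by simp
  qed
  ultimately have "emeasure lborel {x \<in> space lborel. ennreal (dens i x) * indicator ?O x \<noteq> 0} = 0"
    by (simp add: nn_integral_0_iff)
  also have "{x \<in> space lborel. ennreal (dens i x) * indicator ?O x \<noteq> 0} = ?O"
    using det_metric_pos[of _ i] O(2) by (force simp: indicator_def)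
  finally have "emeasure lborel ?O = 0" .
  moreover obtain r where r: "0 < r" "ball (\<kappa> i p) r \<subseteq> ?O" using O openE by blast
  then have "emeasure lborel (ball (\<kappa> i p) r) \<le> emeasure lborel ?O"
    using O(1) by (intro emeasure_mono) auto
  ultimately have "emeasure lborel (ball (\<kappa> i p) r) = 0" by simp
  then show False using content_ball_pos[OF r(1), of "\<kappa> i p"] by (simp add: measure_def)
qed

lemma AE_zero_imp_zero:
  fixes h :: "'m \<Rightarrow> complex"
  assumes "continuous_on UNIV h" "AE p in vol. h p = 0" shows "h p = 0"
proof (rule ccontr)
  assume "h p \<noteq> 0"
  have "open {p. h p \<noteq> 0}" using assms(1) by (intro open_Collect_neq continuous_on_const)
  moreover from this have "emeasure vol {p. h p \<noteq> 0} = 0"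
    using assms(2) by (subst (asm) AE_iff_measurable[OF _ refl]) auto
  ultimately show False using emeasure_open_pos \<open>h p \<noteq> 0\<close> by blast
qed

lemma continuous_measurable: "continuous_on UNIV h \<Longrightarrow> h \<in> borel_measurable vol" for h :: "'m \<Rightarrow> complex"
  using borel_measurable_continuous_onI[of h] by (simp cong: measurable_cong_sets)

lemma integrable_continuous:
  fixes h :: "'m \<Rightarrow> complex"
  assumes "continuous_on UNIV h" shows "integrable vol h"
proof -
  have "bounded (range h)" using compact_continuous_image[OF assms compact_manifold] by (rule compact_imp_bounded)
  then obtain B where "\<And>p. cmod (h p) \<le> B" by (auto simp: bounded_iff)
  then show ?thesis
    using continuous_measurable[OF assms] by (intro integrable_const_bound[where B = B]) auto
qed

lemma grad_product_zero:
  assumes u: "C1_fun u" and v: "C1_fun v" and V: "open V" "p \<in> V" "\<And>q. q \<in> V \<Longrightarrow> v q = 0"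
  shows "grad_product u v p = 0"
proof -
  obtain i where p: "p \<in> U i" by (rule in_some_chart)
  have "partial_deriv a (v \<circ> inv_chart i) (\<kappa> i p) = partial_deriv a (\<lambda>x. 0) (\<kappa> i p)" for a
    by (rule partial_deriv_cong[OF open_chart_image[OF V(1)]]) (use V p in auto)
  then show ?thesis
    by (simp add: grad_product_chart[OF u v p] grad_chart_def partial_deriv_def)
qed

text \<open>
  For \<open>\<psi>\<close> supported in a coordinate ball, the integrand times the volume density is the
  coordinate divergence of \<open>sqrt (det g) g\<^sup>a\<^sup>b \<partial>\<^sub>b u cnj \<psi>\<close>, which has compact support.
\<close>

lemma weak_laplacian_chart:
  assumes u: "has_laplace_beltrami U \<kappa> g u f" and f: "continuous_on UNIV f" and \<psi>: "C1_fun \<psi>"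
    and c: "cball c r \<subseteq> chart_image i" and zero: "\<And>p. p \<notin> chart_ball i c r \<Longrightarrow> \<psi> p = 0"
  shows "(LINT p|vol. f p * cnj (\<psi> p) + grad_product u \<psi> p) = 0"
proof -
  let ?S = "chart_image i"
  define w where "w = u \<circ> inv_chart i"
  define v where "v = \<psi> \<circ> inv_chart i"
  define flux where "flux a x = (\<Sum>b\<in>UNIV. (dens i x * metric_inv i x a b) *\<^sub>R partial_deriv b w x)" for a x
  define F where "F a x = flux a x * cnj (v x)" for a x
  have uC: "C1_fun u" using u by (auto simp: has_laplace_beltrami_def intro: smooth_fun_C1)
  have w: "smooth_on ?S w" using u by (simp add: has_laplace_beltrami_def smooth_fun_def w_def)
  have v: "C1_on ?S v" using \<psi> by (simp add: C1_fun_def v_def)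
  have flux: "C1_on ?S (flux a)" for a
    unfolding flux_def[abs_def] partial_deriv_def
    by (intro C1_on_sum C1_on_scaleR C1_on_mult C1_dens C1_metric_inv smooth_on_derivative_C1 w)
  have F: "C1_on ?S (F a)" for a
    unfolding F_def[abs_def] by (intro C1_on_mult flux C1_on_bounded_linear[OF bounded_linear_cnj] v)
  have F0: "F a x = 0" if "x \<in> ?S - cball c r" for a x
    using zero[of "inv_chart i x"] that by (simp add: F_def v_def chart_ball_def)
  note div = integral_directional_derivative[OF open_image F compact_cball c F0]
  have div_eq: "(\<Sum>a\<in>UNIV. indicator ?S x *\<^sub>R frechet_derivative (F a) (at x) (axis a 1)) =
      indicator ?S x *\<^sub>R dens i x *\<^sub>R (f (inv_chart i x) * cnj (\<psi> (inv_chart i x)) + grad_product u \<psi> (inv_chart i x))" for x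
  proof (cases "x \<in> ?S")
    case True
    have d: "partial_deriv a (F a) x = flux a x * cnj (partial_deriv a v x) + partial_deriv a (flux a) x * cnj (v x)" for a
      unfolding F_def[abs_def] using flux[of a] v True by (intro partial_deriv_mult_cnj) (auto simp: C1_on_def)
    have lap: "(\<Sum>a\<in>UNIV. partial_deriv a (flux a) x) = dens i x *\<^sub>R f (inv_chart i x)"
    proof -
      have "f (inv_chart i x) = laplace_coord (g i) w x"
        using u True by (auto simp: has_laplace_beltrami_def w_def)
      also have "\<dots> = (1 / dens i x) *\<^sub>R (\<Sum>a\<in>UNIV. partial_deriv a (flux a) x)"
        by (simp add: laplace_coord_def flux_def[abs_def])
      finally show ?thesis using det_metric_pos[OF True] by simp
    qed
    have grad: "(\<Sum>a\<in>UNIV. flux a x * cnj (partial_deriv a v x)) = dens i x *\<^sub>R grad_product u \<psi> (inv_chart i x)"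
      using True by (simp add: grad_product_chart[OF uC \<psi>, of _ i] grad_chart_def flux_def v_def w_def
          scaleR_sum_right sum_distrib_right sum_distrib_left scaleR_conv_of_real mult.assoc)
    have "(\<Sum>a\<in>UNIV. partial_deriv a (F a) x) = dens i x *\<^sub>R (f (inv_chart i x) * cnj (v x) + grad_product u \<psi> (inv_chart i x))"
      unfolding d sum.distrib grad sum_distrib_right[symmetric] lap by (simp add: scaleR_add_right)
    then show ?thesis using True by (simp add: v_def partial_deriv_def)
  qed simp
  let ?G = "\<lambda>p. f p * cnj (\<psi> p) + grad_product u \<psi> p"
  have "(LINT p|vol. ?G p) = (LINT x|lborel. indicator ?S x *\<^sub>R dens i x *\<^sub>R ?G (inv_chart i x))"
  proof (rule integral_in_chart)
    have "continuous_on UNIV ?G"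
      by (intro continuous_intros f C1_fun_continuous[OF \<psi>] continuous_grad_product uC \<psi>)
    then show "?G \<in> borel_measurable borel" by (rule borel_measurable_continuous_onI)
    fix p assume "p \<notin> U i"
    then have p: "p \<in> - chart_ball i c r" by (auto simp: chart_ball_def)
    have "grad_product u \<psi> p = 0"
      by (rule grad_product_zero[OF uC \<psi> _ p])
        (use compact_chart_ball[OF c] zero in \<open>auto intro!: open_Compl compact_imp_closed\<close>)
    then show "?G p = 0" using zero p by simp
  qed
  also have "\<dots> = (\<Sum>a\<in>UNIV. LINT x|lborel. indicator ?S x *\<^sub>R frechet_derivative (F a) (at x) (axis a 1))"
    unfolding div_eq[symmetric] by (intro Bochner_Integration.integral_sum div)
  also have "\<dots> = 0" by (simp only: div sum.neutral_const)
  finally show ?thesis .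
qed

text \<open>
  Write \<open>\<psi>\<close> as the sum of its products with the normalised bump functions of a finite cover.
  Both sides are additive in \<open>\<psi>\<close> since the gradient product does not depend on the chart.
\<close>

theorem weak_laplacian:
  assumes u: "has_laplace_beltrami U \<kappa> g u f" and f: "continuous_on UNIV f" and \<psi>: "C1_fun \<psi>"
  shows "(LINT p|vol. f p * cnj (\<psi> p)) = - (LINT p|vol. grad_product u \<psi> p)"
proof -
  have uC: "C1_fun u" using u by (auto simp: has_laplace_beltrami_def intro: smooth_fun_C1)
  obtain B :: "('i \<times> (real^'n) \<times> real) set" where B: "finite B"
    "\<forall>i c r. (i, c, r) \<in> B \<longrightarrow> 0 < r \<and> cball c r \<subseteq> chart_image i"
    "\<forall>p. \<exists>(i, c, r)\<in>B. 0 < bump i c r p"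
    using finite_bump_cover by blast
  define b where "b t = (case t of (i, c, r) \<Rightarrow> bump i c r)" for t
  define s where "s p = (\<Sum>t\<in>B. b t p)" for p
  define \<psi>' where "\<psi>' t p = b t p *\<^sub>R inverse (s p) *\<^sub>R \<psi> p" for t p
  have bC: "C1_fun (b t)" if "t \<in> B" for t
    using that B(2) C1_fun_bump by (cases t) (auto simp: b_def)
  have sC: "C1_fun s" unfolding s_def[abs_def] by (rule C1_fun_sum) (rule bC)
  have s_pos: "0 < s p" for p
  proof -
    obtain t where t: "t \<in> B" "0 < b t p" using B(3) unfolding b_def by (metis (mono_tags, lifting) case_prod_beta)
    show ?thesis
      unfolding s_def by (rule sum_pos2[OF B(1) t(1)]) (use t(2) in \<open>auto simp: b_def bump_nonneg split: prod.split\<close>)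
  qed
  have \<psi>'C: "C1_fun (\<psi>' t)" if "t \<in> B" for t
    unfolding \<psi>'_def[abs_def]
    by (intro C1_fun_scaleR bC[OF that] C1_fun_inverse sC \<psi>) (metis s_pos less_irrefl)
  have sum: "\<psi> p = (\<Sum>t\<in>B. \<psi>' t p)" for p
  proof -
    have "(\<Sum>t\<in>B. b t p * c) = s p * c" for c by (simp add: s_def sum_distrib_right)
    moreover have "(\<Sum>t\<in>B. \<psi>' t p) = (\<Sum>t\<in>B. b t p * inverse (s p)) *\<^sub>R \<psi> p"
      by (simp add: \<psi>'_def scaleR_sum_left)
    ultimately show ?thesis using s_pos[of p] by simp
  qed
  have zero: "(LINT p|vol. f p * cnj (\<psi>' t p) + grad_product u (\<psi>' t) p) = 0" if t: "t \<in> B" for t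
  proof -
    obtain i c r where t_eq: "t = (i, c, r)" by (cases t)
    have r: "0 < r" "cball c r \<subseteq> chart_image i" using B(2) t t_eq by blast+
    show ?thesis
      by (rule weak_laplacian_chart[OF u f \<psi>'C[OF t] r(2)])
        (simp add: \<psi>'_def b_def t_eq bump_zero r)
  qed
  have int: "integrable vol (\<lambda>p. f p * cnj (v p))" "integrable vol (grad_product u v)" if "C1_fun v" for v
    by (intro integrable_continuous continuous_intros f C1_fun_continuous[OF that] continuous_grad_product uC that)+
  have "(LINT p|vol. f p * cnj (\<psi> p)) + (LINT p|vol. grad_product u \<psi> p)
      = (LINT p|vol. f p * cnj (\<psi> p) + grad_product u \<psi> p)"
    using int[OF \<psi>] by simp
  also have "\<dots> = (LINT p|vol. (\<Sum>t\<in>B. f p * cnj (\<psi>' t p) + grad_product u (\<psi>' t) p))"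
  proof (intro Bochner_Integration.integral_cong refl)
    fix p
    have "grad_product u \<psi> p = grad_product u (\<lambda>p. \<Sum>t\<in>B. \<psi>' t p) p"
      using sum by (metis ext)
    also have "\<dots> = (\<Sum>t\<in>B. grad_product u (\<psi>' t) p)"
      by (rule grad_product_sum[OF uC \<psi>'C B(1)])
    finally show "f p * cnj (\<psi> p) + grad_product u \<psi> p = (\<Sum>t\<in>B. f p * cnj (\<psi>' t p) + grad_product u (\<psi>' t) p)"
      by (simp add: sum[of p] sum.distrib sum_distrib_left)
  qed
  also have "\<dots> = (\<Sum>t\<in>B. LINT p|vol. f p * cnj (\<psi>' t p) + grad_product u (\<psi>' t) p)"
    using int \<psi>'C by (intro Bochner_Integration.integral_sum) auto
  also have "\<dots> = 0" using zero by simp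
  finally show ?thesis by (simp add: add_eq_0_iff)
qed

lemma laplacian_symmetric:
  assumes u: "has_laplace_beltrami U \<kappa> g u f" "continuous_on UNIV f"
    and v: "has_laplace_beltrami U \<kappa> g v h" "continuous_on UNIV h"
  shows "(LINT p|vol. f p * cnj (v p)) = (LINT p|vol. u p * cnj (h p))"
proof -
  have C: "C1_fun u" "C1_fun v" using u v by (auto simp: has_laplace_beltrami_def intro: smooth_fun_C1)
  have "(LINT p|vol. u p * cnj (h p)) = cnj (LINT p|vol. h p * cnj (u p))"
    unfolding Bochner_Integration.integral_cnj[symmetric] by (simp add: mult.commute)
  also have "\<dots> = - cnj (LINT p|vol. grad_product v u p)"
    using weak_laplacian[OF v C(1)] by simp
  also have "cnj (LINT p|vol. grad_product v u p) = (LINT p|vol. grad_product u v p)"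
    unfolding Bochner_Integration.integral_cnj[symmetric] grad_product_cnj[OF C] by simp
  finally show ?thesis using weak_laplacian[OF u C(2)] by simp
qed

lemma eigenfunction_continuous: "eigenfunction U \<kappa> g \<mu> u \<Longrightarrow> continuous_on UNIV u"
  by (auto simp: eigenfunction_def has_laplace_beltrami_def intro: C1_fun_continuous smooth_fun_C1)

text \<open>
  The eigenvalues are arbitrary complex numbers, so reality is not presupposed.
\<close>

lemma eigenfunctions_orthogonal:
  assumes u: "eigenfunction U \<kappa> g \<mu> u" and v: "eigenfunction U \<kappa> g \<nu> v" and ne: "\<mu> \<noteq> cnj \<nu>"
  shows "(LINT p|vol. u p * cnj (v p)) = 0"
proof -
  have "(LINT p|vol. - \<mu> * u p * cnj (v p)) = (LINT p|vol. u p * cnj (- \<nu> * v p))"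
    using u v by (intro laplacian_symmetric continuous_intros eigenfunction_continuous[OF u] eigenfunction_continuous[OF v])
      (auto simp: eigenfunction_def)
  moreover have "(LINT p|vol. - \<mu> * u p * cnj (v p)) = - \<mu> * (LINT p|vol. u p * cnj (v p))"
    by (simp only: mult.assoc Bochner_Integration.integral_mult_right_zero)
  moreover have "(LINT p|vol. u p * cnj (- \<nu> * v p)) = - cnj \<nu> * (LINT p|vol. u p * cnj (v p))"
    by (simp add: mult.left_commute[of _ "cnj \<nu>"])
  ultimately show ?thesis using ne by simp
qed

text \<open>
  Test the weak form with the constant function \<open>1\<close>.
\<close>

lemma eigenfunction_mean_zero:
  assumes u: "eigenfunction U \<kappa> g \<mu> u" and "\<mu> \<noteq> 0"
  shows "(LINT p|vol. u p) = 0"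
proof -
  have uC: "C1_fun u" using u by (auto simp: eigenfunction_def has_laplace_beltrami_def intro: smooth_fun_C1)
  have "(LINT p|vol. - \<mu> * u p * cnj 1) = - (LINT p|vol. grad_product u (\<lambda>p. 1) p)"
    using u by (intro weak_laplacian C1_fun_const continuous_intros eigenfunction_continuous[OF u]) (simp add: eigenfunction_def)
  then show ?thesis using assms(2) by (simp add: grad_product_const[OF uC])
qed

lemma laplace_linear_combination:
  assumes u: "has_laplace_beltrami U \<kappa> g u f" and v: "has_laplace_beltrami U \<kappa> g v h"
  shows "has_laplace_beltrami U \<kappa> g (\<lambda>p. u p + c * v p) (\<lambda>p. f p + c * h p)"
  unfolding has_laplace_beltrami_def
proof (intro conjI allI ballI)
  have su: "smooth_on (chart_image i) (u \<circ> inv_chart i)" and sv: "smooth_on (chart_image i) (v \<circ> inv_chart i)" for i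
    using u v by (auto simp: has_laplace_beltrami_def smooth_fun_def)
  show "smooth_fun U \<kappa> (\<lambda>p. u p + c * v p)"
    unfolding smooth_fun_def using smooth_on_linear_combination[OF open_image su sv] by (simp add: o_def)
  fix i p assume p: "p \<in> U i"
  let ?S = "chart_image i" and ?x = "\<kappa> i p"
  define flux where "flux w a x = (\<Sum>b\<in>UNIV. (dens i x * metric_inv i x a b) *\<^sub>R partial_deriv b (w \<circ> inv_chart i) x)" for w a x
  have flux: "flux w a differentiable at x" if "smooth_on ?S (w \<circ> inv_chart i)" "x \<in> ?S" for w a x
  proof -
    have "C1_on ?S (flux w a)"
      unfolding flux_def[abs_def] partial_deriv_def
      by (intro C1_on_sum C1_on_scaleR C1_on_mult C1_dens C1_metric_inv smooth_on_derivative_C1 that)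
    then show ?thesis using that(2) unfolding C1_on_def by blast
  qed
  have lin: "flux (\<lambda>p. u p + c * v p) a x = flux u a x + c * flux v a x" if "x \<in> ?S" for a x
  proof -
    have "partial_deriv b ((\<lambda>p. u p + c * v p) \<circ> inv_chart i) x =
      partial_deriv b (u \<circ> inv_chart i) x + c * partial_deriv b (v \<circ> inv_chart i) x" for b
      using partial_deriv_add_scale[OF C1_on_differentiable[OF smooth_on_C1[OF su[of i]] that]
          C1_on_differentiable[OF smooth_on_C1[OF sv[of i]] that]] by (simp add: o_def)
    then show ?thesis
      by (simp add: flux_def sum.distrib scaleR_add_right sum_distrib_left)
  qed
  have "partial_deriv a (flux (\<lambda>p. u p + c * v p) a) ?x = partial_deriv a (flux u a) ?x + c * partial_deriv a (flux v a) ?x" for a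
  proof -
    have "partial_deriv a (flux (\<lambda>p. u p + c * v p) a) ?x = partial_deriv a (\<lambda>x. flux u a x + c * flux v a x) ?x"
      by (rule partial_deriv_cong[OF open_image]) (use p lin in auto)
    also have "\<dots> = partial_deriv a (flux u a) ?x + c * partial_deriv a (flux v a) ?x"
      using p by (intro partial_deriv_add_scale flux su sv) auto
    finally show ?thesis .
  qed
  moreover have "laplace_coord (g i) (w \<circ> inv_chart i) ?x = (1 / dens i ?x) *\<^sub>R (\<Sum>a\<in>UNIV. partial_deriv a (flux w a) ?x)" for w
    by (simp add: laplace_coord_def flux_def[abs_def])
  moreover have "f p = laplace_coord (g i) (u \<circ> inv_chart i) ?x" "h p = laplace_coord (g i) (v \<circ> inv_chart i) ?x"
    using u v p by (auto simp: has_laplace_beltrami_def)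
  ultimately show "f p + c * h p = laplace_coord (g i) ((\<lambda>p. u p + c * v p) \<circ> inv_chart i) ?x"
    by (simp add: sum.distrib sum_distrib_left[symmetric] scaleR_add_right)
qed

lemma laplace_zero: "has_laplace_beltrami U \<kappa> g (\<lambda>p. 0) (\<lambda>p. 0)"
  by (auto simp: has_laplace_beltrami_def smooth_fun_def smooth_on_def Ck_on_const o_def laplace_coord_def partial_deriv_def)

end

section \<open>Eigenfunctions and the observability limits\<close>

lemma finite_measure_completion:
  assumes "finite_measure M" shows "finite_measure (completion M)"
proof
  interpret finite_measure M by fact
  show "emeasure (completion M) (space (completion M)) \<noteq> \<infinity>"
    by (simp add: emeasure_completion)
qed

text \<open>
  A closed Riemannian manifold with the completed volume measure and a Hilbert basis of
  eigenfunctions, ordered by frequency.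
\<close>

locale riemannian_spectrum = riemannian_measure U \<kappa> g vol
  for U :: "'i \<Rightarrow> 'm::{t2_space, second_countable_topology} set"
    and \<kappa> :: "'i \<Rightarrow> 'm \<Rightarrow> real^'n" and g and vol +
  fixes M :: "'m measure" and \<phi> :: "nat \<Rightarrow> 'm \<Rightarrow> complex" and lam :: "nat \<Rightarrow> real"
  assumes M_eq: "M = completion vol" and basis: "hilbert_basis M \<phi>"
    and eigen: "eigenfunction U \<kappa> g (of_real ((lam j)\<^sup>2)) (\<phi> j)"
    and lam0: "0 < lam 0" and lam_mono: "mono lam" and lam_lim: "filterlim lam at_top sequentially"
begin

lemma lam_pos: "0 < lam j"
  using lam0 monoD[OF lam_mono, of 0 j] by simp

sublocale spectral: spectral_basis M \<phi> lam
proof -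
  interpret completed: finite_measure M unfolding M_eq by (rule finite_measure_completion[OF finite_vol])
  show "spectral_basis M \<phi> lam" by unfold_locales (use basis lam_pos in auto)
qed

lemma space_M [simp]: "space M = UNIV"
  by (simp add: M_eq)

lemma measurable_M: "continuous_on UNIV h \<Longrightarrow> h \<in> borel_measurable M" for h :: "'m \<Rightarrow> complex"
  unfolding M_eq by (rule measurable_completion[OF continuous_measurable])

lemma integral_M: "continuous_on UNIV h \<Longrightarrow> (LINT x|M. h x) = (LINT x|vol. h x)" for h :: "'m \<Rightarrow> complex"
  unfolding M_eq by (rule integral_completion[OF continuous_measurable])

lemma continuous_L2:
  fixes h :: "'m \<Rightarrow> complex"
  assumes h: "continuous_on UNIV h" shows "h \<in> L2 M"
proof -
  obtain B where B: "\<And>p. cmod (h p) \<le> B"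
    using compact_imp_bounded[OF compact_continuous_image[OF h compact_manifold]] by (auto simp: bounded_iff)
  have "integrable M (\<lambda>x. (cmod (h x))\<^sup>2)"
    by (rule spectral.integrable_const_bound[where B = "B\<^sup>2"])
      (use measurable_M[OF h] B in \<open>auto intro!: power_mono\<close>)
  then show ?thesis using measurable_M[OF h] by (simp add: L2_def)
qed

lemma continuous_AE_M:
  fixes h :: "'m \<Rightarrow> complex"
  assumes "continuous_on UNIV h" "AE p in M. h p = 0" shows "h p = 0"
proof (rule AE_zero_imp_zero[OF assms(1)])
  show "AE p in vol. h p = 0" using assms(2) unfolding M_eq AE_completion_iff .
qed

lemma phi_continuous: "continuous_on UNIV (\<phi> j)"
  by (rule eigenfunction_continuous[OF eigen])

lemma inner_eigenfunction:
  assumes u: "eigenfunction U \<kappa> g \<mu> u" and nz: "L2_inner M u (\<phi> j) \<noteq> 0"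
  shows "\<mu> = of_real ((lam j)\<^sup>2)"
proof (rule ccontr)
  assume "\<mu> \<noteq> of_real ((lam j)\<^sup>2)"
  then have "(LINT p|vol. u p * cnj (\<phi> j p)) = 0"
    by (intro eigenfunctions_orthogonal[OF u eigen]) simp
  moreover have "L2_inner M u (\<phi> j) = (LINT p|vol. u p * cnj (\<phi> j p))"
    unfolding L2_inner_def
    by (intro integral_M continuous_intros eigenfunction_continuous[OF u] phi_continuous)
  ultimately show False using nz by simp
qed

text \<open>
  If all coefficients of \<open>u\<close> vanish, then \<open>u\<close> minus its mean vanishes almost everywhere, hence
  everywhere by continuity.
\<close>

lemma nonconstant_has_coefficient:
  assumes u: "continuous_on UNIV u" and nc: "\<not> (\<exists>c. \<forall>p. u p = c)"
  shows "\<exists>j. L2_inner M u (\<phi> j) \<noteq> 0"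
proof (rule ccontr)
  assume "\<not> (\<exists>j. L2_inner M u (\<phi> j) \<noteq> 0)"
  then have z: "L2_inner M u (\<phi> j) = 0" for j by blast
  define m where "m = (LINT x|M. u x) / of_real (measure M UNIV)"
  have M0: "measure M UNIV \<noteq> 0"
  proof -
    have "emeasure M UNIV = emeasure vol UNIV" unfolding M_eq by (simp add: emeasure_completion)
    then have "emeasure M UNIV \<noteq> 0" using emeasure_open_pos[of UNIV] by simp
    then show ?thesis by (simp add: spectral.emeasure_eq_measure)
  qed
  have mL2: "(\<lambda>x. m) \<in> L2 M" by (intro continuous_L2) simp
  have uL2: "u \<in> L2 M" by (rule continuous_L2[OF u])
  have int: "integrable M u" by (rule L2_integrable[OF spectral.finite_measure_axioms uL2])
  have v: "(\<lambda>x. u x - m) \<in> L2_zero_mean M"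
  proof -
    have "(LINT x|M. u x - m) = 0" using int M0 by (simp add: m_def scaleR_conv_of_real)
    then show ?thesis by (simp only: L2_zero_mean_def mem_Collect_eq L2_diff[OF uL2 mL2] simp_thms)
  qed
  have "L2_inner M (\<lambda>x. m) (\<phi> j) = 0" for j
  proof -
    have "(LINT x|M. cnj (\<phi> j x)) = cnj (LINT x|M. \<phi> j x)" by (rule Bochner_Integration.integral_cnj)
    also have "\<dots> = 0" using spectral.phi_zero_mean by (simp add: L2_zero_mean_def)
    finally show ?thesis by (simp add: L2_inner_def)
  qed
  then have "L2_inner M (\<lambda>x. u x - m) (\<phi> j) = 0" for j
    by (simp add: L2_inner_diff_left uL2 mL2 z)
  with spectral.parseval[OF v] have "(\<lambda>n. 0) \<longlonglongrightarrow> (LINT x|M. (cmod (u x - m))\<^sup>2)"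
    by (simp add: sqnorm_def)
  then have "(LINT x|M. (cmod (u x - m))\<^sup>2) = 0" by (simp add: LIMSEQ_const_iff)
  then have "AE x in M. u x - m = 0"
    using integral_nonneg_eq_0_iff_AE[OF L2_D(2)[OF L2_diff[OF uL2 mL2]]] by simp
  then have "u p - m = 0" for p
    by (rule continuous_AE_M[rotated]) (intro continuous_intros u)
  then show False using nc by auto
qed

text \<open>
  A nonconstant eigenfunction has nonzero coefficients only at its own eigenvalue, so it is a
  finite combination of basis functions with one frequency.
\<close>

lemma eigenfunction_expansion:
  assumes u: "u \<in> nonconstant_eigenfunctions U \<kappa> g" and \<omega>: "\<omega> \<in> sets M"
  shows "\<exists>n c. one_frequency lam n c \<and> 0 < sqnorm n c \<and>
    mass_ratio M \<omega> u = qform (gram M \<phi> \<omega>) n c / sqnorm n c"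
proof -
  obtain \<mu> where \<mu>: "eigenfunction U \<kappa> g \<mu> u" and nc: "\<not> (\<exists>c. \<forall>p. u p = c)"
    using u by (auto simp: nonconstant_eigenfunctions_def)
  have cont: "continuous_on UNIV u" by (rule eigenfunction_continuous[OF \<mu>])
  define a where "a j = L2_inner M u (\<phi> j)" for j
  obtain j where j: "a j \<noteq> 0" using nonconstant_has_coefficient[OF cont nc] by (auto simp: a_def)
  have \<mu>_eq: "\<mu> = of_real ((lam k)\<^sup>2)" if "a k \<noteq> 0" for k
    using inner_eigenfunction[OF \<mu>] that by (simp add: a_def)
  have same: "lam k = lam j" if "a k \<noteq> 0" for k
  proof -
    have "complex_of_real ((lam k)\<^sup>2) = of_real ((lam j)\<^sup>2)" using \<mu>_eq[OF that] \<mu>_eq[OF j] by simp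
    then have "(lam k)\<^sup>2 = (lam j)\<^sup>2" by (simp only: of_real_eq_iff)
    then show ?thesis using lam_pos[of k] lam_pos[of j] by (simp add: power2_eq_iff_nonneg less_imp_le)
  qed
  obtain n where n: "\<And>k. n \<le> k \<Longrightarrow> lam j < lam k"
    using lam_lim[unfolded filterlim_at_top_dense, rule_format, of "lam j"] by (auto simp: eventually_sequentially)
  have a0: "a k = 0" if "n \<le> k" for k using same[of k] n[OF that] by auto
  have "\<mu> \<noteq> 0" using \<mu>_eq[OF j] lam_pos[of j] by simp
  then have "(LINT x|M. u x) = 0"
    using eigenfunction_mean_zero[OF \<mu>] integral_M[OF cont] by simp
  then have zm: "u \<in> L2_zero_mean M" by (simp add: L2_zero_mean_def continuous_L2[OF cont])
  have exp: "L2_sums M (\<lambda>j x. a j * \<phi> j x) u" using spectral.expansion[OF zm] by (simp add: a_def)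
  have ext: "\<forall>k\<ge>n. a k = 0" using a0 by blast
  have "(\<lambda>m. sqnorm m a) \<longlonglongrightarrow> sqnorm n a"
    by (rule tendsto_eventually, rule eventually_sequentiallyI, rule sqnorm_extend[OF ext])
  then have norm: "(LINT x|M. (cmod (u x))\<^sup>2) = sqnorm n a"
    by (rule LIMSEQ_unique[OF spectral.L2_sums_norm[OF exp]])
  have "(\<lambda>m. qform (gram M \<phi> \<omega>) m a) \<longlonglongrightarrow> qform (gram M \<phi> \<omega>) n a"
    by (rule tendsto_eventually, rule eventually_sequentiallyI, rule qform_extend[OF ext])
  then have mass: "(LINT x:\<omega>|M. (cmod (u x))\<^sup>2) = qform (gram M \<phi> \<omega>) n a"
    by (rule LIMSEQ_unique[OF spectral.L2_sums_energy[OF exp \<omega>]])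
  have "one_frequency lam n a"
    by (rule one_frequencyI[where \<mu> = "lam j"]) (use a0 same in auto)
  moreover have "0 < sqnorm n a"
  proof -
    have "j < n" using a0[of j] j by (cases "j < n") auto
    then have "(cmod (a j))\<^sup>2 \<le> sqnorm n a" unfolding sqnorm_def by (intro member_le_sum) auto
    moreover have "0 < (cmod (a j))\<^sup>2" using j by simp
    ultimately show ?thesis by linarith
  qed
  ultimately show ?thesis using norm mass by (auto simp: mass_ratio_def)
qed

text \<open>
  Conversely, a nonzero combination with one frequency is an eigenfunction; it is not constant
  because its mean is zero.
\<close>

lemma combination_is_eigenfunction:
  assumes c: "one_frequency lam n c" and pos: "0 < sqnorm n c" and \<omega>: "\<omega> \<in> sets M"
  shows "\<exists>u\<in>nonconstant_eigenfunctions U \<kappa> g. mass_ratio M \<omega> u = qform (gram M \<phi> \<omega>) n c / sqnorm n c"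
proof -
  obtain \<mu> where \<mu>: "\<And>k. c k \<noteq> 0 \<Longrightarrow> lam k = \<mu>"
    using c unfolding one_frequency_def by (metis mult_eq_0_iff)
  define u where "u x = (\<Sum>k<n. c k * \<phi> k x)" for x
  have u_eq: "u = (\<lambda>x. \<Sum>k<n. c k * \<phi> k x)" by (simp add: u_def fun_eq_iff)
  have lapN: "has_laplace_beltrami U \<kappa> g (\<lambda>x. \<Sum>k<N. c k * \<phi> k x) (\<lambda>x. \<Sum>k<N. c k * (- of_real ((lam k)\<^sup>2) * \<phi> k x))" for N
  proof (induction N)
    case 0 then show ?case by (simp add: laplace_zero)
  next
    case (Suc N)
    have "has_laplace_beltrami U \<kappa> g (\<phi> N) (\<lambda>x. - of_real ((lam N)\<^sup>2) * \<phi> N x)"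
      using eigen by (simp add: eigenfunction_def)
    from laplace_linear_combination[OF Suc.IH this, of "c N"] show ?case by simp
  qed
  have eq: "(\<lambda>x. \<Sum>k<n. c k * (- of_real ((lam k)\<^sup>2) * \<phi> k x)) = (\<lambda>x. - of_real (\<mu>\<^sup>2) * u x)"
  proof
    fix x
    have "c k * (- of_real ((lam k)\<^sup>2) * \<phi> k x) = - of_real (\<mu>\<^sup>2) * (c k * \<phi> k x)" for k
      using \<mu>[of k] by (cases "c k = 0") auto
    then show "(\<Sum>k<n. c k * (- of_real ((lam k)\<^sup>2) * \<phi> k x)) = - of_real (\<mu>\<^sup>2) * u x"
      by (simp only: u_def sum_distrib_left)
  qed
  have lap: "has_laplace_beltrami U \<kappa> g u (\<lambda>x. - of_real (\<mu>\<^sup>2) * u x)"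
    using lapN[of n] unfolding eq u_eq[symmetric] .
  have norm: "(LINT x|M. (cmod (u x))\<^sup>2) = sqnorm n c"
    unfolding u_def by (rule spectral.integral_combination)
  have mean: "(LINT x|M. u x) = 0"
    using spectral.combination_zero_mean[of c n] by (simp add: L2_zero_mean_def u_def)
  have nc: "\<not> (\<exists>d. \<forall>p. u p = d)"
  proof
    assume "\<exists>d. \<forall>p. u p = d"
    then obtain d where d: "\<And>p. u p = d" by blast
    then have "d = 0 \<or> measure M UNIV = 0" using mean by (auto simp: scaleR_conv_of_real)
    then show False using norm pos d by auto
  qed
  then have "\<exists>p. u p \<noteq> 0" by metis
  with lap nc have "u \<in> nonconstant_eigenfunctions U \<kappa> g"
    unfolding nonconstant_eigenfunctions_def eigenfunction_def by blast
  moreover have "(LINT x:\<omega>|M. (cmod (u x))\<^sup>2) = qform (gram M \<phi> \<omega>) n c"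
    unfolding u_def by (rule set_integral_combination[OF \<omega> spectral.phi_L2])
  ultimately show ?thesis using norm by (intro bexI[of _ u]) (simp_all add: mass_ratio_def)
qed

end

theorem theorem2:
  fixes U :: "'i \<Rightarrow> 'm::{t2_space, second_countable_topology} set"
    and \<kappa> :: "'i \<Rightarrow> 'm \<Rightarrow> real^'n"
    and g :: "'i \<Rightarrow> real^'n \<Rightarrow> real^'n^'n"
    and vol M :: "'m measure"
    and \<phi> :: "nat \<Rightarrow> 'm \<Rightarrow> complex"
    and lam :: "nat \<Rightarrow> real"
    and \<omega> :: "'m set"
  assumes "closed_riemannian_manifold U \<kappa> g"
    and "riemannian_volume U \<kappa> g vol"
    and "M = completion vol"
    and "hilbert_basis M \<phi>"
    and "\<And>j. eigenfunction U \<kappa> g (of_real ((lam j)\<^sup>2)) (\<phi> j)"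
    and "0 < lam 0" and "mono lam" and "filterlim lam at_top sequentially"
    and "\<omega> \<in> sets M"
  shows "\<exists>\<alpha>::real.
    ((\<lambda>T. high_freq_const M lam \<phi> \<omega> T) \<longlongrightarrow> \<alpha>) at_top \<and>
    ((\<lambda>T. obs_const M lam \<phi> \<omega> T / T) \<longlongrightarrow> min (1/2 * g1 U \<kappa> g M \<omega>) \<alpha>) at_top \<and>
    (1/2 * g1 U \<kappa> g M \<omega> < \<alpha> \<longrightarrow>
       (\<exists>u\<in>nonconstant_eigenfunctions U \<kappa> g. mass_ratio M \<omega> u = g1 U \<kappa> g M \<omega>))"
proof -
  interpret riemannian_spectrum U \<kappa> g vol M \<phi> lam
    by (intro riemannian_spectrum.intro riemannian_measure.intro riemannian_measure_axioms.intro
        riemannian_spectrum_axioms.intro assms)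
  interpret gram_bounds "gram M \<phi> \<omega>" by (rule spectral.gram_bounds_gram[OF assms(9)])
  let ?E = "nonconstant_eigenfunctions U \<kappa> g" and ?r = "mass_ratio M \<omega>" and ?g = "g1 U \<kappa> g M \<omega>"
  obtain \<alpha> c where \<alpha>: "((\<lambda>T. lim (\<lambda>N. 1 / T * obs_const_above M lam \<phi> N \<omega> T)) \<longlongrightarrow> \<alpha>) at_top"
    and c: "((\<lambda>T. obs_const_above M lam \<phi> 0 \<omega> T / T) \<longlongrightarrow> c) at_top" "c \<le> \<alpha>"
    and lower: "\<And>n u. one_frequency lam n u \<Longrightarrow> 2 * c * sqnorm n u \<le> qform (gram M \<phi> \<omega>) n u"
    and attained: "c < \<alpha> \<Longrightarrow> \<exists>n u. one_frequency lam n u \<and> sqnorm n u = 1 \<and> qform (gram M \<phi> \<omega>) n u \<le> 2 * c"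
    using observability_limits[where C = "\<lambda>N. obs_const_above M lam \<phi> N \<omega>",
          OF lam0 lam_mono lam_lim spectral.obs_const_above_iff_observes[OF assms(9)]] by blast
  have ge: "2 * c \<le> ?r u" if u: "u \<in> ?E" for u
  proof -
    obtain n a where a: "one_frequency lam n a" "0 < sqnorm n a" "?r u = qform (gram M \<phi> \<omega>) n a / sqnorm n a"
      using eigenfunction_expansion[OF u assms(9)] by blast
    then show ?thesis using lower[OF a(1)] by (simp add: pos_le_divide_eq)
  qed
  have bdd: "bdd_below (?r ` ?E)" using ge by (rule bdd_belowI2)
  have ne: "?E \<noteq> {}"
  proof -
    let ?a = "\<lambda>k. if k = 0 then 1 else 0 :: complex"
    have "one_frequency lam 1 ?a" by (rule one_frequencyI[where \<mu> = "lam 0"]) (auto split: if_splits)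
    moreover have "0 < sqnorm 1 ?a" by (simp add: sqnorm_def)
    ultimately show ?thesis using combination_is_eigenfunction[OF _ _ assms(9)] by blast
  qed
  have g_ge: "2 * c \<le> ?g" unfolding g1_def by (rule cINF_greatest[OF ne ge])
  have g_eq: "?g = 2 * c \<and> (\<exists>u\<in>?E. ?r u = ?g)" if less: "c < \<alpha>"
  proof -
    obtain n a where a: "one_frequency lam n a" "sqnorm n a = 1" "qform (gram M \<phi> \<omega>) n a \<le> 2 * c"
      using attained[OF less] by blast
    then obtain u where u: "u \<in> ?E" "?r u \<le> 2 * c"
      using combination_is_eigenfunction[OF a(1) _ assms(9)] by auto
    have "?g \<le> ?r u" unfolding g1_def by (rule cINF_lower[OF bdd u(1)])
    then have "?g = 2 * c" "?r u = ?g" using u(2) g_ge by linarith+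
    then show ?thesis using u(1) by blast
  qed
  \<comment> \<open>if \<open>c < \<alpha>\<close> then \<open>?g = 2 * c\<close>; otherwise \<open>c = \<alpha> \<le> ?g / 2\<close>\<close>
  have min: "min (1/2 * ?g) \<alpha> = c"
    using c(2) g_ge g_eq by (cases "c < \<alpha>") auto
  show ?thesis
  proof (intro exI[of _ \<alpha>] conjI impI)
    show "((\<lambda>T. high_freq_const M lam \<phi> \<omega> T) \<longlongrightarrow> \<alpha>) at_top"
      using \<alpha> by (simp add: high_freq_const_def)
    show "((\<lambda>T. obs_const M lam \<phi> \<omega> T / T) \<longlongrightarrow> min (1/2 * ?g) \<alpha>) at_top"
      unfolding min spectral.obs_const_eq by (rule c(1))
    assume "1/2 * ?g < \<alpha>"
    then have "c < \<alpha>" using g_ge by linarith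
    then show "\<exists>u\<in>?E. ?r u = ?g" using g_eq by blast
  qed
qed

end
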